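(* Let $d\ge2$, $\{r_n\}\subset(0,1)$ and $\{s_n\}\subset(1,+\infty)$ with $r_n\to0^+$ and $s_n\to1^+$. Then: (i) (Compactness) If $U\subset\mathbb{R}^d$ is open and bounded and $\{E_n\}$ are measurable with $E_n\subset U$ and $\tilde J^{s_n}_{r_n}(E_n)\le M\beta(r_n,s_n)$ for all $n$, with $M$ independent of $n$, then, up to a subsequence, $\chi_{E_n}\to\chi_E$ strongly in $L^1(\mathbb{R}^d)$ for some measurable $E$ of finite measure with $\mathrm{Per}(E)<+\infty$. (ii) (Lower bound) If $E$ is measurable with finite measure and $\{E_n\}$ are measurable of finite measure with $\chi_{E_n}\to\chi_E$ in $L^1(\mathbb{R}^d)$, then $\omega_{d-1}\mathrm{Per}(E)\le\liminf_{n\to\infty}\frac{\tilde J^{s_n}_{r_n}(E_n)}{\beta(r_n,s_n)}$. (iii) (Upper bound) For every measurable $E$ of finite measure there exist measurable $E_n$ of finite measure with $\chi_{E_n}\to\chi_E$ in $L^1(\mathbb{R}^d)$ and $\omega_{d-1}\mathrm{Per}(E)=\limsup_{n\to\infty}\frac{\tilde J^{s_n}_{r_n}(E_n)}{\beta(r_n,s_n)}$.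
   Context: $k^s_r(t)=r^{-d-s}$ for $0\le t\le r$ and $k^s_r(t)=t^{-d-s}$ for $t>r$; $\tilde J_r^s(E):=\int_E\int_{\mathbb{R}^d\setminus E}k^s_r(|x-y|)\,dy\,dx$ for measurable $E$ of finite measure. $\beta(r,s):=\frac{d+s}{d+1}\frac{r^{1-s}-1}{s-1}+\frac1{d+1}$ for $r\in(0,1)$, $s>1$. $\omega_{d-1}$ is the measure of the unit ball of $\mathbb{R}^{d-1}$; $\mathrm{Per}$ is the De Giorgi perimeter. *)

theory Defs
  imports "HOL-Analysis.Analysis"
begin

definition kern :: "nat \<Rightarrow> real \<Rightarrow> real \<Rightarrow> real \<Rightarrow> real" where
  "kern d r s t = (if t \<le> r then r powr (- real d - s) else t powr (- real d - s))"

definition Jt :: "real \<Rightarrow> real \<Rightarrow> ('a::euclidean_space) set \<Rightarrow> ennreal" where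
  "Jt r s E = (\<integral>\<^sup>+ x. (\<integral>\<^sup>+ y. indicator E x * indicator (UNIV - E) y
        * ennreal (kern DIM('a) r s (dist x y)) \<partial>lebesgue) \<partial>lebesgue)"

definition beta :: "nat \<Rightarrow> real \<Rightarrow> real \<Rightarrow> real" where
  "beta d r s = (real d + s) / (real d + 1) * ((r powr (1 - s) - 1) / (s - 1)) + 1 / (real d + 1)"

definition test_fields :: "(('a::euclidean_space \<Rightarrow> 'a) \<times> ('a \<Rightarrow> 'a \<Rightarrow>\<^sub>L 'a)) set" where
  "test_fields = {(\<phi>, D). (\<forall>x. (\<phi> has_derivative blinfun_apply (D x)) (at x))
      \<and> continuous_on UNIV D \<and> bounded {x. \<phi> x \<noteq> 0} \<and> (\<forall>x. norm (\<phi> x) \<le> 1)}"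

definition divg :: "('a::euclidean_space \<Rightarrow> 'a \<Rightarrow>\<^sub>L 'a) \<Rightarrow> 'a \<Rightarrow> real" where
  "divg D x = (\<Sum>i\<in>Basis. blinfun_apply (D x) i \<bullet> i)"

definition Per :: "('a::euclidean_space) set \<Rightarrow> ennreal" where
  "Per E = (SUP p \<in> test_fields. ennreal (\<integral>x. indicator E x * divg (snd p) x \<partial>lebesgue))"

definition L1_conv :: "(nat \<Rightarrow> ('a::euclidean_space) set) \<Rightarrow> 'a set \<Rightarrow> bool" where
  "L1_conv F E \<longleftrightarrow> (\<lambda>n. \<integral>\<^sup>+ x. ennreal \<bar>indicator (F n) x - indicator E x\<bar> \<partial>lebesgue) \<longlonglongrightarrow> 0"

end

theory Submission
  imports Defs "HOL-Complex_Analysis.Great_Picard"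
begin

text \<open>
  Write \<open>N(h)\<close> for the \<open>L\<^sup>1\<close> distance between the indicator of \<open>E\<close> and its translate by \<open>h\<close>,
  and \<open>B(\<tau>)\<close> for the integral of \<open>N\<close> over the ball of radius \<open>\<tau>\<close>. Since the kernel is a superposition of
  indicators of balls, twice the energy is the integral of \<open>(d + s) \<tau>\<^bsup>-d-s-1\<^esup> B(\<tau>)\<close> over \<open>\<tau> \<ge> r\<close>, and
  \<open>\<beta>(r,s)\<close> is, up to the bounded term \<open>1/(d+1)\<close>, what this integral gives on \<open>[r,1]\<close> for
  \<open>B(\<tau>) = 2\<tau>\<^bsup>d+1\<^esup>/(d+1)\<close>. As \<open>\<beta> \<rightarrow> \<infinity>\<close>, only small \<open>\<tau>\<close> matter.

  Let \<open>u\<close> be a mollification of the indicator. Its translation differences agree with \<open>\<integral>|\<nabla>u \<cdot> h|\<close> up to \<open>O(|h|\<^sup>2)\<close>,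
  and integrating \<open>|v \<cdot> h|\<close> over the ball gives \<open>2 \<omega>\<^bsub>d-1\<^esub> \<tau>\<^bsup>d+1\<^esup> |v| / (d+1)\<close>. Moreover \<open>\<integral>|\<nabla>u| \<le> Per(E)\<close>, because
  mollifying the bounded field \<open>sgn \<nabla>u\<close> yields a test field; this bounds \<open>B\<close> from above, so that the constant
  sequence is a recovery sequence. Conversely, testing \<open>\<nabla>u\<close> against a fixed test field bounds \<open>B\<close> from below in a way
  that is stable under \<open>L\<^sup>1\<close> convergence, which gives the lower bound.

  For compactness, subadditivity of \<open>N\<close> yields \<open>B(t) \<le> (2t/\<tau>)\<^bsup>d+1\<^esup> B(\<tau>)\<close> for \<open>\<tau> \<le> t\<close>, so bounded energy forces
  \<open>B(t) = O(t\<^bsup>d+1\<^esup>)\<close> for every fixed \<open>t\<close> and large \<open>n\<close>; the sets are then uniformly \<open>L\<^sup>1\<close>-close to their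
  mollifications, which are equi-Lipschitz.
\<close>

section \<open>Lebesgue measure under isometries\<close>

text \<open>The lower bound fixes the order of the limits. The kernel is chosen from the test field
  alone, then the index tends to infinity, and only at the end does the mollification scale tend to
  0. This works because the Taylor error adds to \<open>B(\<tau>)\<close> a term of order
  \<open>\<tau>\<close> to the power \<open>d + 2\<close>, with a constant depending only on the
  kernel and the measure of the set. In the energy it becomes a multiple of the integral of
  \<open>\<tau> powr (1 - s)\<close> over \<open>[r,1]\<close>, which stays bounded as
  \<open>s\<close> tends to 1 and disappears after division by \<open>\<beta>\<close>. The speeds of
  \<open>r\<close> and \<open>s\<close> may be related in any way, since \<open>\<beta>\<close> is
  at least \<open>- ln r\<close> for every \<open>s > 1\<close>. In the upper bound the constant has
  to be exact, so the Taylor error must vanish altogether, which subdividing \<open>h\<close>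
  achieves. Radii above 1 are treated by the measure of \<open>E\<close>: the perimeter bound would
  cost a multiple of \<open>1 / (s - 1)\<close> there, which can exceed \<open>\<beta>\<close> by
  any factor. All integrals are computed for Borel sets, where Tonelli's theorem on products is
  available; Lebesgue measurable sets enter through Borel representatives.\<close>

lemma cball_in_sets_borel [measurable]: "cball (a::'a::euclidean_space) r \<in> sets borel"
  by simp

lemma nn_integral_lborel_shift:
  fixes f :: "'a::euclidean_space \<Rightarrow> ennreal"
  assumes [measurable]: "f \<in> borel_measurable borel"
  shows "(\<integral>\<^sup>+x. f (x + a) \<partial>lborel) = (\<integral>\<^sup>+x. f x \<partial>lborel)"
proof -
  have "(\<integral>\<^sup>+x. f x \<partial>lborel) = (\<integral>\<^sup>+x. f x \<partial>distr lborel borel ((+) a))"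
    by (simp only: lborel_distr_plus)
  also have "\<dots> = (\<integral>\<^sup>+x. f (a + x) \<partial>lborel)"
    by (subst nn_integral_distr) auto
  finally show ?thesis by (simp add: add.commute)
qed

lemma nn_integral_lborel_scale:
  fixes f :: "'a::euclidean_space \<Rightarrow> ennreal"
  assumes [measurable]: "f \<in> borel_measurable borel" and "c \<noteq> 0"
  shows "(\<integral>\<^sup>+x. f x \<partial>lborel) = ennreal (\<bar>c\<bar> ^ DIM('a)) * (\<integral>\<^sup>+x. f (c *\<^sub>R x) \<partial>lborel)"
proof -
  have "(\<integral>\<^sup>+x. f x \<partial>lborel) = (\<integral>\<^sup>+x. f x \<partial>density (distr lborel borel (\<lambda>x. 0 + c *\<^sub>R x)) (\<lambda>_. \<bar>c\<bar> ^ DIM('a)))"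
    by (simp only: lborel_affine[OF \<open>c \<noteq> 0\<close>, of "0::'a", symmetric])
  also have "\<dots> = ennreal (\<bar>c\<bar> ^ DIM('a)) * (\<integral>\<^sup>+x. f (c *\<^sub>R x) \<partial>lborel)"
    by (simp add: nn_integral_density nn_integral_distr nn_integral_cmult)
  finally show ?thesis .
qed

lemma nn_integral_lborel_uminus:
  fixes f :: "'a::euclidean_space \<Rightarrow> ennreal"
  assumes "f \<in> borel_measurable borel"
  shows "(\<integral>\<^sup>+x. f (- x) \<partial>lborel) = (\<integral>\<^sup>+x. f x \<partial>lborel)"
  using nn_integral_lborel_scale[OF assms, of "-1"] by simp

lemma nn_integral_lborel_reflect:
  fixes f :: "'a::euclidean_space \<Rightarrow> ennreal"
  assumes [measurable]: "f \<in> borel_measurable borel"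
  shows "(\<integral>\<^sup>+x. f (a - x) \<partial>lborel) = (\<integral>\<^sup>+x. f x \<partial>lborel)"
  using nn_integral_lborel_uminus[of "\<lambda>x. f (x + a)"] nn_integral_lborel_shift[of f a] by simp

lemma lborel_Tonelli:
  fixes f :: "'a::euclidean_space \<Rightarrow> 'b::euclidean_space \<Rightarrow> ennreal"
  assumes "(\<lambda>p. f (fst p) (snd p)) \<in> borel_measurable (borel \<Otimes>\<^sub>M borel)"
  shows "(\<integral>\<^sup>+x. \<integral>\<^sup>+y. f x y \<partial>lborel \<partial>lborel) = (\<integral>\<^sup>+y. \<integral>\<^sup>+x. f x y \<partial>lborel \<partial>lborel)"
proof -
  have "(\<lambda>p. f (fst p) (snd p)) \<in> borel_measurable (lborel \<Otimes>\<^sub>M lborel)"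
    using assms by (simp cong: measurable_cong_sets)
  from lborel_pair.Fubini[OF this] show ?thesis by simp
qed

text \<open>The image of Lebesgue measure under an isometry is translation invariant; Fubini's theorem
  applied to the product of the indicators of \<open>A\<close> and the unit ball identifies it.\<close>

lemma nn_integral_lborel_isometry:
  fixes f :: "'a::euclidean_space \<Rightarrow> 'a"
  assumes lin: "linear f" and nrm: "\<And>x. norm (f x) = norm x"
    and [measurable]: "g \<in> borel_measurable borel"
  shows "(\<integral>\<^sup>+x. g (f x) \<partial>lborel) = (\<integral>\<^sup>+x. g x \<partial>lborel)"
proof -
  have fm[measurable]: "f \<in> borel_measurable borel"
    using lin by (intro borel_measurable_continuous_onI linear_continuous_on)
      (auto simp: linear_conv_bounded_linear)
  have "inj f"
    using nrm lin by (metis linear_injective_0 norm_eq_zero)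
  then have surj: "surj f"
    using lin linear_injective_imp_surjective by blast
  define B where "B = (cball 0 1 :: 'a set)"
  have [measurable]: "B \<in> sets borel" by (simp add: B_def)
  have key: "emeasure (distr lborel borel f) A = emeasure lborel A" if [measurable]: "A \<in> sets borel" for A
  proof -
    have 1: "(\<integral>\<^sup>+x. indicator A (f x) \<partial>lborel) = (\<integral>\<^sup>+x. indicator A (f x + y) \<partial>lborel)" for y
    proof -
      obtain z where z: "f z = y" using surj by (metis surjD)
      have "(\<integral>\<^sup>+x. indicator A (f x + y) \<partial>lborel) = (\<integral>\<^sup>+x. indicator A (f (x + z)) \<partial>lborel)"
        using z lin by (simp add: linear_add)
      also have "\<dots> = (\<integral>\<^sup>+x. indicator A (f x) \<partial>lborel)"
        by (rule nn_integral_lborel_shift[where f="\<lambda>x. indicator A (f x)"]) measurable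
      finally show ?thesis by simp
    qed
    \<comment> \<open>Norm preservation turns the preimage of a ball around \<open>y = f z\<close>
      into the ball of the same radius around \<open>z\<close>. This fixes the multiplicative
      constant that translation invariance leaves open.\<close>
    have 2: "(\<integral>\<^sup>+x. indicator B (y - f x) \<partial>lborel) = emeasure lborel B" for y
    proof -
      obtain z where z: "f z = y" using surj by (metis surjD)
      have "indicator B (y - f x) = (indicator B (z - x) :: ennreal)" for x
        using nrm[of "z - x"] z lin by (simp add: B_def indicator_def linear_diff)
      then have "(\<integral>\<^sup>+x. indicator B (y - f x) \<partial>lborel) = (\<integral>\<^sup>+x. indicator B (z - x) \<partial>lborel)"
        by simp
      also have "\<dots> = (\<integral>\<^sup>+x. indicator B x \<partial>lborel)"
        by (rule nn_integral_lborel_reflect[where f="\<lambda>x. indicator B x"]) measurable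
      finally show ?thesis by simp
    qed
    have "emeasure (distr lborel borel f) A = (\<integral>\<^sup>+x. indicator A (f x) \<partial>lborel)"
      using nn_integral_distr[of f lborel borel "indicator A"] by simp
    then have "emeasure (distr lborel borel f) A * emeasure lborel B
        = (\<integral>\<^sup>+y. indicator B y * (\<integral>\<^sup>+x. indicator A (f x) \<partial>lborel) \<partial>lborel)"
      by (simp add: nn_integral_multc mult.commute)
    also have "\<dots> = (\<integral>\<^sup>+y. (\<integral>\<^sup>+x. indicator B y * indicator A (f x + y) \<partial>lborel) \<partial>lborel)"
      by (simp add: nn_integral_cmult flip: 1)
    also have "\<dots> = (\<integral>\<^sup>+x. (\<integral>\<^sup>+y. indicator B y * indicator A (f x + y) \<partial>lborel) \<partial>lborel)"
      by (rule lborel_Tonelli) measurable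
    also have "\<dots> = (\<integral>\<^sup>+x. (\<integral>\<^sup>+y. indicator B (y - f x) * indicator A y \<partial>lborel) \<partial>lborel)"
    proof (rule nn_integral_cong)
      fix x
      show "(\<integral>\<^sup>+y. indicator B y * indicator A (f x + y) \<partial>lborel)
          = (\<integral>\<^sup>+y. indicator B (y - f x) * indicator A y \<partial>lborel)"
        using nn_integral_lborel_shift[of "\<lambda>y. indicator B (y - f x) * indicator A y" "f x"]
        by (simp add: add.commute)
    qed
    also have "\<dots> = (\<integral>\<^sup>+y. (\<integral>\<^sup>+x. indicator B (y - f x) * indicator A y \<partial>lborel) \<partial>lborel)"
      by (rule lborel_Tonelli) measurable
    also have "\<dots> = (\<integral>\<^sup>+y. emeasure lborel B * indicator A y \<partial>lborel)"
      by (simp add: nn_integral_multc 2)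
    also have "\<dots> = emeasure lborel A * emeasure lborel B"
      by (subst nn_integral_cmult) (auto simp: mult.commute)
    finally have eq: "emeasure (distr lborel borel f) A * emeasure lborel B = emeasure lborel A * emeasure lborel B" .
    have "emeasure lborel B = ennreal (unit_ball_vol (real DIM('a)))"
      using emeasure_cball[of 1 "0::'a"] by (simp add: B_def)
    moreover have "unit_ball_vol (real DIM('a)) \<noteq> 0"
      by (metis less_irrefl of_nat_0_le_iff unit_ball_vol_pos)
    ultimately show ?thesis using eq
      by (simp add: mult.commute[of _ "ennreal _"] ennreal_mult_cancel_left)
  qed
  have "distr lborel borel f = lborel"
    by (rule measure_eqI) (auto simp: key)
  then show ?thesis
    using nn_integral_distr[of f lborel borel g] by simp
qed

text \<open>For \<open>u \<noteq> v\<close> the map is the reflection in the hyperplane orthogonal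
  to \<open>w = u - v\<close>. Equality of the norms gives
  \<open>w \<bullet> w = 2 * (u \<bullet> w)\<close>, so exactly one copy of \<open>w\<close> is
  subtracted from \<open>u\<close>.\<close>

lemma exists_linear_isometry:
  fixes u v :: "'a::euclidean_space"
  assumes "norm u = norm v"
  obtains f where "linear f" "\<And>x. norm (f x) = norm x" "f u = v"
proof (cases "u = v")
  case True
  then show ?thesis using that[of "\<lambda>x. x"] by (simp add: linear_iff)
next
  case False
  define w where "w = u - v"
  define f where "f = (\<lambda>x. x - (2 * (x \<bullet> w) / (w \<bullet> w)) *\<^sub>R w)"
  have w: "w \<bullet> w \<noteq> 0" using False by (simp add: w_def)
  have uv: "u \<bullet> u = v \<bullet> v" using assms by (simp add: norm_eq)
  have "linear f"
    by (auto simp: linear_iff f_def inner_add_left algebra_simps add_divide_distrib)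
  moreover have "norm (f x) = norm x" for x
  proof -
    have "f x \<bullet> f x = x \<bullet> x"
      using w by (simp add: f_def inner_diff_left inner_diff_right inner_commute field_simps power2_eq_square)
    then show ?thesis by (simp add: norm_eq)
  qed
  moreover have "f u = v"
  proof -
    have "w \<bullet> w = 2 * (u \<bullet> w)"
      using uv by (simp add: w_def inner_diff_left inner_diff_right inner_commute)
    then have "2 * (u \<bullet> w) / (w \<bullet> w) = 1" using w by (metis right_inverse_eq)
    then have "f u = u - 1 *\<^sub>R w" unfolding f_def by (simp only:)
    then show ?thesis by (simp add: w_def)
  qed
  ultimately show ?thesis using that by blast
qed

section \<open>Integral of the modulus of a linear form over a ball\<close>

text \<open>The slice of a ball of radius \<open>\<tau>\<close> at height \<open>t\<close> is a ball
  of radius \<open>sqrt (\<tau>\<^sup>2 - t\<^sup>2)\<close> in the remaining \<open>m\<close>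
  dimensions; this is the integral over the heights. On the positive half the integrand has the
  primitive \<open>F\<close>, and evenness doubles the result.\<close>

lemma nn_integral_abs_times_sqrt_power:
  assumes \<tau>: "\<tau> > (0::real)"
  shows "(\<integral>\<^sup>+ t. ennreal \<bar>t\<bar> * (indicator {-\<tau>..\<tau>} t * ennreal (sqrt (\<tau>\<^sup>2 - t\<^sup>2) ^ m)) \<partial>lborel)
     = ennreal (2 * \<tau> ^ (m+2) / (real m + 2))"
proof -
  define F where "F = (\<lambda>t. - ((\<tau>\<^sup>2 - t\<^sup>2) powr (real m / 2 + 1) / (real m + 2)))"
  define f where "f = (\<lambda>t::real. t * (\<tau>\<^sup>2 - t\<^sup>2) powr (real m / 2))"
  have pos: "\<tau>\<^sup>2 - t\<^sup>2 > 0" if "t \<in> {0<..<\<tau>}" for t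
    using that by (simp add: power_strict_mono)
  have "(f has_integral (F \<tau> - F 0)) {0..\<tau>}"
  proof (rule fundamental_theorem_of_calculus_interior)
    show "0 \<le> \<tau>" using \<tau> by simp
    show "continuous_on {0..\<tau>} F"
      unfolding F_def by (intro continuous_intros continuous_on_powr') (auto simp: power_mono add_nonneg_pos)
    show "(F has_vector_derivative f x) (at x)" if "x \<in> {0<..<\<tau>}" for x
      unfolding has_real_derivative_iff_has_vector_derivative[symmetric] F_def f_def
    proof -
      define a where "a = real m / 2 + 1"
      have a: "real m / 2 = a - 1" "real m + 2 = 2 * a" "a \<noteq> 0" by (auto simp: a_def)
      show "((\<lambda>t. - ((\<tau>\<^sup>2 - t\<^sup>2) powr (real m / 2 + 1) / (real m + 2))) has_real_derivative x * (\<tau>\<^sup>2 - x\<^sup>2) powr (real m / 2)) (at x)"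
        unfolding a using pos[OF that] a(3) by (auto intro!: derivative_eq_intros simp: field_simps)
    qed
  qed
  moreover have "F \<tau> - F 0 = \<tau> ^ (m+2) / (real m + 2)"
  proof -
    have "(\<tau>\<^sup>2) powr (real m / 2 + 1) = \<tau> powr (2 * (real m / 2 + 1))"
      using \<tau> by (simp add: powr_powr flip: powr_numeral)
    also have "2 * (real m / 2 + 1) = real (m + 2)" by simp
    also have "\<tau> powr real (m + 2) = \<tau> ^ (m+2)" using \<tau> by (rule powr_realpow)
    finally show ?thesis by (simp add: F_def)
  qed
  ultimately have "(f has_integral (\<tau> ^ (m+2) / (real m + 2))) {0..\<tau>}" by simp
  then have *: "(\<integral>\<^sup>+ t. ennreal (f t) * indicator {0..\<tau>} t \<partial>lborel) = ennreal (\<tau> ^ (m+2) / (real m + 2))"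
    by (intro nn_integral_has_integral_lebesgue') (auto simp: f_def)
  \<comment> \<open>The endpoints are left out because for \<open>m = 0\<close> the left side
    contains \<open>0 ^ 0 = 1\<close>, whereas \<open>f\<close> contains
    \<open>0 powr 0 = 0\<close>.\<close>
  have f_eq: "ennreal \<bar>t\<bar> * (indicator {-\<tau>..\<tau>} t * ennreal (sqrt (\<tau>\<^sup>2 - t\<^sup>2) ^ m))
     = ennreal (f t) * indicator {0..\<tau>} t + ennreal (f (-t)) * indicator {0..\<tau>} (-t)"
    if "t \<noteq> 0" "t \<noteq> \<tau>" "t \<noteq> - \<tau>" for t
  proof (cases "\<bar>t\<bar> < \<tau>")
    case True
    then have "\<tau>\<^sup>2 - t\<^sup>2 > 0" by (metis abs_le_square_iff diff_gt_0_iff_gt linorder_not_less abs_of_pos \<tau>)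
    then have "sqrt (\<tau>\<^sup>2 - t\<^sup>2) ^ m = (\<tau>\<^sup>2 - t\<^sup>2) powr (real m / 2)"
      by (simp add: powr_half_sqrt[symmetric] powr_realpow[symmetric] powr_powr)
    then show ?thesis using True that \<tau>
      by (cases "t > 0") (auto simp: f_def indicator_def simp flip: ennreal_mult')
  next
    case False
    then show ?thesis using that \<tau> by (auto simp: indicator_def)
  qed
  have "(\<integral>\<^sup>+ t. ennreal \<bar>t\<bar> * (indicator {-\<tau>..\<tau>} t * ennreal (sqrt (\<tau>\<^sup>2 - t\<^sup>2) ^ m)) \<partial>lborel)
     = (\<integral>\<^sup>+ t. ennreal (f t) * indicator {0..\<tau>} t + ennreal (f (-t)) * indicator {0..\<tau>} (-t) \<partial>lborel)"
  proof (rule nn_integral_cong_AE)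
    have "AE t in lborel. t \<noteq> (0::real)" "AE t in lborel. t \<noteq> \<tau>" "AE t in lborel. t \<noteq> - \<tau>"
      by (rule AE_lborel_singleton)+
    then show "AE t in lborel. ennreal \<bar>t\<bar> * (indicator {-\<tau>..\<tau>} t * ennreal (sqrt (\<tau>\<^sup>2 - t\<^sup>2) ^ m))
     = ennreal (f t) * indicator {0..\<tau>} t + ennreal (f (-t)) * indicator {0..\<tau>} (-t)"
      by eventually_elim (rule f_eq)
  qed
  also have "\<dots> = (\<integral>\<^sup>+ t. ennreal (f t) * indicator {0..\<tau>} t \<partial>lborel) + (\<integral>\<^sup>+ t. ennreal (f (-t)) * indicator {0..\<tau>} (-t) \<partial>lborel)"
    by (rule nn_integral_add) (auto simp: f_def)
  also have "(\<integral>\<^sup>+ t. ennreal (f (-t)) * indicator {0..\<tau>} (-t) \<partial>lborel) = (\<integral>\<^sup>+ t. ennreal (f t) * indicator {0..\<tau>} t \<partial>lborel)"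
    by (rule nn_integral_lborel_uminus[where f="\<lambda>t. ennreal (f t) * indicator {0..\<tau>} t"]) (auto simp: f_def)
  finally show ?thesis
    unfolding * using \<tau> by (simp flip: ennreal_plus)
qed

text \<open>The ball is sliced orthogonally to \<open>b\<close>. Each slice is a ball in the
  \<open>d - 1\<close> remaining coordinates, which is the source of the factor
  \<open>unit_ball_vol (real (DIM('a) - 1))\<close> in the limit.\<close>

lemma nn_integral_cball_abs_inner_Basis:
  fixes b :: "'a::euclidean_space"
  assumes \<tau>: "\<tau> > 0" and b: "b \<in> Basis" 
  shows "(\<integral>\<^sup>+ h. indicator (cball 0 \<tau>) h * ennreal \<bar>h \<bullet> b\<bar> \<partial>lborel)
     = ennreal (2 * unit_ball_vol (real (DIM('a) - 1)) / (real DIM('a) + 1) * \<tau> ^ (DIM('a) + 1))"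
proof -
  interpret product_sigma_finite "\<lambda>_::'a. lborel :: real measure"
    by standard
  define A where "A = Basis - {b}"
  have A: "finite A" "b \<notin> A" "Basis = insert b A" "card A = DIM('a) - 1"
    using b by (auto simp: A_def)
  let ?N = "\<lambda>y. {f. sqrt (\<Sum>i\<in>A. (f i)\<^sup>2) \<le> sqrt (\<tau>\<^sup>2 - y\<^sup>2)} \<inter> space (Pi\<^sub>M A (\<lambda>_. lborel :: real measure))"
  let ?S = "\<lambda>f::'a \<Rightarrow> real. (\<Sum>b\<in>Basis. f b *\<^sub>R b)"
  have inn: "?S f \<bullet> i = f i" if "i \<in> Basis" for f i
    using that by simp
  have nrm: "norm (?S f) = sqrt (\<Sum>i\<in>Basis. (f i)\<^sup>2)" for f
    by (subst norm_eq_sqrt_inner, subst euclidean_inner) (simp only: inn power2_eq_square cong: sum.cong)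
  have "(\<integral>\<^sup>+ h. indicator (cball 0 \<tau>) h * ennreal \<bar>h \<bullet> b\<bar> \<partial>lborel)
     = (\<integral>\<^sup>+ f. indicator (cball 0 \<tau>) (?S f) * ennreal \<bar>?S f \<bullet> b\<bar> \<partial>Pi\<^sub>M Basis (\<lambda>_. lborel))"
    by (subst lborel_eq, subst nn_integral_distr) measurable
  also have "\<dots> = (\<integral>\<^sup>+ f. indicator {..\<tau>} (sqrt (\<Sum>i\<in>Basis. (f i)\<^sup>2)) * ennreal \<bar>f b\<bar> \<partial>Pi\<^sub>M Basis (\<lambda>_. lborel))"
    using b by (intro nn_integral_cong) (auto simp: nrm indicator_def)
  also have "\<dots> = (\<integral>\<^sup>+ y. \<integral>\<^sup>+ x. indicator {..\<tau>} (sqrt (\<Sum>i\<in>insert b A. ((x(b := y)) i)\<^sup>2)) * ennreal \<bar>(x(b:=y)) b\<bar>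
                   \<partial>Pi\<^sub>M A (\<lambda>_. lborel) \<partial>lborel)"
  proof -
    have "(\<lambda>f. indicator {..\<tau>} (sqrt (\<Sum>i\<in>insert b A. (f i)\<^sup>2)) * ennreal \<bar>f b\<bar>)
        \<in> borel_measurable (Pi\<^sub>M (insert b A) (\<lambda>_. lborel))"
      by measurable
    then show ?thesis
      unfolding A(3) using A(1,2) by (intro product_nn_integral_insert_rev)
  qed
  also have "\<dots> = (\<integral>\<^sup>+ y. \<integral>\<^sup>+ x. (ennreal \<bar>y\<bar> * indicator {-\<tau>..\<tau>} y) * indicator (?N y) x \<partial>Pi\<^sub>M A (\<lambda>_. lborel) \<partial>lborel)"
  proof (intro nn_integral_cong, goal_cases)
    case (1 y x)
    have s: "(\<Sum>i\<in>insert b A. ((x(b := y)) i)\<^sup>2) = y\<^sup>2 + (\<Sum>i\<in>A. (x i)\<^sup>2)"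
      using A(1,2) by (subst sum.insert) (auto intro!: sum.cong)
    have nn: "(\<Sum>i\<in>A. (x i)\<^sup>2) \<ge> 0" by (simp add: sum_nonneg)
    have "sqrt (y\<^sup>2 + (\<Sum>i\<in>A. (x i)\<^sup>2)) \<le> \<tau> \<longleftrightarrow> y\<^sup>2 + (\<Sum>i\<in>A. (x i)\<^sup>2) \<le> \<tau>\<^sup>2"
      using \<tau> nn by (subst real_sqrt_le_iff') auto
    also have "\<dots> \<longleftrightarrow> y \<in> {-\<tau>..\<tau>} \<and> (\<Sum>i\<in>A. (x i)\<^sup>2) \<le> \<tau>\<^sup>2 - y\<^sup>2"
    proof -
      have "\<bar>y\<bar> \<le> \<bar>\<tau>\<bar>" if "y\<^sup>2 + (\<Sum>i\<in>A. (x i)\<^sup>2) \<le> \<tau>\<^sup>2"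
        using that nn by (subst abs_le_square_iff) linarith
      then show ?thesis using \<tau> by auto
    qed
    finally show ?case using 1 s
      by (auto simp: indicator_def)
  qed
  also have "\<dots> = (\<integral>\<^sup>+ y. (ennreal \<bar>y\<bar> * indicator {-\<tau>..\<tau>} y) * emeasure (Pi\<^sub>M A (\<lambda>_. lborel)) (?N y) \<partial>lborel)"
    by (intro nn_integral_cong, subst nn_integral_cmult_indicator) auto
  also have "\<dots> = (\<integral>\<^sup>+ y. ennreal (unit_ball_vol (real (card A))) * (ennreal \<bar>y\<bar> * (indicator {-\<tau>..\<tau>} y * ennreal (sqrt (\<tau>\<^sup>2 - y\<^sup>2) ^ card A))) \<partial>lborel)"
  proof (rule nn_integral_cong_AE)
    \<comment> \<open>At these two heights the slice degenerates to radius 0; the volume formula is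
      applied to positive radii.\<close>
    have "AE t in lborel. t \<noteq> \<tau>" "AE t in lborel. t \<noteq> - \<tau>"
      by (rule AE_lborel_singleton)+
    then show "AE y in lborel. (ennreal \<bar>y\<bar> * indicator {-\<tau>..\<tau>} y) * emeasure (Pi\<^sub>M A (\<lambda>_. lborel)) (?N y)
       = ennreal (unit_ball_vol (real (card A))) * (ennreal \<bar>y\<bar> * (indicator {-\<tau>..\<tau>} y * ennreal (sqrt (\<tau>\<^sup>2 - y\<^sup>2) ^ card A)))"
    proof eventually_elim
      case (elim y)
      show ?case
      proof (cases "y \<in> {-\<tau>..\<tau>}")
        case True
        then have "\<bar>y\<bar> < \<tau>" using elim by auto
        then have "\<tau>\<^sup>2 - y\<^sup>2 > 0" by (metis abs_le_square_iff diff_gt_0_iff_gt linorder_not_less abs_of_pos \<tau>)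
        then have "emeasure (Pi\<^sub>M A (\<lambda>_. lborel)) (?N y) = ennreal (unit_ball_vol (real (card A)) * sqrt (\<tau>\<^sup>2 - y\<^sup>2) ^ card A)"
          using A by (intro emeasure_cball_aux) auto
        then show ?thesis using \<open>\<tau>\<^sup>2 - y\<^sup>2 > 0\<close> by (simp add: ennreal_mult mult_ac)
      qed simp
    qed
  qed
  also have "\<dots> = ennreal (unit_ball_vol (real (card A))) * ennreal (2 * \<tau> ^ (card A+2) / (real (card A) + 2))"
    by (subst nn_integral_cmult) (auto simp: nn_integral_abs_times_sqrt_power[OF \<tau>])
  also have "\<dots> = ennreal (2 * unit_ball_vol (real (DIM('a) - 1)) / (real DIM('a) + 1) * \<tau> ^ (DIM('a) + 1))"
  proof -
    have "card A + 2 = DIM('a) + 1" "real (card A) + 2 = real DIM('a) + 1" 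
      using A(4) DIM_positive[where 'a='a] by (auto simp: of_nat_diff)
    then show ?thesis
      using \<tau> by (simp only:) (simp add: A(4) ennreal_mult[symmetric])
  qed
  finally show ?thesis .
qed

text \<open>An isometry carrying \<open>norm v *\<^sub>R b\<close> to \<open>v\<close> preserves the
  ball and Lebesgue measure and so reduces a general direction to a coordinate direction.\<close>

lemma nn_integral_cball_abs_inner:
  fixes v :: "'a::euclidean_space"
  assumes \<tau>: "\<tau> > 0"
  shows "(\<integral>\<^sup>+ h. indicator (cball 0 \<tau>) h * ennreal \<bar>h \<bullet> v\<bar> \<partial>lborel)
     = ennreal (2 * unit_ball_vol (real (DIM('a) - 1)) / (real DIM('a) + 1) * \<tau> ^ (DIM('a) + 1)) * ennreal (norm v)"
proof -
  obtain b :: 'a where b: "b \<in> Basis" using nonempty_Basis by blast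
  have "norm (norm v *\<^sub>R b) = norm v" using b by simp
  then obtain f where f: "linear f" "\<And>x. norm (f x) = norm x" "f (norm v *\<^sub>R b) = v"
    using exists_linear_isometry by blast
  have inn: "f x \<bullet> f y = x \<bullet> y" for x y
  proof -
    have "orthogonal_transformation f" using f by (simp add: orthogonal_transformation)
    then show ?thesis by (simp add: orthogonal_transformation_def)
  qed
  have "(\<integral>\<^sup>+ h. indicator (cball 0 \<tau>) h * ennreal \<bar>h \<bullet> v\<bar> \<partial>lborel)
     = (\<integral>\<^sup>+ h. indicator (cball 0 \<tau>) (f h) * ennreal \<bar>f h \<bullet> v\<bar> \<partial>lborel)"
    by (rule nn_integral_lborel_isometry[OF f(1,2), symmetric]) measurable
  also have "\<dots> = (\<integral>\<^sup>+ h. (indicator (cball 0 \<tau>) h * ennreal \<bar>h \<bullet> b\<bar>) * ennreal (norm v) \<partial>lborel)"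
  proof (rule nn_integral_cong)
    fix h
    have "f h \<bullet> v = norm v * (h \<bullet> b)"
      using inn[of h "norm v *\<^sub>R b"] f(3) by simp
    then show "indicator (cball 0 \<tau>) (f h) * ennreal \<bar>f h \<bullet> v\<bar> = (indicator (cball 0 \<tau>) h * ennreal \<bar>h \<bullet> b\<bar>) * ennreal (norm v)"
      using f(2)[of h] by (simp add: indicator_def abs_mult ennreal_mult mult.commute)
  qed
  also have "\<dots> = (\<integral>\<^sup>+ h. indicator (cball 0 \<tau>) h * ennreal \<bar>h \<bullet> b\<bar> \<partial>lborel) * ennreal (norm v)"
    by (rule nn_integral_multc) auto
  finally show ?thesis
    by (simp only: nn_integral_cball_abs_inner_Basis[OF \<tau> b])
qed

section \<open>Translation differences and the layer-cake formula\<close>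

text \<open>For \<open>f = indicator F\<close> this is the function \<open>N\<close> of the
  overview, and \<open>ball_shift\<close> is \<open>B\<close>. It is stated for real functions so
  that it applies to mollifications as well; values in \<open>ennreal\<close> keep every estimate
  meaningful without integrability.\<close>

definition L1_shift :: "('a::euclidean_space \<Rightarrow> real) \<Rightarrow> 'a \<Rightarrow> ennreal" where
  "L1_shift f h = (\<integral>\<^sup>+x. ennreal \<bar>f (x + h) - f x\<bar> \<partial>lborel)"

definition ball_shift :: "'a::euclidean_space set \<Rightarrow> real \<Rightarrow> ennreal" where
  "ball_shift F \<tau> = (\<integral>\<^sup>+h. indicator (cball 0 \<tau>) h * L1_shift (indicator F) h \<partial>lborel)"

lemma L1_shift_measurable [measurable]:
  assumes [measurable]: "f \<in> borel_measurable borel"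
  shows "L1_shift f \<in> borel_measurable borel"
  unfolding L1_shift_def by measurable

lemma L1_shift_add_le:
  assumes [measurable]: "f \<in> borel_measurable borel"
  shows "L1_shift f (h + k) \<le> L1_shift f h + L1_shift f k"
proof -
  have "L1_shift f (h + k) \<le> (\<integral>\<^sup>+x. ennreal \<bar>f (x + k + h) - f (x + k)\<bar> + ennreal \<bar>f (x + k) - f x\<bar> \<partial>lborel)"
    unfolding L1_shift_def
    by (intro nn_integral_mono) (auto simp: algebra_simps simp flip: ennreal_plus)
  also have "\<dots> = (\<integral>\<^sup>+x. ennreal \<bar>f (x + k + h) - f (x + k)\<bar> \<partial>lborel) + L1_shift f k"
    unfolding L1_shift_def by (rule nn_integral_add) auto
  also have "(\<integral>\<^sup>+x. ennreal \<bar>f (x + k + h) - f (x + k)\<bar> \<partial>lborel) = L1_shift f h"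
    unfolding L1_shift_def by (rule nn_integral_lborel_shift[where f="\<lambda>x. ennreal \<bar>f (x + h) - f x\<bar>"]) measurable
  finally show ?thesis .
qed

lemma L1_shift_scale_le:
  assumes [measurable]: "f \<in> borel_measurable borel"
  shows "L1_shift f (real m *\<^sub>R h) \<le> of_nat m * L1_shift f h"
proof (induction m)
  case 0
  then show ?case by (simp add: L1_shift_def)
next
  case (Suc m)
  have "L1_shift f (real (Suc m) *\<^sub>R h) = L1_shift f (real m *\<^sub>R h + h)"
    by (simp add: algebra_simps)
  also have "\<dots> \<le> L1_shift f (real m *\<^sub>R h) + L1_shift f h"
    by (rule L1_shift_add_le) measurable
  also have "\<dots> \<le> of_nat (Suc m) * L1_shift f h"
    using Suc by (simp add: algebra_simps add_right_mono)
  finally show ?case .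
qed

lemma L1_shift_indicator_le:
  assumes [measurable]: "F \<in> sets borel"
  shows "L1_shift (indicator F) h \<le> 2 * emeasure lborel F"
proof -
  have "L1_shift (indicator F) h \<le> (\<integral>\<^sup>+x. indicator F (x + h) + indicator F x \<partial>lborel)"
    unfolding L1_shift_def by (intro nn_integral_mono) (auto simp: indicator_def)
  also have "\<dots> = (\<integral>\<^sup>+x. indicator F (x + h) \<partial>lborel) + emeasure lborel F"
    by (subst nn_integral_add) auto
  also have "(\<integral>\<^sup>+x. indicator F (x + h) \<partial>lborel) = emeasure lborel F"
    by (subst nn_integral_lborel_shift[where f="indicator F"]) auto
  finally show ?thesis by (simp add: mult_2)
qed

lemma ball_shift_mono: "\<tau> \<le> \<tau>' \<Longrightarrow> ball_shift F \<tau> \<le> ball_shift F \<tau>'"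
  unfolding ball_shift_def by (intro nn_integral_mono mult_right_mono) (auto simp: indicator_def)

text \<open>The substitution of \<open>m *\<^sub>R h\<close> for \<open>h\<close> gives the Jacobian
  \<open>m ^ d\<close>; subadditivity of the translation differences gives one further factor
  \<open>m\<close>.\<close>

lemma ball_shift_scale_le:
  fixes F :: "'a::euclidean_space set"
  assumes [measurable]: "F \<in> sets borel" and "m > 0"
  shows "ball_shift F (real m * \<tau>) \<le> of_nat m ^ (DIM('a) + 1) * ball_shift F \<tau>"
proof -
  have "ball_shift F (real m * \<tau>) = ennreal (\<bar>real m\<bar> ^ DIM('a)) *
      (\<integral>\<^sup>+h. indicator (cball 0 (real m * \<tau>)) (real m *\<^sub>R h) * L1_shift (indicator F) (real m *\<^sub>R h) \<partial>lborel)"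
    unfolding ball_shift_def using \<open>m > 0\<close> by (intro nn_integral_lborel_scale) auto
  also have "\<dots> \<le> ennreal (\<bar>real m\<bar> ^ DIM('a)) *
      (\<integral>\<^sup>+h. of_nat m * (indicator (cball 0 \<tau>) h * L1_shift (indicator F) h) \<partial>lborel)"
  proof (intro mult_left_mono nn_integral_mono)
    fix h :: 'a
    have "real m *\<^sub>R h \<in> cball 0 (real m * \<tau>) \<longleftrightarrow> h \<in> cball 0 \<tau>" using \<open>m > 0\<close> by simp
    then show "indicator (cball 0 (real m * \<tau>)) (real m *\<^sub>R h) * L1_shift (indicator F) (real m *\<^sub>R h)
        \<le> of_nat m * (indicator (cball 0 \<tau>) h * L1_shift (indicator F) h)"
      using L1_shift_scale_le[of "indicator F" m h] by (auto simp: indicator_def)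
  qed simp
  also have "\<dots> = ennreal (\<bar>real m\<bar> ^ DIM('a)) * (of_nat m * ball_shift F \<tau>)"
    unfolding ball_shift_def by (subst nn_integral_cmult) auto
  also have "ennreal (\<bar>real m\<bar> ^ DIM('a)) = of_nat m ^ DIM('a)"
    by (simp add: ennreal_power[symmetric] ennreal_of_nat_eq_real_of_nat)
  finally show ?thesis by (simp add: mult_ac)
qed

section \<open>Layer-cake representation of the energy\<close>

text \<open>The kernel at distance \<open>t\<close> is the tail integral, from
  \<open>max r t\<close> on, of the derivative of \<open>- (\<tau> powr (- d - s))\<close>. Its
  being constant below \<open>r\<close> thus becomes the restriction to radii
  \<open>\<tau> \<ge> r\<close>.\<close>

lemma nn_integral_kern:
  assumes "r > 0" "s > 0"
  shows "(\<integral>\<^sup>+\<tau>. indicator {t..} \<tau> * (indicator {r..} \<tau> * ennreal ((real d + s) * \<tau> powr (- real d - s - 1))) \<partial>lborel)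
    = ennreal (kern d r s t)"
proof -
  define a where "a = max r t"
  have a: "a > 0" using assms by (auto simp: a_def)
  have "(\<integral>\<^sup>+\<tau>. indicator {t..} \<tau> * (indicator {r..} \<tau> * ennreal ((real d + s) * \<tau> powr (- real d - s - 1))) \<partial>lborel)
      = (\<integral>\<^sup>+\<tau>. ennreal ((real d + s) * \<tau> powr (- real d - s - 1)) * indicator {a..} \<tau> \<partial>lborel)"
    by (intro nn_integral_cong) (auto simp: a_def indicator_def)
  also have "\<dots> = ennreal (0 - (- (a powr (- real d - s))))"
  proof (rule nn_integral_FTC_atLeast)
    show "((\<lambda>\<tau>. - (\<tau> powr (- real d - s))) has_real_derivative (real d + s) * x powr (- real d - s - 1)) (at x)"
      if "a \<le> x" for x
      using that a by (auto intro!: derivative_eq_intros simp: field_simps)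
    have "((\<lambda>\<tau>::real. \<tau> powr (- real d - s)) \<longlongrightarrow> 0) at_top"
      using assms by (intro tendsto_neg_powr filterlim_ident) auto
    then show "((\<lambda>\<tau>::real. - (\<tau> powr (- real d - s))) \<longlongrightarrow> 0) at_top"
      using tendsto_minus by fastforce
  qed (use assms in auto)
  also have "0 - (- (a powr (- real d - s))) = kern d r s t"
    by (auto simp: a_def kern_def max_def)
  finally show ?thesis .
qed

text \<open>The indicator changes between \<open>x\<close> and \<open>x + h\<close> either by
  leaving \<open>F\<close> or by entering it. The two cases are exchanged by \<open>h\<close> going
  to \<open>- h\<close>, which preserves the ball, and this accounts for the factor 2.\<close>

lemma ball_shift_eq_pairs:
  fixes F :: "'a::euclidean_space set"
  assumes [measurable]: "F \<in> sets borel"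
  shows "ball_shift F \<tau> = 2 * (\<integral>\<^sup>+x. \<integral>\<^sup>+y. indicator F x * indicator (UNIV - F) y * indicator {dist x y..} \<tau> \<partial>lborel \<partial>lborel)"
proof -
  define g :: "'a \<Rightarrow> ennreal" where "g h = (\<integral>\<^sup>+x. indicator F x * indicator (UNIV - F) (x + h) \<partial>lborel)" for h
  have [measurable]: "UNIV - F \<in> sets borel" by (simp add: sets.compl_sets[of F borel, simplified])
  have g[measurable]: "g \<in> borel_measurable borel" unfolding g_def by measurable
  have "L1_shift (indicator F) h = g h + g (- h)" for h
  proof -
    have "L1_shift (indicator F) h = (\<integral>\<^sup>+x. indicator F x * indicator (UNIV - F) (x + h) + indicator F (x + h) * indicator (UNIV - F) (x + h + - h) \<partial>lborel)"
      unfolding L1_shift_def by (intro nn_integral_cong) (auto simp: indicator_def)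
    also have "\<dots> = g h + (\<integral>\<^sup>+x. indicator F (x + h) * indicator (UNIV - F) (x + h + - h) \<partial>lborel)"
      unfolding g_def by (rule nn_integral_add) measurable
    also have "(\<integral>\<^sup>+x. indicator F (x + h) * indicator (UNIV - F) (x + h + - h) \<partial>lborel) = g (- h)"
      unfolding g_def
      by (rule nn_integral_lborel_shift[where f="\<lambda>x. indicator F x * indicator (UNIV - F) (x + - h)"]) measurable
    finally show ?thesis .
  qed
  then have "ball_shift F \<tau> = (\<integral>\<^sup>+h. indicator (cball 0 \<tau>) h * g h + indicator (cball 0 \<tau>) (- h) * g (- h) \<partial>lborel)"
    unfolding ball_shift_def by (intro nn_integral_cong) (auto simp: indicator_def)
  also have "\<dots> = (\<integral>\<^sup>+h. indicator (cball 0 \<tau>) h * g h \<partial>lborel) + (\<integral>\<^sup>+h. indicator (cball 0 \<tau>) (- h) * g (- h) \<partial>lborel)"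
    by (rule nn_integral_add) measurable
  also have "(\<integral>\<^sup>+h. indicator (cball 0 \<tau>) (- h) * g (- h) \<partial>lborel) = (\<integral>\<^sup>+h. indicator (cball 0 \<tau>) h * g h \<partial>lborel)"
    by (rule nn_integral_lborel_uminus[where f="\<lambda>h. indicator (cball 0 \<tau>) h * g h"]) measurable
  finally have 1: "ball_shift F \<tau> = 2 * (\<integral>\<^sup>+h. indicator (cball 0 \<tau>) h * g h \<partial>lborel)"
    by (simp add: mult_2)
  have "(\<integral>\<^sup>+h. indicator (cball 0 \<tau>) h * g h \<partial>lborel)
     = (\<integral>\<^sup>+h. \<integral>\<^sup>+x. indicator (cball 0 \<tau>) h * (indicator F x * indicator (UNIV - F) (x + h)) \<partial>lborel \<partial>lborel)"
    unfolding g_def by (intro nn_integral_cong) (subst nn_integral_cmult, auto)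
  also have "\<dots> = (\<integral>\<^sup>+x. \<integral>\<^sup>+h. indicator (cball 0 \<tau>) h * (indicator F x * indicator (UNIV - F) (x + h)) \<partial>lborel \<partial>lborel)"
    by (rule lborel_Tonelli) measurable
  also have "\<dots> = (\<integral>\<^sup>+x. \<integral>\<^sup>+y. indicator F x * indicator (UNIV - F) y * indicator {dist x y..} \<tau> \<partial>lborel \<partial>lborel)"
  proof (rule nn_integral_cong)
    fix x
    have "(\<integral>\<^sup>+y. indicator F x * indicator (UNIV - F) y * indicator (cball x \<tau>) y \<partial>lborel)
       = (\<integral>\<^sup>+h. indicator F x * indicator (UNIV - F) (h + x) * indicator (cball x \<tau>) (h + x) \<partial>lborel)"
      by (rule nn_integral_lborel_shift[symmetric]) measurable
    moreover have "indicator (cball x \<tau>) (h + x) = (indicator (cball 0 \<tau>) h :: ennreal)" for h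
      by (simp add: indicator_def dist_norm)
    moreover have "indicator (cball x \<tau>) y = (indicator {dist x y..} \<tau> :: ennreal)" for y
      by (simp add: indicator_def)
    ultimately show "(\<integral>\<^sup>+h. indicator (cball 0 \<tau>) h * (indicator F x * indicator (UNIV - F) (x + h)) \<partial>lborel)
       = (\<integral>\<^sup>+y. indicator F x * indicator (UNIV - F) y * indicator {dist x y..} \<tau> \<partial>lborel)"
      by (simp add: mult_ac add.commute)
  qed
  finally show ?thesis using 1 by simp
qed

text \<open>With the kernel written as an integral over radii, Tonelli's theorem moves the radius to
  the outside; what remains inside is the measure of the pairs counted by
  \<open>ball_shift_eq_pairs\<close>.\<close>

lemma Jt_layer_cake:
  fixes F :: "'a::euclidean_space set"
  assumes [measurable]: "F \<in> sets borel" and "r > 0" "s > 0"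
  shows "2 * Jt r s F = (\<integral>\<^sup>+\<tau>. indicator {r..} \<tau> * ennreal ((real DIM('a) + s) * \<tau> powr (- real DIM('a) - s - 1)) * ball_shift F \<tau> \<partial>lborel)"
proof -
  have [measurable]: "UNIV - F \<in> sets borel" by (simp add: sets.compl_sets[of F borel, simplified])
  define a where "a \<tau> = indicator {r..} \<tau> * ennreal ((real DIM('a) + s) * \<tau> powr (- real DIM('a) - s - 1))" for \<tau>
  define c where "c x y = (indicator F x * indicator (UNIV - F) y :: ennreal)" for x y :: 'a
  have [measurable]: "a \<in> borel_measurable borel" unfolding a_def by measurable
  have c[measurable]: "(\<lambda>p. c (fst p) (snd p)) \<in> borel_measurable (borel \<Otimes>\<^sub>M borel)" unfolding c_def by measurable
  have c'[measurable]: "c x \<in> borel_measurable borel" for x unfolding c_def by measurable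
  \<comment> \<open>Replacing the completed measure by \<open>lborel\<close> does not change
    nonnegative integrals, and it puts the integrand on products of Borel spaces, where the
    interchanges below apply.\<close>
  have "Jt r s F = (\<integral>\<^sup>+x. \<integral>\<^sup>+y. c x y * ennreal (kern DIM('a) r s (dist x y)) \<partial>lborel \<partial>lborel)"
    unfolding Jt_def nn_integral_completion c_def ..
  also have "\<dots> = (\<integral>\<^sup>+x. \<integral>\<^sup>+y. \<integral>\<^sup>+\<tau>. c x y * (indicator {dist x y..} \<tau> * a \<tau>) \<partial>lborel \<partial>lborel \<partial>lborel)"
    unfolding a_def by (simp only: nn_integral_kern[OF assms(2,3), symmetric]) (subst nn_integral_cmult, measurable)
  also have "\<dots> = (\<integral>\<^sup>+x. \<integral>\<^sup>+\<tau>. \<integral>\<^sup>+y. c x y * (indicator {dist x y..} \<tau> * a \<tau>) \<partial>lborel \<partial>lborel \<partial>lborel)"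
  proof (intro nn_integral_cong lborel_Tonelli)
    fix x :: 'a
    have [measurable]: "(\<lambda>p. indicator {dist x (fst p)..} (snd p) :: ennreal) \<in> borel_measurable ((borel::'a measure) \<Otimes>\<^sub>M borel)"
      unfolding indicator_def atLeast_def mem_Collect_eq by measurable
    show "(\<lambda>p. c x (fst p) * (indicator {dist x (fst p)..} (snd p) * a (snd p))) \<in> borel_measurable (borel \<Otimes>\<^sub>M borel)"
      by measurable
  qed
  also have "\<dots> = (\<integral>\<^sup>+\<tau>. \<integral>\<^sup>+x. \<integral>\<^sup>+y. c x y * (indicator {dist x y..} \<tau> * a \<tau>) \<partial>lborel \<partial>lborel \<partial>lborel)"
  proof (rule lborel_Tonelli)
    have "(\<lambda>q. c (fst (fst q)) (snd q) * (indicator {dist (fst (fst q)) (snd q)..} (snd (fst q)) * a (snd (fst q)))) 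
      \<in> borel_measurable (((borel::'a measure) \<Otimes>\<^sub>M (borel::real measure)) \<Otimes>\<^sub>M (lborel::'a measure))"
      unfolding c_def indicator_def atLeast_def mem_Collect_eq by measurable
    then show "(\<lambda>p. \<integral>\<^sup>+y. c (fst p) y * (indicator {dist (fst p) y..} (snd p) * a (snd p)) \<partial>lborel) \<in> borel_measurable ((borel::'a measure) \<Otimes>\<^sub>M (borel::real measure))"
      by (intro lborel.borel_measurable_nn_integral) (simp add: case_prod_beta')
  qed
  also have "\<dots> = (\<integral>\<^sup>+\<tau>. a \<tau> * (\<integral>\<^sup>+x. \<integral>\<^sup>+y. c x y * indicator {dist x y..} \<tau> \<partial>lborel \<partial>lborel) \<partial>lborel)"
  proof (rule nn_integral_cong)
    fix \<tau> :: real
    have m: "(\<lambda>p. indicator {dist (fst p) (snd p)..} \<tau> :: ennreal) \<in> borel_measurable ((borel::'a measure) \<Otimes>\<^sub>M (borel::'a measure))"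
      unfolding indicator_def atLeast_def mem_Collect_eq by measurable
    have [measurable]: "(\<lambda>p. c (fst p) (snd p) * indicator {dist (fst p) (snd p)..} \<tau> :: ennreal) \<in> borel_measurable ((borel::'a measure) \<Otimes>\<^sub>M (lborel::'a measure))"
      using c m by (auto cong: measurable_cong_sets)
    have m2: "(\<lambda>y. c x y * indicator {dist x y..} \<tau> :: ennreal) \<in> borel_measurable lborel" for x
      unfolding indicator_def atLeast_def mem_Collect_eq by measurable
    have "(\<lambda>x. \<integral>\<^sup>+y. c x y * indicator {dist x y..} \<tau> \<partial>lborel) \<in> borel_measurable borel"
      by (intro lborel.borel_measurable_nn_integral) (simp add: case_prod_beta')
    then have m3: "(\<lambda>x. \<integral>\<^sup>+y. c x y * indicator {dist x y..} \<tau> \<partial>lborel) \<in> borel_measurable lborel"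
      by simp
    have "(\<integral>\<^sup>+y. c x y * (indicator {dist x y..} \<tau> * a \<tau>) \<partial>lborel) = a \<tau> * (\<integral>\<^sup>+y. c x y * indicator {dist x y..} \<tau> \<partial>lborel)" for x
      by (subst nn_integral_cmult[OF m2, symmetric]) (simp add: mult_ac)
    then show "(\<integral>\<^sup>+x. \<integral>\<^sup>+y. c x y * (indicator {dist x y..} \<tau> * a \<tau>) \<partial>lborel \<partial>lborel) = a \<tau> * (\<integral>\<^sup>+x. \<integral>\<^sup>+y. c x y * indicator {dist x y..} \<tau> \<partial>lborel \<partial>lborel)"
      by (simp add: nn_integral_cmult[OF m3])
  qed
  finally have J: "Jt r s F = (\<integral>\<^sup>+\<tau>. a \<tau> * (\<integral>\<^sup>+x. \<integral>\<^sup>+y. c x y * indicator {dist x y..} \<tau> \<partial>lborel \<partial>lborel) \<partial>lborel)" .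
  have "(\<lambda>\<tau>. \<integral>\<^sup>+x. \<integral>\<^sup>+y. c x y * indicator {dist x y..} \<tau> \<partial>lborel \<partial>lborel) \<in> borel_measurable borel"
    unfolding c_def indicator_def atLeast_def mem_Collect_eq by measurable
  then have "2 * Jt r s F = (\<integral>\<^sup>+\<tau>. 2 * (a \<tau> * (\<integral>\<^sup>+x. \<integral>\<^sup>+y. c x y * indicator {dist x y..} \<tau> \<partial>lborel \<partial>lborel)) \<partial>lborel)"
    unfolding J by (subst nn_integral_cmult) auto
  then show ?thesis
    by (simp add: ball_shift_eq_pairs a_def c_def mult_ac)
qed

section \<open>Mollification\<close>

lemma integrable_bounded_support:
  fixes f :: "'a::euclidean_space \<Rightarrow> 'b::{banach, second_countable_topology}"
  assumes "f \<in> borel_measurable borel" "\<And>x. norm (f x) \<le> B" "\<And>x. x \<notin> cball a R \<Longrightarrow> f x = 0"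
  shows "integrable lborel f"
proof (rule integrableI_bounded_set[where A="cball a R" and B=B])
  show "emeasure lborel (cball a R) < \<infinity>"
    by (rule emeasure_lborel_cball_finite)
qed (use assms in auto)

lemma integral_lborel_shift:
  fixes f :: "'a::euclidean_space \<Rightarrow> 'b::{banach, second_countable_topology}"
  assumes [measurable]: "f \<in> borel_measurable borel"
  shows "(\<integral>x. f (x + a) \<partial>lborel) = (\<integral>x. f x \<partial>lborel)"
proof -
  have "(\<integral>x. f x \<partial>lborel) = (\<integral>x. f x \<partial>distr lborel borel ((+) a))"
    by (simp only: lborel_distr_plus)
  also have "\<dots> = (\<integral>x. f (a + x) \<partial>lborel)"
    by (subst integral_distr) auto
  finally show ?thesis by (simp add: add.commute)
qed

text \<open>In the nonintegrable case the Bochner integral is 0 by convention, so the bound is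
  trivial there.\<close>

lemma ennreal_norm_integral_le:
  fixes f :: "'a \<Rightarrow> 'b::{banach, second_countable_topology}"
  shows "ennreal (norm (\<integral>x. f x \<partial>M)) \<le> (\<integral>\<^sup>+x. ennreal (norm (f x)) \<partial>M)"
  by (cases "integrable M f") (auto simp: integral_norm_bound_ennreal not_integrable_integral_eq)

definition conv :: "('a::euclidean_space \<Rightarrow> real) \<Rightarrow> ('a \<Rightarrow> real) \<Rightarrow> 'a \<Rightarrow> real" where
  "conv f \<zeta> x = (\<integral>y. f y * \<zeta> (x - y) \<partial>lborel)"

lemma conv_measurable [measurable]:
  assumes [measurable]: "f \<in> borel_measurable borel" "\<zeta> \<in> borel_measurable borel"
  shows "conv f \<zeta> \<in> borel_measurable borel"
  unfolding conv_def by measurable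

text \<open>Young's inequality in \<open>L1\<close>. The second factor is kept arbitrary because it
  will be either the kernel, of mass 1, or the Taylor remainder of the kernel.\<close>

lemma nn_integral_conv_le:
  assumes [measurable]: "f \<in> borel_measurable borel" "\<zeta> \<in> borel_measurable borel"
  shows "(\<integral>\<^sup>+x. ennreal \<bar>conv f \<zeta> x\<bar> \<partial>lborel) \<le> (\<integral>\<^sup>+x. ennreal \<bar>f x\<bar> \<partial>lborel) * (\<integral>\<^sup>+x. ennreal \<bar>\<zeta> x\<bar> \<partial>lborel)"
proof -
  have "(\<integral>\<^sup>+x. ennreal \<bar>conv f \<zeta> x\<bar> \<partial>lborel) \<le> (\<integral>\<^sup>+x. \<integral>\<^sup>+y. ennreal \<bar>f y\<bar> * ennreal \<bar>\<zeta> (x - y)\<bar> \<partial>lborel \<partial>lborel)"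
    unfolding conv_def
    using ennreal_norm_integral_le[of lborel "\<lambda>y. f y * \<zeta> (x - y)" for x]
    by (intro nn_integral_mono) (simp add: abs_mult ennreal_mult)
  also have "\<dots> = (\<integral>\<^sup>+y. \<integral>\<^sup>+x. ennreal \<bar>f y\<bar> * ennreal \<bar>\<zeta> (x - y)\<bar> \<partial>lborel \<partial>lborel)"
    by (rule lborel_Tonelli) measurable
  also have "\<dots> = (\<integral>\<^sup>+y. ennreal \<bar>f y\<bar> * (\<integral>\<^sup>+x. ennreal \<bar>\<zeta> x\<bar> \<partial>lborel) \<partial>lborel)"
    using nn_integral_lborel_shift[of "\<lambda>x. ennreal \<bar>\<zeta> x\<bar>" "- y" for y]
    by (intro nn_integral_cong) (simp add: nn_integral_cmult)
  also have "\<dots> = (\<integral>\<^sup>+x. ennreal \<bar>f x\<bar> \<partial>lborel) * (\<integral>\<^sup>+x. ennreal \<bar>\<zeta> x\<bar> \<partial>lborel)"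
    by (rule nn_integral_multc) auto
  finally show ?thesis .
qed

text \<open>\<open>G\<close> is the gradient of \<open>\<eta>\<close>. Its role is encoded by a
  uniform quadratic Taylor remainder, as holds for a kernel with Lipschitz gradient; this single
  inequality yields both the estimates of translation differences and the derivatives of mollified
  fields.\<close>

locale mollifier =
  fixes \<eta> :: "'a::euclidean_space \<Rightarrow> real" and G :: "'a \<Rightarrow> 'a" and \<epsilon> L :: real
  assumes eps_pos: "\<epsilon> > 0"
    and cont_eta: "continuous_on UNIV \<eta>" and cont_G: "continuous_on UNIV G"
    and supp: "\<And>z. norm z \<ge> \<epsilon> \<Longrightarrow> \<eta> z = 0" "\<And>z. norm z \<ge> \<epsilon> \<Longrightarrow> G z = 0"
    and nonneg: "\<And>z. \<eta> z \<ge> 0"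
    and total: "(\<integral>\<^sup>+z. ennreal (\<eta> z) \<partial>lborel) = 1"
    and taylor: "\<And>z h. norm h \<le> 1 \<Longrightarrow> \<bar>\<eta> (z + h) - \<eta> z - G z \<bullet> h\<bar> \<le> L * (norm h)\<^sup>2"
begin

lemma measurable_eta [measurable]: "\<eta> \<in> borel_measurable borel"
  using cont_eta by (rule borel_measurable_continuous_onI)

lemma measurable_G [measurable]: "G \<in> borel_measurable borel"
  using cont_G by (rule borel_measurable_continuous_onI)

lemma bounded_kernel: obtains B where "B \<ge> 0" "\<And>z. \<bar>\<eta> z\<bar> \<le> B" "\<And>z. norm (G z) \<le> B"
proof -
  have "bounded (\<eta> ` cball 0 \<epsilon>)" "bounded (G ` cball 0 \<epsilon>)"
    by (auto intro!: compact_imp_bounded compact_continuous_image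
        intro: continuous_on_subset cont_eta cont_G)
  then obtain B1 B2 where B: "\<And>z. z \<in> cball 0 \<epsilon> \<Longrightarrow> norm (\<eta> z) \<le> B1" "\<And>z. z \<in> cball 0 \<epsilon> \<Longrightarrow> norm (G z) \<le> B2"
    unfolding bounded_iff by (metis imageI)
  show ?thesis
  proof (rule that[of "max (max B1 B2) 0"])
    fix z
    show "\<bar>\<eta> z\<bar> \<le> max (max B1 B2) 0" "norm (G z) \<le> max (max B1 B2) 0"
      using B[of z] supp[of z] by (cases "norm z \<le> \<epsilon>"; force)+
  qed simp
qed

lemma L_nonneg: "L \<ge> 0"
proof -
  obtain b :: 'a where "b \<in> Basis" using nonempty_Basis by blast
  then show ?thesis using taylor[of b 0] by simp
qed

lemma integrable_shift_eta: "f \<in> borel_measurable borel \<Longrightarrow> (\<And>y. \<bar>f y\<bar> \<le> C) \<Longrightarrow> integrable lborel (\<lambda>y. f y * \<eta> (x - y))"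
proof -
  assume [measurable]: "f \<in> borel_measurable borel" and f: "\<And>y. \<bar>f y\<bar> \<le> C"
  obtain B where B: "B \<ge> 0" "\<And>z. \<bar>\<eta> z\<bar> \<le> B" "\<And>z. norm (G z) \<le> B" using bounded_kernel by metis
  show ?thesis
  proof (rule integrable_bounded_support[where a=x and R=\<epsilon> and B="C * B"])
    show "norm (f y * \<eta> (x - y)) \<le> C * B" for y
      using f[of y] B(2)[of "x - y"] by (auto simp: abs_mult intro!: mult_mono intro: order_trans[OF abs_ge_zero])
    show "f y * \<eta> (x - y) = 0" if "y \<notin> cball x \<epsilon>" for y
      using that supp(1)[of "x - y"] by (simp add: dist_norm)
  qed measurable
qed

lemma integrable_shift_G: "f \<in> borel_measurable borel \<Longrightarrow> (\<And>y. \<bar>f y\<bar> \<le> C) \<Longrightarrow> integrable lborel (\<lambda>y. f y *\<^sub>R G (x - y))"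
proof -
  assume [measurable]: "f \<in> borel_measurable borel" and f: "\<And>y. \<bar>f y\<bar> \<le> C"
  obtain B where B: "B \<ge> 0" "\<And>z. \<bar>\<eta> z\<bar> \<le> B" "\<And>z. norm (G z) \<le> B" using bounded_kernel by metis
  show ?thesis
  proof (rule integrable_bounded_support[where a=x and R=\<epsilon> and B="C * B"])
    show "norm (f y *\<^sub>R G (x - y)) \<le> C * B" for y
      using f[of y] B(3)[of "x - y"] by (auto intro!: mult_mono intro: order_trans[OF abs_ge_zero])
    show "f y *\<^sub>R G (x - y) = 0" if "y \<notin> cball x \<epsilon>" for y
      using that supp(2)[of "x - y"] by (simp add: dist_norm)
  qed measurable
qed

text \<open>Convolution commutes with translations, and convolution with a probability density does
  not increase the \<open>L1\<close> norm.\<close>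

lemma L1_shift_conv_le:
  assumes [measurable]: "f \<in> borel_measurable borel" and C: "\<And>y. \<bar>f y\<bar> \<le> C"
  shows "L1_shift (conv f \<eta>) h \<le> L1_shift f h"
proof -
  have "conv f \<eta> (x + h) - conv f \<eta> x = conv (\<lambda>y. f (y + h) - f y) \<eta> x" for x
  proof -
    have "conv f \<eta> (x + h) = (\<integral>y. f (y + h) * \<eta> (x - y) \<partial>lborel)"
      unfolding conv_def using integral_lborel_shift[of "\<lambda>y. f y * \<eta> (x + h - y)" h] by simp
    moreover have "integrable lborel (\<lambda>y. f (y + h) * \<eta> (x - y))" "integrable lborel (\<lambda>y. f y * \<eta> (x - y))"
      using C by (auto intro!: integrable_shift_eta)
    ultimately show ?thesis
      by (simp add: conv_def left_diff_distrib)
  qed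
  then have "L1_shift (conv f \<eta>) h = (\<integral>\<^sup>+x. ennreal \<bar>conv (\<lambda>y. f (y + h) - f y) \<eta> x\<bar> \<partial>lborel)"
    by (simp add: L1_shift_def)
  also have "\<dots> \<le> L1_shift f h * (\<integral>\<^sup>+x. ennreal \<bar>\<eta> x\<bar> \<partial>lborel)"
    unfolding L1_shift_def by (rule nn_integral_conv_le) measurable
  finally show ?thesis using nonneg total by simp
qed

section \<open>The gradient of a mollification and its Taylor remainder\<close>

text \<open>The gradient of \<open>conv f \<eta>\<close>, with the derivative placed on the kernel
  so that it makes sense for discontinuous \<open>f\<close>.\<close>

definition grad :: "('a \<Rightarrow> real) \<Rightarrow> 'a \<Rightarrow> 'a" where
  "grad f x = (\<integral>y. f y *\<^sub>R G (x - y) \<partial>lborel)"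

lemma grad_measurable [measurable]:
  assumes [measurable]: "f \<in> borel_measurable borel"
  shows "grad f \<in> borel_measurable borel"
  unfolding grad_def by measurable

text \<open>For \<open>norm h \<le> 1\<close> the Taylor remainder of \<open>\<eta>\<close> is at
  most \<open>L * (norm h)\<^sup>2\<close> and vanishes outside
  \<open>cball 0 (\<epsilon> + 1)\<close>; the constant bounds its \<open>L1\<close> norm divided by
  \<open>(norm h)\<^sup>2\<close>.\<close>

definition taylor_const :: real where "taylor_const = L * measure lborel (cball (0::'a) (\<epsilon> + 1))"

lemma taylor_const_nonneg: "taylor_const \<ge> 0"
  unfolding taylor_const_def using L_nonneg by simp

text \<open>The Taylor remainder of \<open>conv f \<eta>\<close> is the convolution of
  \<open>f\<close> with the Taylor remainder \<open>\<zeta>\<close> of the kernel, so Young's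
  inequality applies.\<close>

lemma nn_integral_taylor_le:
  assumes [measurable]: "f \<in> borel_measurable borel" and C: "\<And>y. \<bar>f y\<bar> \<le> C" and h: "norm h \<le> 1"
  shows "(\<integral>\<^sup>+x. ennreal \<bar>conv f \<eta> (x + h) - conv f \<eta> x - grad f x \<bullet> h\<bar> \<partial>lborel)
    \<le> (\<integral>\<^sup>+x. ennreal \<bar>f x\<bar> \<partial>lborel) * ennreal (taylor_const * (norm h)\<^sup>2)"
proof -
  define \<zeta> where "\<zeta> z = \<eta> (z + h) - \<eta> z - G z \<bullet> h" for z
  have [measurable]: "\<zeta> \<in> borel_measurable borel" unfolding \<zeta>_def by measurable
  have "conv f \<eta> (x + h) - conv f \<eta> x - grad f x \<bullet> h = conv f \<zeta> x" for x
  proof -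
    have i: "integrable lborel (\<lambda>y. f y * \<eta> (x + h - y))" "integrable lborel (\<lambda>y. f y * \<eta> (x - y))"
        "integrable lborel (\<lambda>y. f y *\<^sub>R G (x - y))"
      using C by (auto intro!: integrable_shift_eta integrable_shift_G)
    then have i2: "integrable lborel (\<lambda>y. (f y *\<^sub>R G (x - y)) \<bullet> h)" by (intro integrable_inner_left)
    have "grad f x \<bullet> h = (\<integral>y. (f y *\<^sub>R G (x - y)) \<bullet> h \<partial>lborel)"
      unfolding grad_def by (rule integral_inner_left[symmetric]) (rule i(3))
    then have "conv f \<eta> (x + h) - conv f \<eta> x - grad f x \<bullet> h = (\<integral>y. f y * \<eta> (x + h - y) - f y * \<eta> (x - y) - (f y *\<^sub>R G (x - y)) \<bullet> h \<partial>lborel)"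
      unfolding conv_def using i i2 by (simp del: inner_scaleR_left)
    also have "\<dots> = conv f \<zeta> x"
      unfolding conv_def \<zeta>_def by (intro Bochner_Integration.integral_cong) (auto simp: algebra_simps)
    finally show ?thesis .
  qed
  then have "(\<integral>\<^sup>+x. ennreal \<bar>conv f \<eta> (x + h) - conv f \<eta> x - grad f x \<bullet> h\<bar> \<partial>lborel) = (\<integral>\<^sup>+x. ennreal \<bar>conv f \<zeta> x\<bar> \<partial>lborel)"
    by simp
  also have "\<dots> \<le> (\<integral>\<^sup>+x. ennreal \<bar>f x\<bar> \<partial>lborel) * (\<integral>\<^sup>+x. ennreal \<bar>\<zeta> x\<bar> \<partial>lborel)"
    by (rule nn_integral_conv_le) measurable
  also have "\<dots> \<le> (\<integral>\<^sup>+x. ennreal \<bar>f x\<bar> \<partial>lborel) * ennreal (taylor_const * (norm h)\<^sup>2)"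
  proof (rule mult_left_mono)
    have "(\<integral>\<^sup>+x. ennreal \<bar>\<zeta> x\<bar> \<partial>lborel) \<le> (\<integral>\<^sup>+x. ennreal (L * (norm h)\<^sup>2) * indicator (cball (0::'a) (\<epsilon> + 1)) x \<partial>lborel)"
    proof (rule nn_integral_mono)
      fix z
      show "ennreal \<bar>\<zeta> z\<bar> \<le> ennreal (L * (norm h)\<^sup>2) * indicator (cball 0 (\<epsilon> + 1)) z"
      proof (cases "norm z \<le> \<epsilon> + 1")
        case True
        then show ?thesis using taylor[OF h, of z] by (simp add: \<zeta>_def ennreal_leI)
      next
        case False
        have "norm z \<le> norm (z + h) + norm h" by (metis add_diff_cancel norm_triangle_ineq4)
        with False h have "norm (z + h) \<ge> \<epsilon>" "norm z \<ge> \<epsilon>" by auto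
        then have "\<zeta> z = 0" by (simp add: \<zeta>_def supp)
        then show ?thesis by simp
      qed
    qed
    also have "\<dots> = ennreal (L * (norm h)\<^sup>2) * emeasure lborel (cball (0::'a) (\<epsilon> + 1))"
      by (rule nn_integral_cmult_indicator) simp
    also have "emeasure lborel (cball (0::'a) (\<epsilon> + 1)) = ennreal (measure lborel (cball (0::'a) (\<epsilon> + 1)))"
      by (rule emeasure_eq_ennreal_measure) (use emeasure_lborel_cball_finite[of "0::'a" "\<epsilon>+1"] in auto)
    finally show "(\<integral>\<^sup>+x. ennreal \<bar>\<zeta> x\<bar> \<partial>lborel) \<le> ennreal (taylor_const * (norm h)\<^sup>2)"
      using L_nonneg by (simp add: taylor_const_def ennreal_mult[symmetric] mult_ac)
  qed simp
  finally show ?thesis .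
qed

text \<open>A single Taylor step of the mollification, whose translation differences are dominated
  by those of \<open>f\<close>. The quadratic error remains here; it is harmless for the lower
  bound, where it is of higher order in \<open>\<tau>\<close>.\<close>

lemma nn_integral_grad_inner_le:
  assumes [measurable]: "f \<in> borel_measurable borel" and C: "\<And>y. \<bar>f y\<bar> \<le> C" and h: "norm h \<le> 1"
  shows "(\<integral>\<^sup>+x. ennreal \<bar>grad f x \<bullet> h\<bar> \<partial>lborel)
    \<le> L1_shift f h + (\<integral>\<^sup>+x. ennreal \<bar>f x\<bar> \<partial>lborel) * ennreal (taylor_const * (norm h)\<^sup>2)"
proof -
  have "(\<integral>\<^sup>+x. ennreal \<bar>grad f x \<bullet> h\<bar> \<partial>lborel)
     \<le> (\<integral>\<^sup>+x. ennreal \<bar>conv f \<eta> (x + h) - conv f \<eta> x\<bar> + ennreal \<bar>conv f \<eta> (x + h) - conv f \<eta> x - grad f x \<bullet> h\<bar> \<partial>lborel)"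
    by (intro nn_integral_mono) (auto simp flip: ennreal_plus)
  also have "\<dots> = L1_shift (conv f \<eta>) h + (\<integral>\<^sup>+x. ennreal \<bar>conv f \<eta> (x + h) - conv f \<eta> x - grad f x \<bullet> h\<bar> \<partial>lborel)"
    unfolding L1_shift_def by (rule nn_integral_add) measurable
  also have "\<dots> \<le> L1_shift f h + (\<integral>\<^sup>+x. ennreal \<bar>f x\<bar> \<partial>lborel) * ennreal (taylor_const * (norm h)\<^sup>2)"
    using L1_shift_conv_le[of f C h] nn_integral_taylor_le[of f C h] assms by (intro add_mono) auto
  finally show ?thesis .
qed

text \<open>Splitting \<open>h\<close> into \<open>m\<close> equal steps makes the quadratic Taylor error vanish.\<close>

lemma L1_shift_conv_le_grad:
  assumes [measurable]: "f \<in> borel_measurable borel" and C: "\<And>y. \<bar>f y\<bar> \<le> C"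
    and fin: "(\<integral>\<^sup>+x. ennreal \<bar>f x\<bar> \<partial>lborel) < \<infinity>"
  shows "L1_shift (conv f \<eta>) h \<le> (\<integral>\<^sup>+x. ennreal \<bar>grad f x \<bullet> h\<bar> \<partial>lborel)"
proof -
  define W where "W = (\<integral>\<^sup>+x. ennreal \<bar>grad f x \<bullet> h\<bar> \<partial>lborel)"
  obtain N where N: "(\<integral>\<^sup>+x. ennreal \<bar>f x\<bar> \<partial>lborel) = ennreal N" "N \<ge> 0"
    using fin by (cases "\<integral>\<^sup>+x. ennreal \<bar>f x\<bar> \<partial>lborel") auto
  have step: "L1_shift (conv f \<eta>) h \<le> W + ennreal (N * taylor_const * (norm h)\<^sup>2 / real m)"
    if m: "real m \<ge> norm h" "m > 0" for m :: nat
  proof -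
    define k where "k = (1 / real m) *\<^sub>R h"
    have k: "norm k \<le> 1" "norm k = norm h / real m" using m by (auto simp: k_def field_simps)
    have "L1_shift (conv f \<eta>) k \<le> (\<integral>\<^sup>+x. ennreal \<bar>grad f x \<bullet> k\<bar> + ennreal \<bar>conv f \<eta> (x + k) - conv f \<eta> x - grad f x \<bullet> k\<bar> \<partial>lborel)"
      unfolding L1_shift_def by (intro nn_integral_mono) (auto simp flip: ennreal_plus)
    also have "\<dots> = (\<integral>\<^sup>+x. ennreal \<bar>grad f x \<bullet> k\<bar> \<partial>lborel) + (\<integral>\<^sup>+x. ennreal \<bar>conv f \<eta> (x + k) - conv f \<eta> x - grad f x \<bullet> k\<bar> \<partial>lborel)"
      by (rule nn_integral_add) measurable
    also have "\<dots> \<le> (\<integral>\<^sup>+x. ennreal \<bar>grad f x \<bullet> k\<bar> \<partial>lborel) + ennreal N * ennreal (taylor_const * (norm k)\<^sup>2)"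
      using nn_integral_taylor_le[of f C k] assms k(1) N(1) by (intro add_mono) auto
    also have "(\<integral>\<^sup>+x. ennreal \<bar>grad f x \<bullet> k\<bar> \<partial>lborel) = (\<integral>\<^sup>+x. ennreal (1 / real m) * ennreal \<bar>grad f x \<bullet> h\<bar> \<partial>lborel)"
      by (intro nn_integral_cong) (auto simp: k_def abs_mult simp flip: ennreal_mult')
    also have "\<dots> = ennreal (1 / real m) * W"
      unfolding W_def by (rule nn_integral_cmult) measurable
    finally have 1: "L1_shift (conv f \<eta>) k \<le> ennreal (1 / real m) * W + ennreal N * ennreal (taylor_const * (norm k)\<^sup>2)" .
    have "L1_shift (conv f \<eta>) h = L1_shift (conv f \<eta>) (real m *\<^sub>R k)" using m by (simp add: k_def)
    also have "\<dots> \<le> of_nat m * L1_shift (conv f \<eta>) k" by (rule L1_shift_scale_le) measurable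
    also have "\<dots> \<le> of_nat m * (ennreal (1 / real m) * W + ennreal N * ennreal (taylor_const * (norm k)\<^sup>2))"
      using 1 by (rule mult_left_mono) simp
    also have "\<dots> = (ennreal (real m) * ennreal (1 / real m)) * W + ennreal (real m) * (ennreal N * ennreal (taylor_const * (norm k)\<^sup>2))"
      by (simp add: ring_distribs mult_ac ennreal_of_nat_eq_real_of_nat)
    also have "ennreal (real m) * ennreal (1 / real m) = 1" using m by (simp flip: ennreal_mult)
    also have "ennreal (real m) * (ennreal N * ennreal (taylor_const * (norm k)\<^sup>2)) = ennreal (N * taylor_const * (norm h)\<^sup>2 / real m)"
      using m N taylor_const_nonneg unfolding k(2) by (simp add: power2_eq_square field_simps flip: ennreal_mult)
    finally show ?thesis by simp
  qed
  have "(\<lambda>m. N * taylor_const * (norm h)\<^sup>2 / real m) \<longlonglongrightarrow> 0"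
    by (rule lim_const_over_n)
  then have "(\<lambda>m. W + ennreal (N * taylor_const * (norm h)\<^sup>2 / real m)) \<longlonglongrightarrow> W + ennreal 0"
    by (intro tendsto_add tendsto_const tendsto_ennrealI)
  moreover have "eventually (\<lambda>m. L1_shift (conv f \<eta>) h \<le> W + ennreal (N * taylor_const * (norm h)\<^sup>2 / real m)) sequentially"
    using eventually_gt_at_top[of "nat \<lceil>norm h\<rceil>"]
    by eventually_elim (rule step; linarith)
  ultimately have "L1_shift (conv f \<eta>) h \<le> W + ennreal 0"
    by (rule tendsto_lowerbound) simp
  then show ?thesis by (simp add: W_def)
qed

text \<open>After an interchange of the integrals the formula for the integral of
  \<open>\<bar>h \<bullet> v\<bar>\<close> over the ball is applied at each \<open>x\<close> with
  \<open>v = grad f x\<close>.\<close>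

lemma nn_integral_cball_grad:
  assumes [measurable]: "f \<in> borel_measurable borel" and "\<tau> > 0"
  shows "(\<integral>\<^sup>+h. indicator (cball 0 \<tau>) h * (\<integral>\<^sup>+x. ennreal \<bar>grad f x \<bullet> h\<bar> \<partial>lborel) \<partial>lborel)
    = ennreal (2 * unit_ball_vol (real (DIM('a) - 1)) / (real DIM('a) + 1) * \<tau> ^ (DIM('a) + 1))
       * (\<integral>\<^sup>+x. ennreal (norm (grad f x)) \<partial>lborel)"
proof -
  have "(\<integral>\<^sup>+h. indicator (cball 0 \<tau>) h * (\<integral>\<^sup>+x. ennreal \<bar>grad f x \<bullet> h\<bar> \<partial>lborel) \<partial>lborel)
     = (\<integral>\<^sup>+h. \<integral>\<^sup>+x. indicator (cball 0 \<tau>) h * ennreal \<bar>grad f x \<bullet> h\<bar> \<partial>lborel \<partial>lborel)"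
    by (intro nn_integral_cong) (subst nn_integral_cmult, auto)
  also have "\<dots> = (\<integral>\<^sup>+x. \<integral>\<^sup>+h. indicator (cball 0 \<tau>) h * ennreal \<bar>grad f x \<bullet> h\<bar> \<partial>lborel \<partial>lborel)"
    by (rule lborel_Tonelli) measurable
  also have "\<dots> = (\<integral>\<^sup>+x. ennreal (2 * unit_ball_vol (real (DIM('a) - 1)) / (real DIM('a) + 1) * \<tau> ^ (DIM('a) + 1)) * ennreal (norm (grad f x)) \<partial>lborel)"
    by (simp only: inner_commute[of "grad f _"] nn_integral_cball_abs_inner[OF \<open>\<tau> > 0\<close>])
  also have "\<dots> = ennreal (2 * unit_ball_vol (real (DIM('a) - 1)) / (real DIM('a) + 1) * \<tau> ^ (DIM('a) + 1))
       * (\<integral>\<^sup>+x. ennreal (norm (grad f x)) \<partial>lborel)"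
    by (rule nn_integral_cmult) measurable
  finally show ?thesis .
qed

text \<open>Since the kernel has mass 1, the mollification minus \<open>f\<close> at
  \<open>x\<close> is the average of \<open>f (x - z) - f x\<close> with weight
  \<open>\<eta> z\<close>.\<close>

lemma nn_integral_conv_diff_le:
  assumes [measurable]: "f \<in> borel_measurable borel" and C: "\<And>y. \<bar>f y\<bar> \<le> C"
  shows "(\<integral>\<^sup>+x. ennreal \<bar>conv f \<eta> x - f x\<bar> \<partial>lborel) \<le> (\<integral>\<^sup>+z. ennreal (\<eta> z) * L1_shift f (- z) \<partial>lborel)"
proof -
  have "ennreal \<bar>conv f \<eta> x - f x\<bar> \<le> (\<integral>\<^sup>+z. ennreal (\<eta> z) * ennreal \<bar>f (x - z) - f x\<bar> \<partial>lborel)" for x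
  proof -
    have i1: "integrable lborel (\<lambda>y. f y * \<eta> (x - y))" "integrable lborel (\<lambda>y. f x * \<eta> (x - y))"
      by (rule integrable_shift_eta[OF _ C]; measurable)+
    have "(\<integral>\<^sup>+y. ennreal (\<eta> (x - y)) \<partial>lborel) = 1"
      using nn_integral_lborel_reflect[of "\<lambda>y. ennreal (\<eta> y)" x] total by simp
    then have "(\<integral>y. \<eta> (x - y) \<partial>lborel) = 1"
      using nonneg by (subst integral_eq_nn_integral) auto
    moreover have "integrable lborel (\<lambda>y. \<eta> (x - y))"
      using integrable_shift_eta[of "\<lambda>_. 1" 1 x] by simp
    ultimately have "conv f \<eta> x - f x = (\<integral>y. f y * \<eta> (x - y) - f x * \<eta> (x - y) \<partial>lborel)"
      unfolding conv_def by (subst Bochner_Integration.integral_diff[OF i1]) simp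
    also have "ennreal \<bar>\<dots>\<bar> \<le> (\<integral>\<^sup>+y. ennreal (norm (f y * \<eta> (x - y) - f x * \<eta> (x - y))) \<partial>lborel)"
      using ennreal_norm_integral_le[of lborel "\<lambda>y. f y * \<eta> (x - y) - f x * \<eta> (x - y)"] by simp
    also have "\<dots> = (\<integral>\<^sup>+y. ennreal (\<eta> (x - y)) * ennreal \<bar>f (x - (x - y)) - f x\<bar> \<partial>lborel)"
      using nonneg by (intro nn_integral_cong) (simp add: abs_mult mult.commute ennreal_mult flip: left_diff_distrib)
    also have "\<dots> = (\<integral>\<^sup>+z. ennreal (\<eta> z) * ennreal \<bar>f (x - z) - f x\<bar> \<partial>lborel)"
      by (rule nn_integral_lborel_reflect[where f="\<lambda>z. ennreal (\<eta> z) * ennreal \<bar>f (x - z) - f x\<bar>"]) measurable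
    finally show ?thesis .
  qed
  then have "(\<integral>\<^sup>+x. ennreal \<bar>conv f \<eta> x - f x\<bar> \<partial>lborel) \<le> (\<integral>\<^sup>+x. \<integral>\<^sup>+z. ennreal (\<eta> z) * ennreal \<bar>f (x - z) - f x\<bar> \<partial>lborel \<partial>lborel)"
    by (intro nn_integral_mono)
  also have "\<dots> = (\<integral>\<^sup>+z. \<integral>\<^sup>+x. ennreal (\<eta> z) * ennreal \<bar>f (x - z) - f x\<bar> \<partial>lborel \<partial>lborel)"
    by (rule lborel_Tonelli) measurable
  also have "\<dots> = (\<integral>\<^sup>+z. ennreal (\<eta> z) * L1_shift f (- z) \<partial>lborel)"
    unfolding L1_shift_def by (intro nn_integral_cong) (simp add: nn_integral_cmult)
  finally show ?thesis .
qed

end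

section \<open>Duality with test fields\<close>

lemma has_derivative_quadratic_remainder:
  fixes f :: "'a::real_normed_vector \<Rightarrow> 'b::real_normed_vector"
  assumes "bounded_linear f'" and K: "\<And>h. norm h \<le> 1 \<Longrightarrow> norm (f (x + h) - f x - f' h) \<le> K * (norm h)\<^sup>2"
  shows "(f has_derivative f') (at x)"
  unfolding has_derivative_at
proof (intro conjI assms(1))
  have "((\<lambda>h::'a. K * norm h) \<longlongrightarrow> K * norm (0::'a)) (at 0)"
    by (intro tendsto_intros)
  then have lim: "((\<lambda>h::'a. K * norm h) \<longlongrightarrow> 0) (at 0)" by simp
  show "((\<lambda>h. norm (f (x + h) - f x - f' h) / norm h) \<longlongrightarrow> 0) (at 0)"
  proof (rule Lim_null_comparison[OF _ lim])
    have "eventually (\<lambda>h::'a. norm h \<le> 1) (at 0)"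
      unfolding eventually_at by (rule exI[of _ 1]) (auto simp: dist_norm)
    then show "\<forall>\<^sub>F h in at 0. norm (norm (f (x + h) - f x - f' h) / norm h) \<le> K * norm h"
    proof eventually_elim
      case (elim h)
      then show ?case using K[of h] by (cases "h = 0") (auto simp: field_simps power2_eq_square)
    qed
  qed
qed

text \<open>Difference quotients of a compactly supported function have integral 0 by translation
  invariance. The mean value theorem bounds them by a constant on a fixed ball, and dominated
  convergence gives the derivative.\<close>

lemma integral_partial_derivative_eq_0:
  fixes f :: "'a::euclidean_space \<Rightarrow> real"
  assumes d: "\<And>x. (f has_derivative f' x) (at x)" and c: "continuous_on UNIV (\<lambda>x. f' x i)"
    and s: "\<And>x. norm x > R \<Longrightarrow> f x = 0" and i: "norm i \<le> 1"
  shows "(\<integral>x. f' x i \<partial>lborel) = 0"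
proof -
  have cf: "continuous_on UNIV f"
    using d by (meson continuous_at_imp_continuous_on has_derivative_continuous)
  have [measurable]: "f \<in> borel_measurable borel" by (rule borel_measurable_continuous_onI[OF cf])
  have [measurable]: "(\<lambda>x. f' x i) \<in> borel_measurable borel" by (rule borel_measurable_continuous_onI[OF c])
  \<comment> \<open>The quotients vanish outside radius \<open>R + 1\<close>, and the intermediate
    point of the mean value theorem lies at distance at most 1 from \<open>x\<close>; hence the
    radius \<open>R + 2\<close>.\<close>
  have "bounded ((\<lambda>x. f' x i) ` cball 0 (R + 2))"
    by (intro compact_imp_bounded compact_continuous_image continuous_on_subset[OF c]) auto
  then obtain C where C: "\<And>x. x \<in> cball 0 (R + 2) \<Longrightarrow> norm (f' x i) \<le> C"
    unfolding bounded_iff by (metis imageI)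
  define g where "g n x = real (Suc n) * (f (x + (1 / real (Suc n)) *\<^sub>R i) - f x)" for n x
  have bf: "bounded (f ` cball 0 R)"
    by (intro compact_imp_bounded compact_continuous_image continuous_on_subset[OF cf]) auto
  then obtain B where B: "\<And>x. x \<in> cball 0 R \<Longrightarrow> norm (f x) \<le> B"
    unfolding bounded_iff by (metis imageI)
  have B': "norm (f x) \<le> max B 0" for x
    using B[of x] s[of x] by (cases "norm x \<le> R") auto
  have intf: "integrable lborel f"
    by (rule integrable_bounded_support[where a=0 and R=R and B="max B 0"]) (use B' in \<open>auto simp: s\<close>)
  have intf': "integrable lborel (\<lambda>x. f (x + a))" for a
    by (rule integrable_bounded_support[where a="-a" and R=R and B="max B 0"])
      (use B' in \<open>auto simp: s dist_norm norm_minus_commute[of "-a"] add.commute\<close>)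
  have int0: "(\<integral>x. g n x \<partial>lborel) = 0" for n
    unfolding g_def using intf intf' by (simp add: integral_lborel_shift)
  have "(\<lambda>n. \<integral>x. g n x \<partial>lborel) \<longlonglongrightarrow> (\<integral>x. f' x i \<partial>lborel)"
  proof (rule integral_dominated_convergence)
    show "integrable lborel (\<lambda>x. C * indicator (cball (0::'a) (R + 1)) x :: real)"
      by (intro integrable_mult_right integrable_real_indicator emeasure_lborel_cball_finite) auto
    show "AE x in lborel. (\<lambda>n. g n x) \<longlonglongrightarrow> f' x i"
    proof (intro AE_I2)
      fix x
      have "((\<lambda>t. f (x + t *\<^sub>R i)) has_derivative (\<lambda>t. f' x (t *\<^sub>R i))) (at 0)"
        by (rule has_derivative_compose[where g=f and f="\<lambda>t. x + t *\<^sub>R i" and g'="f' x", simplified])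
          (use d[of x] in \<open>auto intro!: derivative_eq_intros\<close>)
      moreover have "f' x (t *\<^sub>R i) = t * f' x i" for t
        using linear_scale[OF has_derivative_linear[OF d[of x]], of t i] by simp
      ultimately have "((\<lambda>t. f (x + t *\<^sub>R i)) has_real_derivative f' x i) (at 0)"
        by (simp add: has_field_derivative_def mult_commute_abs)
      then have "((\<lambda>t. (f (x + t *\<^sub>R i) - f x) / t) \<longlongrightarrow> f' x i) (at 0)"
        by (simp add: has_field_derivative_iff)
      moreover have "filterlim (\<lambda>n. 1 / real (Suc n)) (at 0) sequentially"
        unfolding filterlim_at using LIMSEQ_Suc[OF lim_1_over_n] by simp
      ultimately have "(\<lambda>n. (f (x + (1 / real (Suc n)) *\<^sub>R i) - f x) / (1 / real (Suc n))) \<longlonglongrightarrow> f' x i"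
        by (rule filterlim_compose)
      then show "(\<lambda>n. g n x) \<longlonglongrightarrow> f' x i" by (simp add: g_def mult.commute)
    qed
    show "AE x in lborel. norm (g n x) \<le> C * indicator (cball (0::'a) (R + 1)) x" for n
    proof (intro AE_I2)
      fix x
      define t where "t = 1 / real (Suc n)"
      have t: "0 < t" "t \<le> 1" by (auto simp: t_def)
      have nt: "norm (t' *\<^sub>R i) \<le> 1" if "0 \<le> t'" "t' \<le> t" for t'
        using that t i by (auto intro: mult_le_one)
      show "norm (g n x) \<le> C * indicator (cball (0::'a) (R + 1)) x"
      proof (cases "norm x \<le> R + 1")
        case True
        have "\<exists>t'\<in>{0<..<t}. f (x + t *\<^sub>R i) - f (x + 0 *\<^sub>R i) = (t - 0) * f' (x + t' *\<^sub>R i) i"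
        proof -
          have der: "((\<lambda>t. f (x + t *\<^sub>R i)) has_derivative (\<lambda>u. u * f' (x + t' *\<^sub>R i) i)) (at t')" for t'
          proof -
            have "((\<lambda>t. f (x + t *\<^sub>R i)) has_derivative (\<lambda>u. f' (x + t' *\<^sub>R i) (u *\<^sub>R i))) (at t')"
              by (rule has_derivative_compose[where g=f and f="\<lambda>t. x + t *\<^sub>R i", simplified])
                (use d in \<open>auto intro!: derivative_eq_intros\<close>)
            then show ?thesis
              using linear_scale[OF has_derivative_linear[OF d[of "x + t' *\<^sub>R i"]], of _ i] by simp
          qed
          from mvt_simple[OF t(1), of "\<lambda>t. f (x + t *\<^sub>R i)" "\<lambda>t' u. u * f' (x + t' *\<^sub>R i) i"]
          show ?thesis using der has_derivative_at_withinI by blast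
        qed
        then obtain t' where t': "0 < t'" "t' < t" "f (x + t *\<^sub>R i) - f x = t * f' (x + t' *\<^sub>R i) i" by auto
        have "norm (x + t' *\<^sub>R i) \<le> R + 2"
          using True nt[of t'] t' norm_triangle_ineq[of x "t' *\<^sub>R i"] by linarith
        then have "norm (f' (x + t' *\<^sub>R i) i) \<le> C" by (intro C) simp
        moreover have "g n x = f' (x + t' *\<^sub>R i) i"
          unfolding g_def t_def[symmetric] t'(3) by (simp add: t_def)
        ultimately show ?thesis using True by simp
      next
        case False
        have "norm x \<le> norm (x + t *\<^sub>R i) + norm (t *\<^sub>R i)" by (metis add_diff_cancel norm_triangle_ineq4)
        then have "norm (x + t *\<^sub>R i) > R" "norm x > R" using False nt[of t] t by linarith+
        then show ?thesis unfolding g_def t_def[symmetric] using False s by simp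
      qed
    qed
  qed (auto simp: g_def)
  then show ?thesis unfolding int0 by (simp add: LIMSEQ_const_iff)
qed

lemma test_fieldsD:
  assumes "(\<phi>, D) \<in> test_fields"
  shows "(\<phi> has_derivative blinfun_apply (D x)) (at x)" "continuous_on UNIV D"
    "bounded {x. \<phi> x \<noteq> 0}" "norm (\<phi> x) \<le> 1"
  using assms by (auto simp: test_fields_def)

lemma test_fields_continuous:
  assumes "(\<phi>, D) \<in> test_fields"
  shows "continuous_on UNIV \<phi>" "continuous_on UNIV (\<lambda>x. blinfun_apply (D x) h)" "continuous_on UNIV (divg D)"
proof -
  show "continuous_on UNIV \<phi>"
    using test_fieldsD(1)[OF assms] by (meson continuous_at_imp_continuous_on has_derivative_continuous)
  show 2: "continuous_on UNIV (\<lambda>x. blinfun_apply (D x) h)" for h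
    using test_fieldsD(2)[OF assms] by (intro continuous_intros)
  show "continuous_on UNIV (divg D)"
    unfolding divg_def by (intro continuous_intros 2)
qed

text \<open>Outside a closed ball containing the support, the field vanishes in a whole
  neighbourhood of each point, so uniqueness of the derivative makes the divergence vanish there
  too.\<close>

lemma test_fields_support:
  assumes "(\<phi>, D) \<in> test_fields"
  obtains R where "R > 0" "\<And>x. norm x > R \<Longrightarrow> \<phi> x = 0" "\<And>x. norm x > R \<Longrightarrow> divg D x = 0"
proof -
  obtain R where R: "R > 0" "\<And>x. \<phi> x \<noteq> 0 \<Longrightarrow> norm x \<le> R"
    using test_fieldsD(3)[OF assms] by (auto simp: bounded_pos)
  have "divg D x = 0" if "norm x > R" for x
  proof -
    have "open {x::'a. norm x > R}" by (intro open_Collect_less continuous_intros)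
    then have "eventually (\<lambda>y. norm y > R) (nhds x)" using that eventually_nhds by blast
    then have "eventually (\<lambda>y. \<phi> y = 0) (nhds x)" by eventually_elim (use R(2) in force)
    then have "eventually (\<lambda>y. \<phi> y = 0) (at x)" "\<phi> x = 0" by (simp_all add: eventually_nhds_conv_at)
    then have "((\<lambda>_. 0) has_derivative blinfun_apply (D x)) (at x)"
      by (rule has_derivative_transform_eventually[OF test_fieldsD(1)[OF assms]]) simp
    then have "blinfun_apply (D x) = (\<lambda>_. 0)"
      using has_derivative_unique has_derivative_const by blast
    then show ?thesis by (simp add: divg_def)
  qed
  then show ?thesis using that[of R] R by force
qed

context mollifier
begin

lemma has_derivative_eta: "(\<eta> has_derivative (\<lambda>h. G z \<bullet> h)) (at z)"
  by (rule has_derivative_quadratic_remainder[where K=L])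
    (use taylor[of _ z] in \<open>auto simp: bounded_linear_inner_right\<close>)

text \<open>Integration by parts: for each basis vector \<open>i\<close> the partial derivative
  along \<open>i\<close> of the product of the translated kernel and the component
  \<open>\<phi> x \<bullet> i\<close> has integral 0. Summation over the basis gives the
  claim.\<close>

lemma integral_eta_divg:
  assumes t: "(\<phi>, D) \<in> test_fields"
  shows "(\<integral>x. \<eta> (x - y) * divg D x \<partial>lborel) = - (\<integral>x. G (x - y) \<bullet> \<phi> x \<partial>lborel)"
proof -
  note c = test_fields_continuous[OF t] and D = test_fieldsD[OF t]
  obtain R where R: "R > 0" "\<And>x. norm x > R \<Longrightarrow> \<phi> x = 0" "\<And>x. norm x > R \<Longrightarrow> divg D x = 0"
    using test_fields_support[OF t] by metis
  have c_eta: "continuous_on UNIV (\<lambda>x. \<eta> (x - y))"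
    by (rule continuous_on_compose2[OF cont_eta]) (auto intro!: continuous_intros)
  have c_G: "continuous_on UNIV (\<lambda>x. G (x - y))"
    by (rule continuous_on_compose2[OF cont_G]) (auto intro!: continuous_intros)
  define f' where "f' i x h = \<eta> (x - y) * (blinfun_apply (D x) h \<bullet> i) + (G (x - y) \<bullet> h) * (\<phi> x \<bullet> i)" for i x h
  have int: "integrable lborel g" if "continuous_on UNIV g" "\<And>x. norm (x - y) \<ge> \<epsilon> \<Longrightarrow> g x = 0" for g :: "'a \<Rightarrow> real"
  proof -
    have "bounded (g ` cball y \<epsilon>)"
      by (intro compact_imp_bounded compact_continuous_image continuous_on_subset[OF that(1)]) auto
    then obtain C where C: "\<And>x. x \<in> cball y \<epsilon> \<Longrightarrow> norm (g x) \<le> C"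
      unfolding bounded_iff by (metis imageI)
    show ?thesis
    proof (rule integrable_bounded_support[where a=y and R=\<epsilon> and B="max C 0"])
      show "norm (g x) \<le> max C 0" for x
        using C[of x] that(2)[of x] by (cases "x \<in> cball y \<epsilon>") (auto simp: dist_norm norm_minus_commute)
    qed (use that in \<open>auto simp: dist_norm norm_minus_commute intro: borel_measurable_continuous_onI\<close>)
  qed
  have zero: "(\<integral>x. f' i x i \<partial>lborel) = 0" if "i \<in> Basis" for i
  proof (rule integral_partial_derivative_eq_0[where f="\<lambda>x. \<eta> (x - y) * (\<phi> x \<bullet> i)" and R=R and f'="f' i" and i=i])
    fix x
    have "((\<lambda>x. \<eta> (x - y)) has_derivative (\<lambda>h. G (x - y) \<bullet> h)) (at x)"
      by (rule has_derivative_compose[where g=\<eta> and f="\<lambda>x. x - y" and f'="\<lambda>h. h"])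
        (auto intro!: derivative_eq_intros has_derivative_eta)
    moreover have "((\<lambda>x. \<phi> x \<bullet> i) has_derivative (\<lambda>h. blinfun_apply (D x) h \<bullet> i)) (at x)"
      by (intro has_derivative_inner_left D(1))
    ultimately show "((\<lambda>x. \<eta> (x - y) * (\<phi> x \<bullet> i)) has_derivative f' i x) (at x)"
      unfolding f'_def by (rule has_derivative_mult)
  next
    show "continuous_on UNIV (\<lambda>x. f' i x i)"
      unfolding f'_def by (intro continuous_intros c_eta c_G c)
  qed (use R that in auto)
  have int': "integrable lborel (\<lambda>x. f' i x i)" for i
    by (rule int) (auto simp: f'_def supp intro!: continuous_intros c_eta c_G c)
  have "0 = (\<Sum>i\<in>Basis. \<integral>x. f' i x i \<partial>lborel)" using zero by simp
  also have "\<dots> = (\<integral>x. (\<Sum>i\<in>Basis. f' i x i) \<partial>lborel)" using int' by simp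
  also have "\<dots> = (\<integral>x. \<eta> (x - y) * divg D x + G (x - y) \<bullet> \<phi> x \<partial>lborel)"
  proof -
    have "(\<Sum>i\<in>Basis. f' i x i) = \<eta> (x - y) * divg D x + G (x - y) \<bullet> \<phi> x" for x
      unfolding f'_def divg_def sum.distrib sum_distrib_left euclidean_inner[of "G (x - y)" "\<phi> x"] ..
    then show ?thesis by simp
  qed
  also have "\<dots> = (\<integral>x. \<eta> (x - y) * divg D x \<partial>lborel) + (\<integral>x. G (x - y) \<bullet> \<phi> x \<partial>lborel)"
    by (intro Bochner_Integration.integral_add int) (auto simp: supp intro!: continuous_intros c_eta c_G c)
  finally show ?thesis by simp
qed

text \<open>Fubini's theorem transfers the kernel gradient from the set to the field. The field is
  only assumed measurable because the lemma is applied to a truncated sign field, which is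
  discontinuous in general.\<close>

lemma integral_grad_inner:
  assumes [measurable]: "\<phi> \<in> borel_measurable borel" "F \<in> sets borel"
    and n: "\<And>x. norm (\<phi> x) \<le> 1" and R: "\<And>x. norm x > R \<Longrightarrow> \<phi> x = 0"
  shows "(\<integral>y. indicator F y * (\<integral>x. G (x - y) \<bullet> \<phi> x \<partial>lborel) \<partial>lborel) = (\<integral>x. grad (indicator F) x \<bullet> \<phi> x \<partial>lborel)"
    and "integrable lborel (\<lambda>x. grad (indicator F) x \<bullet> \<phi> x)"
proof -
  obtain B where B: "B \<ge> 0" "\<And>z. \<bar>\<eta> z\<bar> \<le> B" "\<And>z. norm (G z) \<le> B" using bounded_kernel by metis
  define f where "f x y = indicator F y * (G (x - y) \<bullet> \<phi> x)" for x y
  have [measurable]: "(\<lambda>p. f (fst p) (snd p)) \<in> borel_measurable (borel \<Otimes>\<^sub>M borel)" unfolding f_def by measurable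
  have fint: "integrable (lborel \<Otimes>\<^sub>M lborel) (\<lambda>p. f (fst p) (snd p))"
  \<comment> \<open>The field confines \<open>x\<close> to radius \<open>R\<close>, and the support
    of \<open>G\<close> then confines \<open>y\<close> to radius
    \<open>R + \<epsilon>\<close>.\<close>
  proof (rule integrableI_bounded_set[where A="cball 0 R \<times> cball 0 (R + \<epsilon>)" and B="B * 1"])
    show "emeasure (lborel \<Otimes>\<^sub>M lborel) (cball (0::'a) R \<times> cball (0::'a) (R + \<epsilon>)) < \<infinity>"
      by (subst lborel.emeasure_pair_measure_Times) (auto simp: ennreal_mult_less_top emeasure_lborel_cball_finite[unfolded infinity_ennreal_def])
    have b: "norm (f x y) \<le> B * 1" for x y
    proof -
      have "\<bar>G (x - y) \<bullet> \<phi> x\<bar> \<le> B * 1"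
        using B n by (intro order_trans[OF Cauchy_Schwarz_ineq2] mult_mono) auto
      then show ?thesis using B by (auto simp: f_def indicator_def)
    qed
    have z: "f x y = 0" if "(x, y) \<notin> cball 0 R \<times> cball 0 (R + \<epsilon>)" for x y
    proof (cases "norm x \<le> R")
      case True
      have "norm y \<le> norm (x - y) + norm x" using norm_triangle_ineq4[of x "x - y"] by simp
      with True that have "norm (x - y) \<ge> \<epsilon>" by auto
      then show ?thesis by (simp add: f_def supp)
    qed (simp add: f_def R)
    show "AE p in lborel \<Otimes>\<^sub>M lborel. p \<in> cball 0 R \<times> cball 0 (R + \<epsilon>) \<longrightarrow> norm (f (fst p) (snd p)) \<le> B * 1"
      using b by simp
    show "AE p in lborel \<Otimes>\<^sub>M lborel. p \<notin> cball 0 R \<times> cball 0 (R + \<epsilon>) \<longrightarrow> f (fst p) (snd p) = 0"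
      using z by (intro AE_I2 impI) (metis prod.collapse)
  qed (auto cong: measurable_cong_sets)
  then have fint': "integrable (lborel \<Otimes>\<^sub>M lborel) (case_prod f)" by (simp add: case_prod_beta')
  have i1: "(\<integral>y. f x y \<partial>lborel) = grad (indicator F) x \<bullet> \<phi> x" for x
  proof -
    have "integrable lborel (\<lambda>y. indicator F y *\<^sub>R G (x - y))"
      by (rule integrable_shift_G[where C=1]) (auto simp: indicator_def)
    then show ?thesis unfolding grad_def by (subst integral_inner_left[symmetric]) (auto simp: f_def[abs_def])
  qed
  have i2: "(\<integral>x. f x y \<partial>lborel) = indicator F y * (\<integral>x. G (x - y) \<bullet> \<phi> x \<partial>lborel)" for y
    unfolding f_def by (cases "y \<in> F") auto
  show "(\<integral>y. indicator F y * (\<integral>x. G (x - y) \<bullet> \<phi> x \<partial>lborel) \<partial>lborel) = (\<integral>x. grad (indicator F) x \<bullet> \<phi> x \<partial>lborel)"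
    unfolding i1[symmetric] i2[symmetric] by (rule lborel_pair.Fubini_integral[OF fint'])
  show "integrable lborel (\<lambda>x. grad (indicator F) x \<bullet> \<phi> x)"
    unfolding i1[symmetric] using lborel_pair.integrable_fst'[OF fint] by simp
qed

text \<open>Averaging against a probability density preserves the bound 1, and the compact supports
  add up. The derivative falls on the kernel, whose Taylor remainder controls that of the
  average.\<close>

lemma mollified_test_field:
  assumes [measurable]: "\<phi> \<in> borel_measurable borel"
    and n: "\<And>x. norm (\<phi> x) \<le> 1" and R: "\<And>x. norm x > R \<Longrightarrow> \<phi> x = 0"
  obtains \<psi> D where "(\<psi>, D) \<in> test_fields" "\<And>y. divg D y = (\<integral>x. G (x - y) \<bullet> \<phi> x \<partial>lborel)"
proof -
  obtain B where B: "B \<ge> 0" "\<And>z. \<bar>\<eta> z\<bar> \<le> B" "\<And>z. norm (G z) \<le> B" using bounded_kernel by metis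
  have int: "integrable lborel (\<lambda>x. g x *\<^sub>R \<phi> x)" if [measurable]: "g \<in> borel_measurable borel" and g: "\<And>x. \<bar>g x\<bar> \<le> C" for g C
  proof (rule integrable_bounded_support[where a=0 and R=R and B="C * 1"])
    show "norm (g x *\<^sub>R \<phi> x) \<le> C * 1" for x
      using g[of x] n[of x] unfolding norm_scaleR by (intro mult_mono) auto
  qed (auto simp: R)
  have Gb: "\<bar>G z \<bullet> h\<bar> \<le> B * norm h" for z h
    using B by (intro order_trans[OF Cauchy_Schwarz_ineq2] mult_right_mono) auto
  have intG: "integrable lborel (\<lambda>x. (G (x - y) \<bullet> h) *\<^sub>R \<phi> x)" for y h
    by (rule int[where C="B * norm h"]) (auto simp: Gb)
  have inteta: "integrable lborel (\<lambda>x. \<eta> (x - y) *\<^sub>R \<phi> x)" for y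
    by (rule int[where C=B]) (auto simp: B)
  have intphi: "integrable lborel (\<lambda>x. norm (\<phi> x))"
    using int[of "\<lambda>_. 1" 1] by (simp add: integrable_norm)
  define T where "T y h = (\<integral>x. (G (x - y) \<bullet> h) *\<^sub>R \<phi> x \<partial>lborel)" for y h
  \<comment> \<open>The minus sign compensates the one from differentiating
    \<open>\<eta> (x - y)\<close> in \<open>y\<close>, so that the divergence of
    \<open>\<psi>\<close> is the integral of \<open>G (x - y) \<bullet> \<phi> x\<close> with a
    positive sign. \<open>T y\<close> is the resulting derivative.\<close>
  define \<psi> where "\<psi> y = - (\<integral>x. \<eta> (x - y) *\<^sub>R \<phi> x \<partial>lborel)" for y
  have T_lin: "linear (T y)" for y
  proof (rule linearI)
    show "T y (a + b) = T y a + T y b" for a b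
      unfolding T_def by (simp add: inner_add_right scaleR_add_left Bochner_Integration.integral_add[OF intG intG])
    show "T y (c *\<^sub>R b) = c *\<^sub>R T y b" for c b
      unfolding T_def by (simp flip: scaleR_scaleR)
  qed
  then have T_bl: "bounded_linear (T y)" for y by (simp add: linear_conv_bounded_linear)
  define D where "D y = Blinfun (T y)" for y
  have D: "blinfun_apply (D y) = T y" for y
    unfolding D_def by (rule bounded_linear_Blinfun_apply[OF T_bl])
  have "(\<psi>, D) \<in> test_fields"
    unfolding test_fields_def mem_Collect_eq case_prod_conv
  proof (intro conjI allI)
    fix y
    show "(\<psi> has_derivative blinfun_apply (D y)) (at y)"
      unfolding D
    proof (rule has_derivative_quadratic_remainder[OF T_bl])
      fix h :: 'a
      assume h: "norm h \<le> 1"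
      have "\<psi> (y + h) - \<psi> y - T y h = - (\<integral>x. (\<eta> (x - y + - h) - \<eta> (x - y) - G (x - y) \<bullet> (- h)) *\<^sub>R \<phi> x \<partial>lborel)"
        unfolding \<psi>_def T_def using inteta[of "y + h"] inteta[of y] intG[of y h]
        by (simp add: algebra_simps)
      then have "norm (\<psi> (y + h) - \<psi> y - T y h) \<le> (\<integral>x. norm ((\<eta> (x - y + - h) - \<eta> (x - y) - G (x - y) \<bullet> (- h)) *\<^sub>R \<phi> x) \<partial>lborel)"
        by (simp only: norm_minus_cancel integral_norm_bound)
      also have "\<dots> \<le> (\<integral>x. (L * (norm h)\<^sup>2) * norm (\<phi> x) \<partial>lborel)"
      proof (rule integral_mono)
        show "integrable lborel (\<lambda>x. norm ((\<eta> (x - y + - h) - \<eta> (x - y) - G (x - y) \<bullet> (- h)) *\<^sub>R \<phi> x))"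
          using inteta[of "y + h"] inteta[of y] intG[of y h]
          by (intro integrable_norm) (simp add: algebra_simps)
        show "norm ((\<eta> (x - y + - h) - \<eta> (x - y) - G (x - y) \<bullet> (- h)) *\<^sub>R \<phi> x) \<le> (L * (norm h)\<^sup>2) * norm (\<phi> x)" for x
          unfolding norm_scaleR real_norm_def using taylor[of "-h" "x - y"] h by (intro mult_right_mono) auto
      qed (use intphi in auto)
      also have "\<dots> = (L * (\<integral>x. norm (\<phi> x) \<partial>lborel)) * (norm h)\<^sup>2" by simp
      finally show "norm (\<psi> (y + h) - \<psi> y - T y h) \<le> (L * (\<integral>x. norm (\<phi> x) \<partial>lborel)) * (norm h)\<^sup>2" .
    qed
    show "norm (\<psi> y) \<le> 1"
    proof -
      have "ennreal (norm (\<psi> y)) \<le> (\<integral>\<^sup>+x. ennreal (norm (\<eta> (x - y) *\<^sub>R \<phi> x)) \<partial>lborel)"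
        unfolding \<psi>_def norm_minus_cancel by (rule ennreal_norm_integral_le)
      also have "\<dots> \<le> (\<integral>\<^sup>+x. ennreal (\<eta> (x + - y)) \<partial>lborel)"
        using n nonneg by (intro nn_integral_mono ennreal_leI) (auto intro: mult_left_le)
      also have "\<dots> = 1"
        using nn_integral_lborel_shift[of "\<lambda>x. ennreal (\<eta> x)" "-y"] total by simp
      finally show ?thesis by simp
    qed
  next
    show "bounded {y. \<psi> y \<noteq> 0}"
    proof (rule boundedI)
      fix y assume "y \<in> {y. \<psi> y \<noteq> 0}"
      then have "\<exists>x. \<eta> (x - y) *\<^sub>R \<phi> x \<noteq> 0" unfolding \<psi>_def by (metis (mono_tags, lifting) Bochner_Integration.integral_cong integral_zero mem_Collect_eq neg_equal_0_iff_equal)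
      then obtain x where "\<eta> (x - y) \<noteq> 0" "\<phi> x \<noteq> 0" by auto
      then have "norm (x - y) \<le> \<epsilon>" "norm x \<le> R" using supp(1)[of "x - y"] R[of x] by (force simp: not_le)+
      moreover have "norm y \<le> norm (x - y) + norm x" using norm_triangle_ineq4[of x "x - y"] by simp
      ultimately show "norm y \<le> R + \<epsilon>" by simp
    qed
    show "continuous_on UNIV D"
    proof (rule continuous_on_blinfun_componentwise)
      fix i :: 'a assume "i \<in> Basis"
      have "continuous_on UNIV (\<lambda>y. T y i)"
        unfolding continuous_on_sequentially
      proof (intro allI ballI impI)
        fix X :: "nat \<Rightarrow> 'a" and y assume X: "(\<forall>n. X n \<in> UNIV) \<and> X \<longlonglongrightarrow> y"
        show "((\<lambda>y. T y i) \<circ> X) \<longlonglongrightarrow> T y i"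
          unfolding T_def comp_def
        proof (rule integral_dominated_convergence)
          show "integrable lborel (\<lambda>x. (B * norm i) * norm (\<phi> x))" using intphi by simp
          show "AE x in lborel. (\<lambda>n. (G (x - X n) \<bullet> i) *\<^sub>R \<phi> x) \<longlonglongrightarrow> (G (x - y) \<bullet> i) *\<^sub>R \<phi> x"
          proof (intro AE_I2)
            fix x
            have "(\<lambda>n. G (x - X n)) \<longlonglongrightarrow> G (x - y)"
              using X cont_G by (intro continuous_on_tendsto_compose[OF cont_G] tendsto_intros) auto
            then show "(\<lambda>n. (G (x - X n) \<bullet> i) *\<^sub>R \<phi> x) \<longlonglongrightarrow> (G (x - y) \<bullet> i) *\<^sub>R \<phi> x"
              by (intro tendsto_intros)
          qed
          show "AE x in lborel. norm ((G (x - X n) \<bullet> i) *\<^sub>R \<phi> x) \<le> (B * norm i) * norm (\<phi> x)" for n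
            unfolding norm_scaleR real_norm_def using Gb by (intro AE_I2 mult_right_mono) auto
        qed measurable
      qed
      then show "continuous_on UNIV (\<lambda>y. blinfun_apply (D y) i)" by (simp add: D)
    qed
  qed
  moreover have "divg D y = (\<integral>x. G (x - y) \<bullet> \<phi> x \<partial>lborel)" for y
  proof -
    have "divg D y = (\<Sum>i\<in>Basis. (\<integral>x. (G (x - y) \<bullet> i) * (\<phi> x \<bullet> i) \<partial>lborel))"
      unfolding divg_def D T_def
      by (intro sum.cong refl) (subst integral_inner_left[symmetric], use intG in auto)
    also have "\<dots> = (\<integral>x. (\<Sum>i\<in>Basis. (G (x - y) \<bullet> i) * (\<phi> x \<bullet> i)) \<partial>lborel)"
      using integrable_inner_left[OF intG] by (subst Bochner_Integration.integral_sum) auto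
    finally show ?thesis by (simp add: euclidean_inner[symmetric])
  qed
  ultimately show ?thesis using that by blast
qed

text \<open>Pairing the gradient with its own sign gives its norm, and by duality this pairing is
  the integral over \<open>F\<close> of the divergence of a mollified field. Truncation to
  \<open>cball 0 k\<close> makes the support bounded and is removed by monotone convergence.\<close>

lemma nn_integral_grad_le_Per:
  assumes F[measurable]: "F \<in> sets borel"
  shows "(\<integral>\<^sup>+x. ennreal (norm (grad (indicator F) x)) \<partial>lborel) \<le> Per F"
proof -
  let ?w = "grad (indicator F)"
  have *: "(\<integral>\<^sup>+x. indicator (cball (0::'a) (real k)) x * ennreal (norm (?w x)) \<partial>lborel) \<le> Per F" for k
  proof -
    define \<phi> where "\<phi> x = indicator (cball (0::'a) (real k)) x *\<^sub>R sgn (?w x)" for x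
    have m[measurable]: "\<phi> \<in> borel_measurable borel"
      unfolding \<phi>_def sgn_div_norm by measurable
    have n: "norm (\<phi> x) \<le> 1" for x by (auto simp: \<phi>_def indicator_def norm_sgn)
    have R: "\<phi> x = 0" if "norm x > real k" for x using that by (simp add: \<phi>_def)
    have ip: "?w x \<bullet> \<phi> x = indicator (cball (0::'a) (real k)) x * norm (?w x)" for x
      by (cases "?w x = 0") (auto simp: \<phi>_def sgn_div_norm dot_square_norm power2_eq_square)
    obtain \<psi> D where t: "(\<psi>, D) \<in> test_fields" "\<And>y. divg D y = (\<integral>x. G (x - y) \<bullet> \<phi> x \<partial>lborel)"
      using mollified_test_field[OF m n R] by blast
    have [measurable]: "divg D \<in> borel_measurable borel"
      using test_fields_continuous(3)[OF t(1)] by (rule borel_measurable_continuous_onI)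
    have "(\<integral>\<^sup>+x. indicator (cball (0::'a) (real k)) x * ennreal (norm (?w x)) \<partial>lborel) = (\<integral>\<^sup>+x. ennreal (?w x \<bullet> \<phi> x) \<partial>lborel)"
      by (intro nn_integral_cong) (auto simp: ip indicator_def)
    also have "\<dots> = ennreal (\<integral>x. ?w x \<bullet> \<phi> x \<partial>lborel)"
      by (rule nn_integral_eq_integral[OF integral_grad_inner(2)]) (use n R in \<open>auto simp: ip\<close>)
    also have "\<dots> = ennreal (\<integral>y. indicator F y * divg D y \<partial>lborel)"
      unfolding t(2) using n R by (subst integral_grad_inner(1)) auto
    also have "\<dots> = ennreal (\<integral>y. indicator F y * divg (snd (\<psi>, D)) y \<partial>lebesgue)"
      by (subst integral_completion) auto
    also have "\<dots> \<le> Per F"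
      unfolding Per_def by (rule SUP_upper[OF t(1)])
    finally show ?thesis .
  qed
  have "(\<integral>\<^sup>+x. ennreal (norm (?w x)) \<partial>lborel) = (\<integral>\<^sup>+x. (SUP k. indicator (cball (0::'a) (real k)) x * ennreal (norm (?w x))) \<partial>lborel)"
  proof (rule nn_integral_cong)
    fix x :: 'a
    obtain k where "norm x \<le> real k" using real_arch_simple by blast
    then have "ennreal (norm (?w x)) \<le> indicator (cball (0::'a) (real k)) x * ennreal (norm (?w x))" by simp
    then show "ennreal (norm (?w x)) = (SUP k. indicator (cball (0::'a) (real k)) x * ennreal (norm (?w x)))"
      by (intro antisym SUP_upper2[of k] SUP_least) (auto simp: indicator_def)
  qed
  also have "\<dots> = (SUP k. \<integral>\<^sup>+x. indicator (cball (0::'a) (real k)) x * ennreal (norm (?w x)) \<partial>lborel)"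
    by (rule nn_integral_monotone_convergence_SUP)
      (auto simp: incseq_def le_fun_def indicator_def)
  also have "\<dots> \<le> Per F" using * by (rule SUP_least)
  finally show ?thesis .
qed

text \<open>Up to sign, integration by parts turns the left side into the pairing of the gradient
  with \<open>\<phi>\<close>, which is bounded by the integral of the norm because
  \<open>\<phi>\<close> has norm at most 1. The inner integral is the mollified divergence.\<close>

lemma nn_integral_grad_ge_divg:
  assumes F[measurable]: "F \<in> sets borel" and t: "(\<phi>, D) \<in> test_fields"
  shows "ennreal (\<integral>y. indicator F y * (\<integral>x. \<eta> (x - y) * divg D x \<partial>lborel) \<partial>lborel)
     \<le> (\<integral>\<^sup>+x. ennreal (norm (grad (indicator F) x)) \<partial>lborel)"
proof -
  obtain R where R: "R > 0" "\<And>x. norm x > R \<Longrightarrow> \<phi> x = 0" "\<And>x. norm x > R \<Longrightarrow> divg D x = 0"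
    using test_fields_support[OF t] by metis
  have [measurable]: "\<phi> \<in> borel_measurable borel"
    using test_fields_continuous(1)[OF t] by (rule borel_measurable_continuous_onI)
  note n = test_fieldsD(4)[OF t]
  have "(\<integral>y. indicator F y * (\<integral>x. \<eta> (x - y) * divg D x \<partial>lborel) \<partial>lborel) = - (\<integral>x. grad (indicator F) x \<bullet> \<phi> x \<partial>lborel)"
    unfolding integral_eta_divg[OF t] using integral_grad_inner(1)[of \<phi> F R] n R(2) F by simp
  also have "ennreal \<dots> \<le> ennreal (norm (\<integral>x. grad (indicator F) x \<bullet> \<phi> x \<partial>lborel))"
    by (intro ennreal_leI) simp
  also have "\<dots> \<le> (\<integral>\<^sup>+x. ennreal (norm (grad (indicator F) x \<bullet> \<phi> x)) \<partial>lborel)"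
    by (rule ennreal_norm_integral_le)
  also have "\<dots> \<le> (\<integral>\<^sup>+x. ennreal (norm (grad (indicator F) x)) \<partial>lborel)"
    using n by (intro nn_integral_mono ennreal_leI)
      (metis Cauchy_Schwarz_ineq2 mult_left_le norm_ge_zero order_trans real_norm_def)
  finally show ?thesis .
qed

end

section \<open>Two-sided bounds at small scales\<close>

lemma emeasure_lborel_cball_eq:
  "emeasure lborel (cball (a::'a::euclidean_space) R) = ennreal (measure lborel (cball a R))"
  using emeasure_lborel_cball_finite[of a R] by (intro emeasure_eq_ennreal_measure) auto

section \<open>Construction of the mollifier\<close>

text \<open>The function taking \<open>t\<close> to the square of \<open>max 0 (c - t)\<close> has
  the 2-Lipschitz derivative \<open>- 2 * max 0 (c - t)\<close>; hence the constant 1 in the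
  remainder, also across the kink at \<open>c\<close>.\<close>

lemma truncated_square_taylor:
  fixes a b c :: real
  shows "\<bar>(max 0 (c - b))\<^sup>2 - (max 0 (c - a))\<^sup>2 + 2 * max 0 (c - a) * (b - a)\<bar> \<le> (b - a)\<^sup>2"
proof -
  consider "a \<le> c" "b \<le> c" | "a \<le> c" "b > c" | "a > c" "b \<le> c" | "a > c" "b > c" by linarith
  then show ?thesis
  proof cases
    case 1
    then have "(max 0 (c - b))\<^sup>2 - (max 0 (c - a))\<^sup>2 + 2 * max 0 (c - a) * (b - a) = (b - a)\<^sup>2"
      by (simp add: power2_eq_square algebra_simps)
    then show ?thesis by simp
  next
    case 2
    have "(max 0 (c - b))\<^sup>2 - (max 0 (c - a))\<^sup>2 + 2 * max 0 (c - a) * (b - a) = (b - a)\<^sup>2 - (b - c)\<^sup>2"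
      using 2 by (simp add: power2_eq_square algebra_simps)
    moreover have "(b - c)\<^sup>2 \<le> (b - a)\<^sup>2" using 2 by (intro power_mono) auto
    ultimately show ?thesis by (simp add: abs_if)
  next
    case 3
    then have "(max 0 (c - b))\<^sup>2 - (max 0 (c - a))\<^sup>2 + 2 * max 0 (c - a) * (b - a) = (c - b)\<^sup>2" by simp
    moreover have "(c - b)\<^sup>2 \<le> (a - b)\<^sup>2" using 3 by (intro power_mono) auto
    ultimately show ?thesis by (simp add: power2_commute)
  next
    case 4
    then show ?thesis by simp
  qed
qed

text \<open>The kernel is the normalised square of the positive part of
  \<open>\<epsilon>\<^sup>2 - (norm z)\<^sup>2\<close>, whose gradient is Lipschitz. The pointwise
  bound is for the compactness argument: it scales like the power \<open>- d\<close> of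
  \<open>\<epsilon>\<close>, which matches the volume in \<open>ball_shift\<close>.\<close>

lemma mollifier_exists:
  assumes "\<epsilon> > 0"
  obtains \<eta> :: "'a::euclidean_space \<Rightarrow> real" and G L where "mollifier \<eta> G \<epsilon> L"
    "\<And>z. \<eta> z \<le> 2 / measure lborel (cball (0::'a) (\<epsilon> / 2))"
proof -
  define m where "m = (\<lambda>z::'a. max 0 (\<epsilon>\<^sup>2 - (norm z)\<^sup>2))"
  define p where "p = (\<lambda>z. (m z)\<^sup>2)"
  define V where "V = measure lborel (cball (0::'a) (\<epsilon> / 2))"
  have V: "V > 0" using assms by (simp add: V_def content_cball_pos)
  have m0: "m z = 0" if "norm z \<ge> \<epsilon>" for z
    using that assms by (simp add: m_def power_mono)
  have m_le: "m z \<le> \<epsilon>\<^sup>2" for z by (simp add: m_def)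
  have m_nn: "m z \<ge> 0" for z by (simp add: m_def)
  have cm: "continuous_on UNIV m" unfolding m_def by (intro continuous_intros)
  have cp: "continuous_on UNIV p" unfolding p_def by (intro continuous_intros cm)
  have [measurable]: "p \<in> borel_measurable borel" by (rule borel_measurable_continuous_onI[OF cp])
  have p_le: "p z \<le> (\<epsilon>\<^sup>2)\<^sup>2" for z unfolding p_def using m_le m_nn by (intro power_mono)
  have p0: "p z = 0" if "norm z \<ge> \<epsilon>" for z using m0[OF that] by (simp add: p_def)
  have p_nn: "p z \<ge> 0" for z by (simp add: p_def)
  have intp: "integrable lborel p"
    by (rule integrable_bounded_support[where a=0 and R=\<epsilon> and B="(\<epsilon>\<^sup>2)\<^sup>2"])
      (use p_le p0 p_nn in auto)
  define Z where "Z = (\<integral>z. p z \<partial>lborel)"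
  have Z: "(\<integral>\<^sup>+z. ennreal (p z) \<partial>lborel) = ennreal Z"
    unfolding Z_def by (rule nn_integral_eq_integral[OF intp]) (simp add: p_def)
  \<comment> \<open>On the ball of half the radius \<open>m\<close> is at least
    \<open>3 / 4 * \<epsilon>\<^sup>2\<close>. Thus the maximum of \<open>p\<close> over its minimum
    on that ball is at most \<open>16 / 9\<close>, which explains the 2 in the bound for
    \<open>\<eta>\<close>.\<close>
  have Z_ge: "Z \<ge> (3 / 4 * \<epsilon>\<^sup>2)\<^sup>2 * V"
  proof -
    have "(3 / 4 * \<epsilon>\<^sup>2)\<^sup>2 * V = (\<integral>z. (3 / 4 * \<epsilon>\<^sup>2)\<^sup>2 * indicator (cball (0::'a) (\<epsilon> / 2)) z \<partial>lborel)"
      by (simp add: V_def)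
    also have "\<dots> \<le> Z" unfolding Z_def
    proof (rule integral_mono[OF _ intp])
      show "integrable lborel (\<lambda>z. (3 / 4 * \<epsilon>\<^sup>2)\<^sup>2 * indicator (cball (0::'a) (\<epsilon> / 2)) z)"
        by (intro integrable_mult_right integrable_real_indicator emeasure_lborel_cball_finite) auto
      fix z :: 'a
      show "(3 / 4 * \<epsilon>\<^sup>2)\<^sup>2 * indicator (cball (0::'a) (\<epsilon> / 2)) z \<le> p z"
      proof (cases "norm z \<le> \<epsilon> / 2")
        case True
        then have "(norm z)\<^sup>2 \<le> (\<epsilon> / 2)\<^sup>2" by (intro power_mono) auto
        then have "3 / 4 * \<epsilon>\<^sup>2 \<le> m z" unfolding m_def power_divide by (intro max.coboundedI2) simp
        then show ?thesis using True unfolding p_def by (simp add: power_mono)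
      qed (simp add: p_def)
    qed
    finally show ?thesis .
  qed
  have "0 < (3 / 4 * \<epsilon>\<^sup>2)\<^sup>2 * V" using V assms by simp
  with Z_ge have Zpos: "Z > 0" by linarith
  define \<eta> where "\<eta> = (\<lambda>z. p z / Z)"
  define G where "G = (\<lambda>z::'a. (- 4 * m z / Z) *\<^sub>R z)"
  \<comment> \<open>The first square bounds the change of \<open>(norm z)\<^sup>2\<close> when
    \<open>norm z \<le> \<epsilon> + 1\<close> and \<open>norm h \<le> 1\<close>. The summand
    \<open>2 * \<epsilon>\<^sup>2\<close> bounds the coefficient \<open>2 * m z\<close> of the part
    of that change that is quadratic in \<open>h\<close>.\<close>
  define L where "L = ((2 * \<epsilon> + 3)\<^sup>2 + 2 * \<epsilon>\<^sup>2) / Z"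
  have "mollifier \<eta> G \<epsilon> L"
  proof
    show "continuous_on UNIV \<eta>" "continuous_on UNIV G"
      unfolding \<eta>_def G_def using Zpos by (auto intro!: continuous_intros cp cm)
    show "\<eta> z = 0" "G z = 0" if "norm z \<ge> \<epsilon>" for z
      using m0[OF that] by (auto simp: \<eta>_def p_def G_def)
    show "\<eta> z \<ge> 0" for z using Zpos by (simp add: \<eta>_def p_def)
    have "(\<integral>\<^sup>+z. ennreal (\<eta> z) \<partial>lborel) = (\<integral>\<^sup>+z. ennreal (1 / Z) * ennreal (p z) \<partial>lborel)"
      using Zpos by (intro nn_integral_cong) (auto simp: \<eta>_def simp flip: ennreal_mult')
    also have "\<dots> = ennreal (1 / Z) * ennreal Z" by (simp add: nn_integral_cmult Z)
    finally show "(\<integral>\<^sup>+z. ennreal (\<eta> z) \<partial>lborel) = 1" using Zpos by (simp flip: ennreal_mult)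
    fix z h :: 'a assume h: "norm h \<le> 1"
    have "\<bar>p (z + h) - p z + 4 * m z * (z \<bullet> h)\<bar> \<le> ((2 * \<epsilon> + 3)\<^sup>2 + 2 * \<epsilon>\<^sup>2) * (norm h)\<^sup>2"
    proof (cases "norm z \<le> \<epsilon> + 1")
      case True
      define a b where "a = (norm z)\<^sup>2" and "b = (norm (z + h))\<^sup>2"
      have ba: "b - a = 2 * (z \<bullet> h) + (norm h)\<^sup>2"
        unfolding a_def b_def power2_norm_eq_inner by (simp add: inner_add_left inner_add_right inner_commute)
      have "\<bar>b - a\<bar> \<le> 2 * (norm z * norm h) + norm h * norm h"
        unfolding ba power2_eq_square using Cauchy_Schwarz_ineq2[of z h] zero_le_square[of "norm h"] by linarith
      also have "\<dots> \<le> 2 * ((\<epsilon> + 1) * norm h) + 1 * norm h"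
        using True h by (intro add_mono mult_left_mono mult_right_mono) auto
      also have "\<dots> = (2 * \<epsilon> + 3) * norm h" by (simp add: algebra_simps)
      finally have "\<bar>b - a\<bar>\<^sup>2 \<le> ((2 * \<epsilon> + 3) * norm h)\<^sup>2" by (intro power_mono) auto
      then have sq: "(b - a)\<^sup>2 \<le> (2 * \<epsilon> + 3)\<^sup>2 * (norm h)\<^sup>2" by (simp add: power_mult_distrib)
      \<comment> \<open>The one-variable remainder contains \<open>2 * m z * (b - a)\<close>, which
        is \<open>4 * m z * (z \<bullet> h)\<close> plus a surplus
        \<open>2 * m z * (norm h)\<^sup>2\<close>; the surplus is subtracted again.\<close>
      have "p (z + h) - p z + 4 * m z * (z \<bullet> h) = ((max 0 (\<epsilon>\<^sup>2 - b))\<^sup>2 - (max 0 (\<epsilon>\<^sup>2 - a))\<^sup>2 + 2 * max 0 (\<epsilon>\<^sup>2 - a) * (b - a)) - 2 * m z * (norm h)\<^sup>2"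
        unfolding ba p_def m_def a_def[symmetric] b_def[symmetric] by (simp add: algebra_simps)
      moreover have "\<bar>2 * m z * (norm h)\<^sup>2\<bar> \<le> 2 * \<epsilon>\<^sup>2 * (norm h)\<^sup>2"
        using m_le[of z] m_nn[of z] by (simp add: abs_mult mult_right_mono)
      ultimately have "\<bar>p (z + h) - p z + 4 * m z * (z \<bullet> h)\<bar> \<le> (2 * \<epsilon> + 3)\<^sup>2 * (norm h)\<^sup>2 + 2 * \<epsilon>\<^sup>2 * (norm h)\<^sup>2"
        using truncated_square_taylor[of "\<epsilon>\<^sup>2" b a] sq by linarith
      then show ?thesis by (simp add: algebra_simps)
    next
      case False
      have "norm z \<le> norm (z + h) + norm h" by (metis add_diff_cancel norm_triangle_ineq4)
      then have "norm (z + h) \<ge> \<epsilon>" "norm z \<ge> \<epsilon>" using False h by linarith+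
      then show ?thesis by (simp add: p_def m0)
    qed
    then have "\<bar>p (z + h) - p z + 4 * m z * (z \<bullet> h)\<bar> / Z \<le> L * (norm h)\<^sup>2"
      using Zpos by (simp add: L_def divide_right_mono)
    moreover have "\<eta> (z + h) - \<eta> z - G z \<bullet> h = (p (z + h) - p z + 4 * m z * (z \<bullet> h)) / Z"
      by (simp add: \<eta>_def G_def diff_divide_distrib add_divide_distrib)
    ultimately show "\<bar>\<eta> (z + h) - \<eta> z - G z \<bullet> h\<bar> \<le> L * (norm h)\<^sup>2"
      using Zpos by (simp add: abs_divide)
  qed (rule assms)
  moreover have "\<eta> z \<le> 2 / V" for z
  proof -
    have "p z * V \<le> (\<epsilon>\<^sup>2)\<^sup>2 * V" using p_le V by (intro mult_right_mono) auto
    also have "\<dots> \<le> 2 * ((3 / 4 * \<epsilon>\<^sup>2)\<^sup>2 * V)" using V by (simp add: power_mult_distrib power_divide)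
    also have "\<dots> \<le> 2 * Z" using Z_ge by simp
    finally show ?thesis using V Zpos by (simp add: \<eta>_def field_simps)
  qed
  ultimately show ?thesis using that unfolding V_def by blast
qed

section \<open>Bounds for translation differences integrated over a ball\<close>

text \<open>Regularity of the measure gives a compact \<open>K\<close> inside \<open>F\<close> and
  an open \<open>T\<close> around it with \<open>T - K\<close> small. For short \<open>h\<close> the
  points of \<open>K\<close> stay in \<open>T\<close>, so the indicator can only change when
  \<open>x\<close> or \<open>x + h\<close> lies in \<open>T - K\<close>.\<close>

lemma L1_shift_indicator_small:
  fixes F :: "'a::euclidean_space set"
  assumes [measurable]: "F \<in> sets borel" and fin: "emeasure lborel F < \<infinity>" and "e > 0"
  obtains \<delta> where "\<delta> > 0" "\<And>h. norm h \<le> \<delta> \<Longrightarrow> L1_shift (indicator F) h \<le> ennreal e"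
proof -
  \<comment> \<open>\<open>T - K\<close> is covered by three pieces of measure at most
    \<open>e / 6\<close>, and it is counted twice, once for \<open>x\<close> and once for
    \<open>x + h\<close>.\<close>
  have e6: "e / 6 > 0" and FL: "F \<in> sets lebesgue" using assms by auto
  obtain T where T: "open T" "F \<subseteq> T" "emeasure lebesgue (T - F) < ennreal (e / 6)"
    using sets_lebesgue_outer_open[OF FL e6] by metis
  obtain C where C: "closed C" "C \<subseteq> F" "emeasure lebesgue (F - C) < ennreal (e / 6)"
    using sets_lebesgue_inner_closed[OF FL e6] by metis
  have [measurable]: "T \<in> sets borel" "C \<in> sets borel" using T C by auto
  have "(\<lambda>k. emeasure lborel (F - cball 0 (real k))) \<longlonglongrightarrow> emeasure lborel (\<Inter>k. F - cball 0 (real k))"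
  proof (rule Lim_emeasure_decseq)
    show "decseq (\<lambda>k. F - cball 0 (real k))" by (auto simp: decseq_def)
    show "emeasure lborel (F - cball 0 (real k)) \<noteq> \<infinity>" for k
      using fin emeasure_mono[of "F - cball 0 (real k)" F lborel] by (auto simp: top_unique)
  qed auto
  also have "(\<Inter>k. F - cball 0 (real k)) = {}"
    using real_arch_simple by auto
  finally have "(\<lambda>k. emeasure lborel (F - cball 0 (real k))) \<longlonglongrightarrow> 0" by simp
  then have "eventually (\<lambda>k. emeasure lborel (F - cball 0 (real k)) < ennreal (e / 6)) sequentially"
    using \<open>e > 0\<close> by (intro order_tendstoD) auto
  then obtain k :: nat where k: "emeasure lborel (F - cball 0 (real k)) < ennreal (e / 6)"
    by (auto simp: eventually_sequentially)
  define K where "K = C \<inter> cball 0 (real k)"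
  have "compact K" unfolding K_def using C by (intro closed_Int_compact) auto
  have KF: "K \<subseteq> F" "K \<subseteq> T" using C T by (auto simp: K_def)
  have [measurable]: "K \<in> sets borel" by (simp add: K_def)
  obtain \<delta> where \<delta>: "\<delta> > 0" "(\<Union>x\<in>K. ball x \<delta>) \<subseteq> T"
    using compact_subset_open_imp_ball_epsilon_subset[OF \<open>compact K\<close> T(1) KF(2)] by blast
  have TK: "emeasure lborel (T - K) \<le> ennreal (e / 2)"
  proof -
    have "emeasure lborel (T - K) \<le> emeasure lborel ((T - F) \<union> ((F - C) \<union> (F - cball 0 (real k))))"
      by (intro emeasure_mono) (auto simp: K_def)
    also have "\<dots> \<le> emeasure lborel (T - F) + emeasure lborel ((F - C) \<union> (F - cball 0 (real k)))"
      by (intro emeasure_subadditive) auto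
    also have "\<dots> \<le> emeasure lborel (T - F) + (emeasure lborel (F - C) + emeasure lborel (F - cball 0 (real k)))"
      by (intro add_mono emeasure_subadditive) auto
    also have "\<dots> \<le> ennreal (e / 6) + (ennreal (e / 6) + ennreal (e / 6))"
      using T(3) C(3) k by (intro add_mono) auto
    also have "\<dots> = ennreal (e / 2)" using \<open>e > 0\<close> by (simp flip: ennreal_plus)
    finally show ?thesis .
  qed
  show ?thesis
  proof (rule that[of "\<delta> / 2"])
    fix h :: 'a assume h: "norm h \<le> \<delta> / 2"
    have K1: "x \<in> T" if "x + h \<in> K" for x
    proof -
      have "dist (x + h) x < \<delta>" using h \<delta>(1) by (simp add: dist_norm)
      then show ?thesis using \<delta>(2) that by force
    qed
    have K2: "x + h \<in> T" if "x \<in> K" for x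
    proof -
      have "dist x (x + h) < \<delta>" using h \<delta>(1) by (simp add: dist_norm)
      then show ?thesis using \<delta>(2) that by force
    qed
    have "L1_shift (indicator F) h \<le> (\<integral>\<^sup>+x. indicator (T - K) x + indicator (T - K) (x + h) \<partial>lborel)"
      unfolding L1_shift_def
    proof (rule nn_integral_mono)
      fix x
      show "ennreal \<bar>indicator F (x + h) - indicator F x\<bar> \<le> indicator (T - K) x + indicator (T - K) (x + h)"
        using K1[of x] K2[of x] KF T(2) by (auto simp: indicator_def)
    qed
    also have "\<dots> = (\<integral>\<^sup>+x. indicator (T - K) x \<partial>lborel) + (\<integral>\<^sup>+x. indicator (T - K) (x + h) \<partial>lborel)"
      by (rule nn_integral_add) measurable
    also have "(\<integral>\<^sup>+x. indicator (T - K) (x + h) \<partial>lborel) = (\<integral>\<^sup>+x. indicator (T - K) x \<partial>lborel)"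
      by (rule nn_integral_lborel_shift) measurable
    also have "(\<integral>\<^sup>+x. indicator (T - K) x \<partial>lborel) + (\<integral>\<^sup>+x. indicator (T - K) x \<partial>lborel) \<le> ennreal (e / 2) + ennreal (e / 2)"
      using TK by (intro add_mono) auto
    also have "\<dots> = ennreal e" using \<open>e > 0\<close> by (simp flip: ennreal_plus)
    finally show "L1_shift (indicator F) h \<le> ennreal e" .
  qed (use \<delta> in auto)
qed

lemma nn_integral_abs_indicator:
  "F \<in> sets borel \<Longrightarrow> (\<integral>\<^sup>+x. ennreal \<bar>indicator F x\<bar> \<partial>lborel) = emeasure lborel F"
proof -
  assume "F \<in> sets borel"
  have "(\<integral>\<^sup>+x. ennreal \<bar>indicator F x\<bar> \<partial>lborel) = (\<integral>\<^sup>+x. indicator F x \<partial>lborel)"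
    by (intro nn_integral_cong) (auto simp: indicator_def)
  then show ?thesis using \<open>F \<in> sets borel\<close> by simp
qed

lemma L1_shift_le_approx:
  assumes [measurable]: "f \<in> borel_measurable borel" "u \<in> borel_measurable borel"
  shows "L1_shift f h \<le> L1_shift u h + 2 * (\<integral>\<^sup>+x. ennreal \<bar>u x - f x\<bar> \<partial>lborel)"
proof -
  have "L1_shift f h \<le> (\<integral>\<^sup>+x. ennreal \<bar>u (x + h) - u x\<bar> + (ennreal \<bar>u (x + h) - f (x + h)\<bar> + ennreal \<bar>u x - f x\<bar>) \<partial>lborel)"
    unfolding L1_shift_def by (intro nn_integral_mono) (auto simp flip: ennreal_plus)
  also have "\<dots> = L1_shift u h + ((\<integral>\<^sup>+x. ennreal \<bar>u (x + h) - f (x + h)\<bar> \<partial>lborel) + (\<integral>\<^sup>+x. ennreal \<bar>u x - f x\<bar> \<partial>lborel))"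
    unfolding L1_shift_def by (simp add: nn_integral_add)
  also have "(\<integral>\<^sup>+x. ennreal \<bar>u (x + h) - f (x + h)\<bar> \<partial>lborel) = (\<integral>\<^sup>+x. ennreal \<bar>u x - f x\<bar> \<partial>lborel)"
    by (rule nn_integral_lborel_shift[where f="\<lambda>x. ennreal \<bar>u x - f x\<bar>"]) measurable
  finally show ?thesis by (simp add: mult_2)
qed

text \<open>The mollification satisfies the bound exactly, since its translation differences have no
  Taylor error left. Replacing \<open>F\<close> by its mollification costs an error uniform in
  \<open>h\<close>, hence a small one after integration over the ball.\<close>

lemma ball_shift_le_Per:
  fixes F :: "'a::euclidean_space set"
  assumes F[measurable]: "F \<in> sets borel" and fin: "emeasure lborel F < \<infinity>" and \<tau>: "\<tau> > 0"
  shows "ball_shift F \<tau> \<le> ennreal (2 * unit_ball_vol (real (DIM('a) - 1)) / (real DIM('a) + 1) * \<tau> ^ (DIM('a) + 1)) * Per F"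
    (is "_ \<le> ?c * _")
proof (rule ennreal_le_epsilon)
  fix e :: real assume "e > 0"
  define V where "V = measure lborel (cball (0::'a) \<tau>)"
  have V: "V > 0" "emeasure lborel (cball (0::'a) \<tau>) = ennreal V"
    using \<tau> by (auto simp: V_def content_cball_pos emeasure_lborel_cball_eq)
  \<comment> \<open>The approximation error enters twice in each translation difference and is then
    integrated over a ball of volume \<open>V\<close>.\<close>
  define e' where "e' = e / (2 * V)"
  have e': "e' > 0" using \<open>e > 0\<close> V by (simp add: e'_def)
  obtain \<delta> where \<delta>: "\<delta> > 0" "\<And>h. norm h \<le> \<delta> \<Longrightarrow> L1_shift (indicator F) h \<le> ennreal e'"
    using L1_shift_indicator_small[OF F fin e'] by metis
  obtain \<eta> :: "'a \<Rightarrow> real" and G L where "mollifier \<eta> G \<delta> L"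
    using mollifier_exists[OF \<delta>(1)] by metis
  then interpret mollifier \<eta> G \<delta> L .
  let ?u = "conv (indicator F) \<eta>"
  have fin': "(\<integral>\<^sup>+x. ennreal \<bar>indicator F x\<bar> \<partial>lborel) < \<infinity>"
    unfolding nn_integral_abs_indicator[OF F] by (rule fin)
  have d: "(\<integral>\<^sup>+x. ennreal \<bar>?u x - indicator F x\<bar> \<partial>lborel) \<le> ennreal e'"
  proof -
    have "(\<integral>\<^sup>+x. ennreal \<bar>?u x - indicator F x\<bar> \<partial>lborel) \<le> (\<integral>\<^sup>+z. ennreal (\<eta> z) * L1_shift (indicator F) (- z) \<partial>lborel)"
      by (rule nn_integral_conv_diff_le[where C=1]) (auto simp: indicator_def)
    also have "\<dots> \<le> (\<integral>\<^sup>+z. ennreal (\<eta> z) * ennreal e' \<partial>lborel)"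
    proof (rule nn_integral_mono)
      fix z
      show "ennreal (\<eta> z) * L1_shift (indicator F) (- z) \<le> ennreal (\<eta> z) * ennreal e'"
        using \<delta>(2)[of "-z"] supp(1)[of z] by (cases "norm z \<le> \<delta>") (auto intro: mult_left_mono)
    qed
    also have "\<dots> = ennreal e'" by (simp add: nn_integral_multc total)
    finally show ?thesis .
  qed
  have "ball_shift F \<tau> \<le> (\<integral>\<^sup>+h. indicator (cball 0 \<tau>) h * (\<integral>\<^sup>+x. ennreal \<bar>grad (indicator F) x \<bullet> h\<bar> \<partial>lborel) + ennreal (2 * e') * indicator (cball 0 \<tau>) h \<partial>lborel)"
    unfolding ball_shift_def
  proof (rule nn_integral_mono)
    fix h :: 'a
    have "L1_shift (indicator F) h \<le> L1_shift ?u h + 2 * (\<integral>\<^sup>+x. ennreal \<bar>?u x - indicator F x\<bar> \<partial>lborel)"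
      by (rule L1_shift_le_approx) measurable
    also have "\<dots> \<le> (\<integral>\<^sup>+x. ennreal \<bar>grad (indicator F) x \<bullet> h\<bar> \<partial>lborel) + 2 * ennreal e'"
      by (intro add_mono mult_left_mono d L1_shift_conv_le_grad[OF _ _ fin', where C=1])
        (auto simp: indicator_def)
    also have "2 * ennreal e' = ennreal (2 * e')" using e' by (simp add: ennreal_mult)
    finally show "indicator (cball 0 \<tau>) h * L1_shift (indicator F) h \<le> indicator (cball 0 \<tau>) h * (\<integral>\<^sup>+x. ennreal \<bar>grad (indicator F) x \<bullet> h\<bar> \<partial>lborel) + ennreal (2 * e') * indicator (cball 0 \<tau>) h"
      by (cases "h \<in> cball 0 \<tau>") auto
  qed
  also have "\<dots> = (\<integral>\<^sup>+h. indicator (cball 0 \<tau>) h * (\<integral>\<^sup>+x. ennreal \<bar>grad (indicator F) x \<bullet> h\<bar> \<partial>lborel) \<partial>lborel) + (\<integral>\<^sup>+h. ennreal (2 * e') * indicator (cball (0::'a) \<tau>) h \<partial>lborel)"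
    by (rule nn_integral_add) measurable
  also have "\<dots> = ?c * (\<integral>\<^sup>+x. ennreal (norm (grad (indicator F) x)) \<partial>lborel) + ennreal (2 * e') * ennreal V"
    by (simp only: nn_integral_cball_grad[OF _ \<tau>] borel_measurable_indicator[OF F] V(2)[symmetric])
      (subst nn_integral_cmult_indicator, auto)
  also have "\<dots> \<le> ?c * Per F + ennreal e"
    using e' V by (intro add_mono mult_left_mono nn_integral_grad_le_Per F) (auto simp: e'_def simp flip: ennreal_mult)
  finally show "ball_shift F \<tau> \<le> ?c * Per F + ennreal e" .
qed

text \<open>Intended for radii above 1, where it leaves the integrand
  \<open>\<tau> powr (- s - 1)\<close>, whose integral is bounded for \<open>s > 1\<close>.\<close>

lemma ball_shift_le_emeasure:
  fixes F :: "'a::euclidean_space set"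
  assumes [measurable]: "F \<in> sets borel" and \<tau>: "\<tau> \<ge> 0"
  shows "ball_shift F \<tau> \<le> 2 * emeasure lborel F * ennreal (unit_ball_vol (real DIM('a)) * \<tau> ^ DIM('a))"
proof -
  have "ball_shift F \<tau> \<le> (\<integral>\<^sup>+h. (2 * emeasure lborel F) * indicator (cball (0::'a) \<tau>) h \<partial>lborel)"
    unfolding ball_shift_def using L1_shift_indicator_le[of F] by (intro nn_integral_mono) (auto simp: indicator_def)
  also have "\<dots> = (2 * emeasure lborel F) * emeasure lborel (cball (0::'a) \<tau>)"
    by (rule nn_integral_cmult_indicator) simp
  finally show ?thesis using \<tau> by (simp add: emeasure_cball)
qed

text \<open>The single-step Taylor estimate is integrated over the ball: the gradient term produces
  the exact constant, the error \<open>\<tau>\<^sup>2\<close> times the volume of the ball. The set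
  enters the error only through its measure, so the bound is uniform along a convergent
  sequence.\<close>

lemma (in mollifier) ball_shift_ge_divg:
  fixes F :: "'a set"
  assumes F[measurable]: "F \<in> sets borel" and fin: "emeasure lborel F < \<infinity>" and \<tau>: "0 < \<tau>" "\<tau> \<le> 1"
    and t: "(\<phi>, D) \<in> test_fields"
  shows "ennreal (2 * unit_ball_vol (real (DIM('a) - 1)) / (real DIM('a) + 1) * \<tau> ^ (DIM('a) + 1)
       * (\<integral>y. indicator F y * (\<integral>x. \<eta> (x - y) * divg D x \<partial>lborel) \<partial>lborel)
     - measure lborel F * taylor_const * unit_ball_vol (real DIM('a)) * \<tau> ^ (DIM('a) + 2)) \<le> ball_shift F \<tau>"
    (is "ennreal (?c * ?A - ?K) \<le> _")
proof -
  define N where "N = measure lborel F"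
  have N: "emeasure lborel F = ennreal N" "N \<ge> 0" using fin by (auto simp: N_def emeasure_eq_ennreal_measure)
  have c: "?c \<ge> 0" using \<tau> by simp
  have "ennreal (?c * ?A) \<le> ennreal ?c * ennreal ?A"
    using c by (simp add: ennreal_mult'[symmetric])
  also have "\<dots> \<le> ennreal ?c * (\<integral>\<^sup>+x. ennreal (norm (grad (indicator F) x)) \<partial>lborel)"
    by (intro mult_left_mono nn_integral_grad_ge_divg[OF F t]) simp
  also have "\<dots> = (\<integral>\<^sup>+h. indicator (cball 0 \<tau>) h * (\<integral>\<^sup>+x. ennreal \<bar>grad (indicator F) x \<bullet> h\<bar> \<partial>lborel) \<partial>lborel)"
    using \<tau> by (subst nn_integral_cball_grad) auto
  also have "\<dots> \<le> (\<integral>\<^sup>+h. indicator (cball 0 \<tau>) h * L1_shift (indicator F) h + ennreal (N * taylor_const * \<tau>\<^sup>2) * indicator (cball 0 \<tau>) h \<partial>lborel)"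
  proof (rule nn_integral_mono)
    fix h :: 'a
    show "indicator (cball 0 \<tau>) h * (\<integral>\<^sup>+x. ennreal \<bar>grad (indicator F) x \<bullet> h\<bar> \<partial>lborel) \<le> indicator (cball 0 \<tau>) h * L1_shift (indicator F) h + ennreal (N * taylor_const * \<tau>\<^sup>2) * indicator (cball 0 \<tau>) h"
    proof (cases "h \<in> cball 0 \<tau>")
      case True
      have "(\<integral>\<^sup>+x. ennreal \<bar>grad (indicator F) x \<bullet> h\<bar> \<partial>lborel)
        \<le> L1_shift (indicator F) h + (\<integral>\<^sup>+x. ennreal \<bar>indicator F x\<bar> \<partial>lborel) * ennreal (taylor_const * (norm h)\<^sup>2)"
        using True \<tau> by (intro nn_integral_grad_inner_le[where C=1]) (auto simp: indicator_def)
      also have "(\<integral>\<^sup>+x. ennreal \<bar>indicator F x\<bar> \<partial>lborel) * ennreal (taylor_const * (norm h)\<^sup>2) = ennreal (N * taylor_const * (norm h)\<^sup>2)"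
        unfolding nn_integral_abs_indicator[OF F] using N taylor_const_nonneg by (simp add: mult.assoc flip: ennreal_mult)
      also have "ennreal (N * taylor_const * (norm h)\<^sup>2) \<le> ennreal (N * taylor_const * \<tau>\<^sup>2)"
        using True N taylor_const_nonneg by (intro ennreal_leI mult_left_mono power_mono) auto
      finally show ?thesis using True by (simp add: add_left_mono)
    qed simp
  qed
  also have "\<dots> = ball_shift F \<tau> + (\<integral>\<^sup>+h. ennreal (N * taylor_const * \<tau>\<^sup>2) * indicator (cball (0::'a) \<tau>) h \<partial>lborel)"
    unfolding ball_shift_def by (rule nn_integral_add) measurable
  also have "(\<integral>\<^sup>+h. ennreal (N * taylor_const * \<tau>\<^sup>2) * indicator (cball (0::'a) \<tau>) h \<partial>lborel) = ennreal (N * taylor_const * \<tau>\<^sup>2) * emeasure lborel (cball (0::'a) \<tau>)"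
    by (rule nn_integral_cmult_indicator) simp
  also have "\<dots> = ennreal ?K"
    using \<tau> N taylor_const_nonneg
    by (simp add: emeasure_cball N_def power2_eq_square mult_ac flip: ennreal_mult)
  finally have "ennreal (?c * ?A) \<le> ball_shift F \<tau> + ennreal ?K" .
  moreover have "?K \<ge> 0" using \<tau> taylor_const_nonneg by simp
  ultimately show ?thesis
    by (simp add: ennreal_minus[symmetric] ennreal_minus_le_iff add.commute)
qed

section \<open>Energy bounds\<close>

lemma beta_radial:
  "(real d + s) / (real d + 1) * ((r powr (1 - s) - 1) / (s - 1)) = beta d r s - 1 / (real d + 1)"
  by (simp add: beta_def)

text \<open>From \<open>exp x \<ge> 1 + x\<close> with \<open>x = (1 - s) * ln r\<close>. The bound
  does not involve \<open>s\<close>, so \<open>\<beta>\<close> diverges as soon as \<open>r\<close>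
  tends to 0.\<close>

lemma beta_ge:
  assumes "0 < r" "r < 1" "1 < s"
  shows "beta d r s \<ge> - ln r" "(r powr (1 - s) - 1) / (s - 1) \<ge> - ln r"
proof -
  have "r powr (1 - s) = exp ((1 - s) * ln r)" using assms by (simp add: powr_def)
  also have "\<dots> \<ge> 1 + (1 - s) * ln r" by (rule exp_ge_add_one_self)
  finally have "(s - 1) * (- ln r) \<le> r powr (1 - s) - 1" by (simp add: algebra_simps)
  then show 1: "(r powr (1 - s) - 1) / (s - 1) \<ge> - ln r" using assms by (simp add: field_simps)
  have "- ln r > 0" using assms by simp
  then have "0 \<le> (r powr (1 - s) - 1) / (s - 1)" using 1 by linarith
  then have "1 * ((r powr (1 - s) - 1) / (s - 1)) \<le> (real d + s) / (real d + 1) * ((r powr (1 - s) - 1) / (s - 1))"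
    using assms by (intro mult_right_mono) auto
  then have "(r powr (1 - s) - 1) / (s - 1) \<le> beta d r s"
    unfolding beta_def using divide_nonneg_nonneg[of 1 "real d + 1"] by linarith
  with 1 show "beta d r s \<ge> - ln r" by linarith
qed

lemma beta_pos: "0 < r \<Longrightarrow> r < 1 \<Longrightarrow> 1 < s \<Longrightarrow> beta d r s > 0"
  using beta_ge(1)[of r s d] ln_less_zero[of r] by linarith

lemma beta_at_top:
  assumes "\<forall>n. 0 < r n \<and> r n < 1" "\<forall>n. 1 < s n" "r \<longlonglongrightarrow> 0"
  shows "filterlim (\<lambda>n. beta d (r n) (s n)) at_top sequentially"
proof (rule filterlim_at_top_mono)
  have "filterlim r (at_right 0) sequentially"
    unfolding filterlim_at using assms
    by (intro conjI always_eventually allI) (auto simp: less_imp_neq[THEN not_sym])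
  from filterlim_compose[OF ln_at_0 this] show "filterlim (\<lambda>n. - ln (r n)) at_top sequentially"
    by (simp add: filterlim_uminus_at_bot)
  show "\<forall>\<^sub>F n in sequentially. - ln (r n) \<le> beta d (r n) (s n)"
    using assms beta_ge(1) by (intro always_eventually) blast
qed

text \<open>Here \<open>k\<close> is the order beyond \<open>d\<close> of a bound for
  \<open>ball_shift\<close>: 0 for the measure bound, 1 for the perimeter term, 2 for the Taylor
  error.\<close>

lemma powr_split:
  fixes \<tau> :: real
  assumes "\<tau> > 0"
  shows "\<tau> powr (- real d - s - 1) * \<tau> ^ (d + k) = \<tau> powr (real k - 1 - s)"
proof -
  have "\<tau> powr (- real d - s - 1) * \<tau> ^ (d + k) = \<tau> powr (- real d - s - 1) * \<tau> powr real (d + k)"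
    by (simp only: powr_realpow[OF assms])
  also have "\<dots> = \<tau> powr (- real d - s - 1 + real (d + k))" by (rule powr_add[symmetric])
  finally show ?thesis by (simp add: algebra_simps)
qed

lemma ennreal_integral_le_nn_integral:
  assumes "integrable M f"
  shows "ennreal (\<integral>x. f x \<partial>M) \<le> (\<integral>\<^sup>+x. ennreal (f x) \<partial>M)"
proof -
  have i: "integrable M (\<lambda>x. max 0 (f x))" using assms by simp
  have "ennreal (\<integral>x. f x \<partial>M) \<le> ennreal (\<integral>x. max 0 (f x) \<partial>M)"
    using assms i by (intro ennreal_leI integral_mono) auto
  also have "\<dots> = (\<integral>\<^sup>+x. ennreal (max 0 (f x)) \<partial>M)"
    by (rule nn_integral_eq_integral[OF i, symmetric]) auto
  also have "\<dots> = (\<integral>\<^sup>+x. ennreal (f x) \<partial>M)"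
    by (intro nn_integral_cong) (auto simp: max_def ennreal_neg)
  finally show ?thesis .
qed

text \<open>The bound is inserted into the layer-cake formula on \<open>[r,1]\<close>. The term of
  order \<open>d + 1\<close> reproduces \<open>\<beta>\<close> without its summand
  \<open>1 / (d + 1)\<close>; the error gives the integral of \<open>\<tau> powr (1 - s)\<close>, at
  most \<open>1 / (2 - s)\<close>. The 2 in the last denominator comes from
  \<open>2 * Jt\<close>.\<close>

lemma Jt_ge:
  fixes F :: "'a::euclidean_space set"
  assumes [measurable]: "F \<in> sets borel" and r: "0 < r" "r < 1" and s: "1 < s" "s < 2"
    and lb: "\<And>\<tau>. 0 < \<tau> \<Longrightarrow> \<tau> \<le> 1 \<Longrightarrow> ennreal (2 * w / (real DIM('a) + 1) * \<tau> ^ (DIM('a) + 1) * A - K * \<tau> ^ (DIM('a) + 2)) \<le> ball_shift F \<tau>"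
    and K: "K \<ge> 0"
  shows "ennreal (w * A * (beta DIM('a) r s - 1 / (real DIM('a) + 1)) - K * ((real DIM('a) + s) / (2 * (2 - s)))) \<le> Jt r s F"
proof -
  let ?d = "DIM('a)"
  define a where "a \<tau> = (real ?d + s) * \<tau> powr (- real ?d - s - 1)" for \<tau>
  define f where "f \<tau> = (real ?d + s) * (2 * w / (real ?d + 1) * A * \<tau> powr (- s) - K * \<tau> powr (1 - s))" for \<tau>
  define P where "P \<tau> = (real ?d + s) * (2 * w / (real ?d + 1) * A * (\<tau> powr (1 - s) / (1 - s)) - K * (\<tau> powr (2 - s) / (2 - s)))" for \<tau>
  have hb: "has_bochner_integral lborel (\<lambda>\<tau>. f \<tau> * indicator {r..1} \<tau>) (P 1 - P r)"
  proof (rule has_bochner_integral_FTC_Icc_real)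
    show "r \<le> 1" using r by simp
    show "(P has_real_derivative f x) (at x)" if "r \<le> x" "x \<le> 1" for x
      unfolding P_def f_def using that r s
      by (auto intro!: derivative_eq_intros)
    show "isCont f x" if "r \<le> x" "x \<le> 1" for x
      unfolding f_def using that r by (intro continuous_intros) auto
  qed
  have "P 1 - P r = (real ?d + s) * (2 * w / (real ?d + 1) * A * ((r powr (1 - s) - 1) / (s - 1)) - K * ((1 - r powr (2 - s)) / (2 - s)))"
  proof -
    have "(r powr (1 - s) - 1) / (s - 1) = 1 / (1 - s) - r powr (1 - s) / (1 - s)"
      using s by (simp add: field_simps)
    moreover have "k * (c * a - K * b) - k * (c * x - K * y) = k * (c * (a - x) - K * (b - y))" for k c a b x y :: real
      by (simp add: algebra_simps)
    ultimately show ?thesis unfolding P_def diff_divide_distrib[of 1 "r powr (2 - s)"]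
      by (simp only: powr_one_eq_one)
  qed
  also have "\<dots> = 2 * (w * A * ((real ?d + s) / (real ?d + 1) * ((r powr (1 - s) - 1) / (s - 1)))) - K * ((real ?d + s) * (1 - r powr (2 - s)) / (2 - s))"
    by (simp add: algebra_simps)
  \<comment> \<open>Discarding the nonnegative \<open>r powr (2 - s)\<close> makes the error
    independent of \<open>r\<close>.\<close>
  also have "\<dots> \<ge> 2 * (w * A * ((real ?d + s) / (real ?d + 1) * ((r powr (1 - s) - 1) / (s - 1)))) - K * ((real ?d + s) * 1 / (2 - s))"
    using K s by (intro diff_left_mono mult_left_mono divide_right_mono) auto
  finally have "P 1 - P r \<ge> 2 * (w * A * (beta ?d r s - 1 / (real ?d + 1))) - K * ((real ?d + s) * 1 / (2 - s))"
    unfolding beta_radial .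
  moreover have "K * ((real ?d + s) * 1 / (2 - s)) = 2 * (K * ((real ?d + s) / (2 * (2 - s))))"
    using s by (simp add: field_simps)
  ultimately have P: "P 1 - P r \<ge> 2 * (w * A * (beta ?d r s - 1 / (real ?d + 1)) - K * ((real ?d + s) / (2 * (2 - s))))"
    by (simp only: right_diff_distrib[of 2])
  have "2 * ennreal (w * A * (beta ?d r s - 1 / (real ?d + 1)) - K * ((real ?d + s) / (2 * (2 - s)))) = ennreal (2 * (w * A * (beta ?d r s - 1 / (real ?d + 1)) - K * ((real ?d + s) / (2 * (2 - s)))))"
    by (subst ennreal_mult') auto
  also have "\<dots> \<le> ennreal (P 1 - P r)" using P by (rule ennreal_leI)
  also have "\<dots> = ennreal (\<integral>\<tau>. f \<tau> * indicator {r..1} \<tau> \<partial>lborel)"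
    using has_bochner_integral_integral_eq[OF hb] by simp
  also have "\<dots> \<le> (\<integral>\<^sup>+\<tau>. ennreal (f \<tau> * indicator {r..1} \<tau>) \<partial>lborel)"
    using hb by (intro ennreal_integral_le_nn_integral) (simp add: has_bochner_integral_iff)
  also have "\<dots> \<le> (\<integral>\<^sup>+\<tau>. indicator {r..} \<tau> * ennreal (a \<tau>) * ball_shift F \<tau> \<partial>lborel)"
  proof (rule nn_integral_mono)
    fix \<tau> :: real
    show "ennreal (f \<tau> * indicator {r..1} \<tau>) \<le> indicator {r..} \<tau> * ennreal (a \<tau>) * ball_shift F \<tau>"
    proof (cases "\<tau> \<in> {r..1}")
      case True
      then have \<tau>: "\<tau> > 0" using r by auto
      have "f \<tau> = a \<tau> * (2 * w / (real ?d + 1) * \<tau> ^ (?d + 1) * A - K * \<tau> ^ (?d + 2))"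
      proof -
        have "\<tau> powr (- s) = \<tau> powr (- real ?d - s - 1) * \<tau> ^ (?d + 1)"
          "\<tau> powr (1 - s) = \<tau> powr (- real ?d - s - 1) * \<tau> ^ (?d + 2)"
          unfolding powr_split[OF \<tau>] by simp_all
        moreover have "k * (c * A * (u * x) - K * (u * y)) = k * u * (c * x * A - K * y)" for k c u x y :: real
          by (simp add: algebra_simps)
        ultimately show ?thesis unfolding f_def a_def by (simp only:)
      qed
      moreover have "a \<tau> \<ge> 0" using s by (simp add: a_def)
      ultimately have "ennreal (f \<tau>) = ennreal (a \<tau>) * ennreal (2 * w / (real ?d + 1) * \<tau> ^ (?d + 1) * A - K * \<tau> ^ (?d + 2))"
        by (simp add: ennreal_mult')
      also have "\<dots> \<le> ennreal (a \<tau>) * ball_shift F \<tau>"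
        using True \<tau> by (intro mult_left_mono lb) auto
      finally show ?thesis using True by simp
    qed simp
  qed
  also have "\<dots> = 2 * Jt r s F"
    using r s unfolding a_def by (intro Jt_layer_cake[symmetric]) auto
  finally show ?thesis
    by (subst (asm) ennreal_mult_le_mult_iff) auto
qed

text \<open>The layer-cake integral is split at radius 1: the perimeter bound yields
  \<open>\<beta>\<close> on \<open>[r,1]\<close>, and the measure bound yields a remainder on
  \<open>[1,\<infinity>)\<close> independent of \<open>r\<close> and \<open>s\<close>.\<close>

lemma Jt_le:
  fixes F :: "'a::euclidean_space set"
  assumes F[measurable]: "F \<in> sets borel" and fin: "emeasure lborel F < \<infinity>" and r: "0 < r" "r < 1" and s: "1 < s"
    and P: "Per F = ennreal p" "p \<ge> 0"
  shows "Jt r s F \<le> ennreal (unit_ball_vol (real (DIM('a) - 1)) * p * beta DIM('a) r s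
       + measure lborel F * unit_ball_vol (real DIM('a)) * (real DIM('a) + 1))"
proof -
  let ?d = "DIM('a)"
  define w where "w = unit_ball_vol (real (?d - 1))"
  define v where "v = unit_ball_vol (real ?d)"
  define N where "N = measure lborel F"
  have w: "w \<ge> 0" and v: "v \<ge> 0" and N: "N \<ge> 0" "emeasure lborel F = ennreal N"
    using fin by (auto simp: w_def v_def N_def emeasure_eq_ennreal_measure)
  define a where "a \<tau> = (real ?d + s) * \<tau> powr (- real ?d - s - 1)" for \<tau>
  define c1 where "c1 = (real ?d + s) * (2 * w / (real ?d + 1) * p)"
  define c2 where "c2 = (real ?d + s) * (2 * N * v)"
  have c: "c1 \<ge> 0" "c2 \<ge> 0" using w v N P s by (auto simp: c1_def c2_def)
  have "2 * Jt r s F = (\<integral>\<^sup>+\<tau>. indicator {r..} \<tau> * ennreal (a \<tau>) * ball_shift F \<tau> \<partial>lborel)"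
    using r s unfolding a_def by (intro Jt_layer_cake) auto
  also have "\<dots> \<le> (\<integral>\<^sup>+\<tau>. ennreal (c1 * \<tau> powr (- s)) * indicator {r..1} \<tau> + ennreal (c2 * \<tau> powr (- s - 1)) * indicator {1..} \<tau> \<partial>lborel)"
  proof (rule nn_integral_mono)
    fix \<tau> :: real
    consider "\<tau> < r" | "r \<le> \<tau>" "\<tau> \<le> 1" | "\<tau> > 1" by linarith
    then show "indicator {r..} \<tau> * ennreal (a \<tau>) * ball_shift F \<tau> \<le> ennreal (c1 * \<tau> powr (- s)) * indicator {r..1} \<tau> + ennreal (c2 * \<tau> powr (- s - 1)) * indicator {1..} \<tau>"
    proof cases
      case 1
      then show ?thesis by simp
    next
      case 2
      then have \<tau>: "\<tau> > 0" using r by simp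
      have "ennreal (a \<tau>) * ball_shift F \<tau> \<le> ennreal (a \<tau>) * (ennreal (2 * w / (real ?d + 1) * \<tau> ^ (?d + 1)) * ennreal p)"
        using ball_shift_le_Per[OF F fin \<tau>] P by (intro mult_left_mono) (auto simp: w_def)
      also have "\<dots> = ennreal (c1 * \<tau> powr (- s))"
      proof -
        have "a \<tau> * (2 * w / (real ?d + 1) * \<tau> ^ (?d + 1) * p) = c1 * (\<tau> powr (- real ?d - s - 1) * \<tau> ^ (?d + 1))"
          by (simp only: a_def c1_def ac_simps)
        also have "\<dots> = c1 * \<tau> powr (- s)" unfolding powr_split[OF \<tau>] by simp
        finally show ?thesis using P w s \<tau> by (simp add: a_def flip: ennreal_mult)
      qed
      finally show ?thesis using 2 by (simp add: add_increasing2)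
    next
      case 3
      then have \<tau>: "\<tau> > 0" "\<tau> \<ge> r" using r by simp_all
      have "ennreal (a \<tau>) * ball_shift F \<tau> \<le> ennreal (a \<tau>) * (2 * ennreal N * ennreal (v * \<tau> ^ ?d))"
        using ball_shift_le_emeasure[OF F, of \<tau>] \<tau> N by (intro mult_left_mono) (auto simp: v_def)
      also have "2 * ennreal N = ennreal (2 * N)" using N by (simp add: ennreal_mult)
      also have "ennreal (a \<tau>) * (ennreal (2 * N) * ennreal (v * \<tau> ^ ?d)) = ennreal (c2 * \<tau> powr (- s - 1))"
      proof -
        have "a \<tau> * (2 * N * (v * \<tau> ^ ?d)) = c2 * (\<tau> powr (- real ?d - s - 1) * \<tau> ^ (?d + 0))"
          by (simp only: a_def c2_def ac_simps add_0)
        also have "\<dots> = c2 * \<tau> powr (- s - 1)"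
          unfolding powr_split[OF \<tau>(1)] by (rule arg_cong[where f="\<lambda>e. c2 * \<tau> powr e"]) simp
        finally show ?thesis using N v s \<tau> by (simp add: a_def flip: ennreal_mult)
      qed
      finally show ?thesis using 3 \<tau> by simp
    qed
  qed
  also have "\<dots> = (\<integral>\<^sup>+\<tau>. ennreal (c1 * \<tau> powr (- s)) * indicator {r..1} \<tau> \<partial>lborel) + (\<integral>\<^sup>+\<tau>. ennreal (c2 * \<tau> powr (- s - 1)) * indicator {1..} \<tau> \<partial>lborel)"
    by (rule nn_integral_add) measurable
  also have "(\<integral>\<^sup>+\<tau>. ennreal (c1 * \<tau> powr (- s)) * indicator {r..1} \<tau> \<partial>lborel) = ennreal (c1 * (1 powr (1 - s) / (1 - s)) - c1 * (r powr (1 - s) / (1 - s)))"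
  proof (rule nn_integral_FTC_Icc[where F="\<lambda>\<tau>. c1 * (\<tau> powr (1 - s) / (1 - s))"])
    show "((\<lambda>\<tau>. c1 * (\<tau> powr (1 - s) / (1 - s))) has_real_derivative c1 * x powr (- s)) (at x)" if "x \<in> {r..1}" for x
      using that r s by (auto intro!: derivative_eq_intros)
  qed (use c r in auto)
  also have "c1 * (1 powr (1 - s) / (1 - s)) - c1 * (r powr (1 - s) / (1 - s)) = c1 * ((r powr (1 - s) - 1) / (s - 1))"
  proof -
    have "1 powr (1 - s) / (1 - s) - r powr (1 - s) / (1 - s) = (r powr (1 - s) - 1) / (s - 1)"
      using s by (simp add: field_simps)
    then show ?thesis unfolding right_diff_distrib[symmetric] by simp
  qed
  also have "(\<integral>\<^sup>+\<tau>. ennreal (c2 * \<tau> powr (- s - 1)) * indicator {1..} \<tau> \<partial>lborel) = ennreal (0 - (- (c2 / s * 1 powr (- s))))"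
  proof (rule nn_integral_FTC_atLeast[where F="\<lambda>\<tau>. - (c2 / s * \<tau> powr (- s))"])
    show "((\<lambda>\<tau>. - (c2 / s * \<tau> powr (- s))) has_real_derivative c2 * x powr (- s - 1)) (at x)" if "1 \<le> x" for x
      using that s by (auto intro!: derivative_eq_intros)
    have "((\<lambda>\<tau>::real. \<tau> powr (- s)) \<longlongrightarrow> 0) at_top"
      using s by (intro tendsto_neg_powr filterlim_ident) auto
    then have "((\<lambda>\<tau>::real. - (c2 / s * \<tau> powr (- s))) \<longlongrightarrow> - (c2 / s * 0)) at_top"
      by (intro tendsto_intros)
    then show "((\<lambda>\<tau>::real. - (c2 / s * \<tau> powr (- s))) \<longlongrightarrow> 0) at_top" by simp
  qed (use c in auto)
  also have "0 - (- (c2 / s * 1 powr (- s))) = c2 / s" by simp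
  also have "c1 * ((r powr (1 - s) - 1) / (s - 1)) = 2 * (w * p * (beta ?d r s - 1 / (real ?d + 1)))"
  proof -
    have "k * (2 * w / x * p) * q = 2 * (w * p * (k / x * q))" for k x q :: real by simp
    then show ?thesis unfolding c1_def beta_radial[symmetric] .
  qed
  also have "ennreal (2 * (w * p * (beta ?d r s - 1 / (real ?d + 1)))) + ennreal (c2 / s) \<le> ennreal (2 * (w * p * beta ?d r s)) + ennreal (2 * (N * v * (real ?d + 1)))"
  proof (intro add_mono ennreal_leI)
    show "2 * (w * p * (beta ?d r s - 1 / (real ?d + 1))) \<le> 2 * (w * p * beta ?d r s)"
      using w P by (intro mult_left_mono) auto
    \<comment> \<open>The quotient is \<open>1 + d / s\<close>, and \<open>s > 1\<close>.\<close>
    have "(real ?d + s) / s \<le> real ?d + 1" using s by (simp add: field_simps)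
    then have "2 * N * v * ((real ?d + s) / s) \<le> 2 * N * v * (real ?d + 1)" using N v by (intro mult_left_mono) auto
    then show "c2 / s \<le> 2 * (N * v * (real ?d + 1))" by (simp add: c2_def mult_ac)
  qed
  also have "\<dots> = 2 * ennreal (w * p * beta ?d r s + N * v * (real ?d + 1))"
  proof -
    have "2 * ennreal (w * p * beta ?d r s + N * v * (real ?d + 1)) = ennreal (2 * (w * p * beta ?d r s + N * v * (real ?d + 1)))"
      by (subst ennreal_mult') auto
    then show ?thesis
      using w v N P beta_pos[OF r s, of ?d] by (simp add: ring_distribs less_imp_le flip: ennreal_plus)
  qed
  finally show ?thesis
    unfolding w_def v_def N_def by (subst (asm) ennreal_mult_le_mult_iff) auto
qed

section \<open>The lower bound for a single test field\<close>

text \<open>Uniform continuity on \<open>cball 0 (R + 1)\<close> suffices: for points closer than 1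
  of which one lies outside this ball, both lie beyond radius \<open>R\<close>, where the divergence
  vanishes.\<close>

lemma divg_uniformly_continuous:
  assumes t: "(\<phi>, D) \<in> test_fields" and "e > 0"
  obtains \<delta> where "\<delta> > 0" "\<And>x y. norm (x - y) < \<delta> \<Longrightarrow> \<bar>divg D x - divg D y\<bar> \<le> e"
proof -
  obtain R where R: "R > 0" "\<And>x. norm x > R \<Longrightarrow> \<phi> x = 0" "\<And>x. norm x > R \<Longrightarrow> divg D x = 0"
    using test_fields_support[OF t] by metis
  have "uniformly_continuous_on (cball 0 (R + 1)) (divg D)"
    by (intro compact_uniformly_continuous continuous_on_subset[OF test_fields_continuous(3)[OF t]]) auto
  then obtain \<delta> where \<delta>: "\<delta> > 0" "\<And>x y. x \<in> cball 0 (R + 1) \<Longrightarrow> y \<in> cball 0 (R + 1) \<Longrightarrow> dist y x < \<delta> \<Longrightarrow> dist (divg D y) (divg D x) < e"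
    using \<open>e > 0\<close> unfolding uniformly_continuous_on_def by metis
  show ?thesis
  proof (rule that[of "min \<delta> 1"])
    fix x y :: 'a assume xy: "norm (x - y) < min \<delta> 1"
    show "\<bar>divg D x - divg D y\<bar> \<le> e"
    proof (cases "norm x \<le> R + 1 \<and> norm y \<le> R + 1")
      case True
      then have "dist (divg D x) (divg D y) < e" using xy by (intro \<delta>(2)) (auto simp: dist_norm)
      then show ?thesis by (simp add: dist_real_def)
    next
      case False
      have "norm x \<le> norm y + norm (x - y)" "norm y \<le> norm x + norm (x - y)"
        using norm_triangle_ineq2[of x y] norm_triangle_ineq3[of x y] by linarith+
      then have "norm x > R" "norm y > R" using False xy by auto
      then show ?thesis using R(3) \<open>e > 0\<close> by simp
    qed
  qed (use \<delta> in auto)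
qed

lemma integral_indicator_mult_tendsto:
  fixes E :: "'a::euclidean_space set" and q :: "'a \<Rightarrow> real"
  assumes E[measurable]: "E \<in> sets borel" and F[measurable]: "\<And>n. F n \<in> sets borel" and q[measurable]: "q \<in> borel_measurable borel"
    and fE: "emeasure lborel E < \<infinity>" and fF: "\<And>n. emeasure lborel (F n) < \<infinity>" and C: "\<And>x. \<bar>q x\<bar> \<le> C"
    and L: "(\<lambda>n. \<integral>\<^sup>+x. ennreal \<bar>indicator (F n) x - indicator E x\<bar> \<partial>lborel) \<longlonglongrightarrow> 0"
  shows "(\<lambda>n. \<integral>x. indicator (F n) x * q x \<partial>lborel) \<longlonglongrightarrow> (\<integral>x. indicator E x * q x \<partial>lborel)"
proof (rule tendsto_L1_int)
  have int: "integrable lborel (\<lambda>x. indicator S x * q x)" if [measurable]: "S \<in> sets borel" and "emeasure lborel S < \<infinity>" for S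
    by (rule integrableI_bounded_set[where A=S and B=C]) (use that C in \<open>auto simp: indicator_def\<close>)
  show "integrable lborel (\<lambda>x. indicator (F n) x * q x)" for n by (rule int[OF F fF])
  show "integrable lborel (\<lambda>x. indicator E x * q x)" by (rule int[OF E fE])
  have C0: "C \<ge> 0" using C[of 0] by linarith
  have lim: "(\<lambda>n. ennreal C * (\<integral>\<^sup>+x. ennreal \<bar>indicator (F n) x - indicator E x\<bar> \<partial>lborel)) \<longlonglongrightarrow> ennreal C * 0"
    by (intro ennreal_tendsto_cmult L) simp
  have bnd: "(\<integral>\<^sup>+x. ennreal (norm (indicator (F n) x * q x - indicator E x * q x)) \<partial>lborel)
       \<le> ennreal C * (\<integral>\<^sup>+x. ennreal \<bar>indicator (F n) x - indicator E x\<bar> \<partial>lborel)" for n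
  proof -
    have "(\<integral>\<^sup>+x. ennreal (norm (indicator (F n) x * q x - indicator E x * q x)) \<partial>lborel)
       \<le> (\<integral>\<^sup>+x. ennreal C * ennreal \<bar>indicator (F n) x - indicator E x\<bar> \<partial>lborel)"
    proof (rule nn_integral_mono)
      fix x
      have "norm (indicator (F n) x * q x - indicator E x * q x) = \<bar>q x\<bar> * \<bar>indicator (F n) x - indicator E x\<bar>"
        by (auto simp: indicator_def)
      also have "\<dots> \<le> C * \<bar>indicator (F n) x - indicator E x\<bar>" using C by (intro mult_right_mono) auto
      finally show "ennreal (norm (indicator (F n) x * q x - indicator E x * q x)) \<le> ennreal C * ennreal \<bar>indicator (F n) x - indicator E x\<bar>"
        using C0 by (simp add: ennreal_leI flip: ennreal_mult)
    qed
    then show ?thesis by (subst (asm) nn_integral_cmult) auto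
  qed
  show "(\<lambda>n. \<integral>\<^sup>+x. ennreal (norm (indicator (F n) x * q x - indicator E x * q x)) \<partial>lborel) \<longlonglongrightarrow> 0"
  proof (rule tendsto_sandwich)
    show "\<forall>\<^sub>F n in sequentially. 0 \<le> (\<integral>\<^sup>+x. ennreal (norm (indicator (F n) x * q x - indicator E x * q x)) \<partial>lborel)"
      by (intro always_eventually allI zero_le)
    show "\<forall>\<^sub>F n in sequentially. (\<integral>\<^sup>+x. ennreal (norm (indicator (F n) x * q x - indicator E x * q x)) \<partial>lborel)
       \<le> ennreal C * (\<integral>\<^sup>+x. ennreal \<bar>indicator (F n) x - indicator E x\<bar> \<partial>lborel)"
      by (intro always_eventually allI bnd)
    show "(\<lambda>n. ennreal C * (\<integral>\<^sup>+x. ennreal \<bar>indicator (F n) x - indicator E x\<bar> \<partial>lborel)) \<longlonglongrightarrow> 0"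
      using lim by (simp only: mult_zero_right)
  qed (rule tendsto_const)
qed

lemma ennreal_divide_le: "y > 0 \<Longrightarrow> ennreal (x / y) \<le> ennreal x / ennreal y"
  by (cases "x \<ge> 0") (auto simp: divide_ennreal ennreal_neg divide_nonpos_pos)

text \<open>The mollifier depends only on the modulus of continuity of the divergence, so its Taylor
  constant is fixed while \<open>n\<close> tends to infinity and the error is removed by
  \<open>\<beta>\<close>. The mollified divergence is a bounded function, and its integral over
  \<open>F n\<close> is continuous under \<open>L1\<close> convergence.\<close>

lemma liminf_Jt_ge_test_field:
  fixes E :: "'a::euclidean_space set"
  assumes E[measurable]: "E \<in> sets borel" and F[measurable]: "\<And>n. F n \<in> sets borel"
    and fE: "emeasure lborel E < \<infinity>" and fF: "\<And>n. emeasure lborel (F n) < \<infinity>"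
    and L: "(\<lambda>n. \<integral>\<^sup>+x. ennreal \<bar>indicator (F n) x - indicator E x\<bar> \<partial>lborel) \<longlonglongrightarrow> 0"
    and r01: "\<forall>n. 0 < r n \<and> r n < 1" and s1: "\<forall>n. 1 < s n" and rlim: "r \<longlonglongrightarrow> 0" and slim: "s \<longlonglongrightarrow> 1"
    and t: "(\<phi>, D) \<in> test_fields"
  shows "ennreal (unit_ball_vol (real (DIM('a) - 1)) * (\<integral>x. indicator E x * divg D x \<partial>lborel))
    \<le> liminf (\<lambda>n. Jt (r n) (s n) (F n) / ennreal (beta DIM('a) (r n) (s n)))"
    (is "_ \<le> ?X")
proof (rule ennreal_le_epsilon)
  let ?d = "DIM('a)"
  fix e' :: real assume e': "e' > 0"
  define w where "w = unit_ball_vol (real (?d - 1))"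
  define N where "N = measure lborel E"
  have w: "w \<ge> 0" and N: "N \<ge> 0" by (auto simp: w_def N_def)
  \<comment> \<open>Replacing the divergence by its mollification costs at most \<open>e\<close>
    pointwise, hence \<open>w * N * e\<close> in total; the added 1 keeps the denominator positive
    when \<open>N = 0\<close>.\<close>
  define e where "e = e' / (w * N + 1)"
  have wN: "w * N + 1 > 0" using w N by (simp add: add_nonneg_pos)
  then have e: "e > 0" "w * N * e \<le> e'" using e' w N by (auto simp: e_def field_simps)
  obtain \<delta> where \<delta>: "\<delta> > 0" "\<And>x y. norm (x - y) < \<delta> \<Longrightarrow> \<bar>divg D x - divg D y\<bar> \<le> e"
    using divg_uniformly_continuous[OF t e(1)] by metis
  obtain \<eta> :: "'a \<Rightarrow> real" and G L where "mollifier \<eta> G \<delta> L"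
    using mollifier_exists[OF \<delta>(1)] by metis
  then interpret mollifier \<eta> G \<delta> L .
  have cd: "continuous_on UNIV (divg D)" by (rule test_fields_continuous(3)[OF t])
  have dm[measurable]: "divg D \<in> borel_measurable borel"
    by (rule borel_measurable_continuous_onI[OF cd])
  obtain R where R: "R > 0" "\<And>x. norm x > R \<Longrightarrow> \<phi> x = 0" "\<And>x. norm x > R \<Longrightarrow> divg D x = 0"
    using test_fields_support[OF t] by metis
  have "bounded (divg D ` cball 0 R)"
    by (intro compact_imp_bounded compact_continuous_image continuous_on_subset[OF cd]) auto
  then obtain C0 where C0: "\<And>x. x \<in> cball 0 R \<Longrightarrow> norm (divg D x) \<le> C0"
    unfolding bounded_iff by (metis imageI)
  define C where "C = max C0 0"
  have C: "\<bar>divg D x\<bar> \<le> C" for x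
    using C0[of x] R(3)[of x] by (cases "norm x \<le> R") (auto simp: C_def)
  have eta1: "(\<integral>\<^sup>+x. ennreal (\<eta> (x - y)) \<partial>lborel) = 1" for y
    using nn_integral_lborel_shift[of "\<lambda>x. ennreal (\<eta> x)" "-y"] total by simp
  have eta_i: "integrable lborel (\<lambda>x. \<eta> (x - y))" for y
    by (rule integrableI_nonneg) (auto simp: eta1 nonneg)
  have eta1': "(\<integral>x. \<eta> (x - y) \<partial>lborel) = 1" for y
    by (subst integral_eq_nn_integral) (auto simp: eta1 nonneg)
  define q where "q y = (\<integral>x. \<eta> (x - y) * divg D x \<partial>lborel)" for y
  have [measurable]: "q \<in> borel_measurable borel" unfolding q_def by measurable
  have eta_d: "integrable lborel (\<lambda>x. \<eta> (x - y) * divg D x)" for y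
    by (rule Bochner_Integration.integrable_bound[OF integrable_mult_right[OF eta_i[of y], of C]])
      (auto simp: abs_mult nonneg C_def mult.commute intro!: AE_I2 mult_right_mono C[unfolded C_def])
  have qd: "\<bar>q y - divg D y\<bar> \<le> e" for y
  proof -
    have "q y - divg D y = (\<integral>x. \<eta> (x - y) * divg D x - \<eta> (x - y) * divg D y \<partial>lborel)"
      unfolding q_def using eta_d[of y] eta_i[of y] eta1'[of y] by simp
    also have "\<dots> = (\<integral>x. \<eta> (x - y) * (divg D x - divg D y) \<partial>lborel)" by (simp add: algebra_simps)
    finally have "\<bar>q y - divg D y\<bar> \<le> (\<integral>x. norm (\<eta> (x - y) * (divg D x - divg D y)) \<partial>lborel)"
      using integral_norm_bound[of lborel "\<lambda>x. \<eta> (x - y) * (divg D x - divg D y)"] by simp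
    also have "\<dots> \<le> (\<integral>x. \<eta> (x - y) * e \<partial>lborel)"
    proof (rule integral_mono)
      show "integrable lborel (\<lambda>x. norm (\<eta> (x - y) * (divg D x - divg D y)))"
        using eta_d[of y] eta_i[of y] by (intro integrable_norm) (simp add: right_diff_distrib)
      show "norm (\<eta> (x - y) * (divg D x - divg D y)) \<le> \<eta> (x - y) * e" for x
        using \<delta>(2)[of x y] supp(1)[of "x - y"] nonneg[of "x - y"]
        by (cases "norm (x - y) < \<delta>") (auto simp: abs_mult intro: mult_left_mono)
    qed (use eta_i in auto)
    also have "\<dots> = e" using eta1' by simp
    finally show ?thesis .
  qed
  have qC: "\<bar>q y\<bar> \<le> C + e" for y using qd[of y] C[of y] by linarith
  define A where "A S = (\<integral>x. indicator S x * q x \<partial>lborel)" for S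
  define Nn where "Nn n = measure lborel (F n)" for n
  define v where "v = unit_ball_vol (real ?d)"
  have v: "v \<ge> 0" by (simp add: v_def)
  have Alim: "(\<lambda>n. A (F n)) \<longlonglongrightarrow> A E"
    unfolding A_def by (rule integral_indicator_mult_tendsto[OF E F _ fE fF qC L]) measurable
  have Nlim: "Nn \<longlonglongrightarrow> N"
  proof -
    have "(\<lambda>n. \<integral>x. indicator (F n) x * 1 \<partial>lborel) \<longlonglongrightarrow> (\<integral>x. indicator E x * (1::real) \<partial>lborel)"
      by (rule integral_indicator_mult_tendsto[OF E F _ fE fF _ L, where C=1]) auto
    then show ?thesis by (simp add: Nn_def[abs_def] N_def)
  qed
  define b where "b n = beta ?d (r n) (s n)" for n
  have bpos: "b n > 0" for n using r01 s1 beta_pos by (simp add: b_def)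
  have blim: "filterlim b at_top sequentially"
    unfolding b_def[abs_def] by (rule beta_at_top[OF r01 s1 rlim])
  have binv: "(\<lambda>n. 1 / b n) \<longlonglongrightarrow> 0"
    using tendsto_inverse_0_at_top[OF blim] by (simp add: inverse_eq_divide)
  \<comment> \<open>The lower bound of \<open>Jt_ge\<close>. After division by \<open>b n\<close>
    the first term tends to \<open>w * A E\<close>, while the second is a bounded sequence over a
    divergent one.\<close>
  define Y where "Y n = w * A (F n) * (b n - 1 / (real ?d + 1)) - Nn n * taylor_const * v * ((real ?d + s n) / (2 * (2 - s n)))" for n
  have s2: "eventually (\<lambda>n. s n < 2) sequentially"
    using slim by (rule order_tendstoD) simp
  have ev: "eventually (\<lambda>n. ennreal (Y n / b n) \<le> Jt (r n) (s n) (F n) / ennreal (b n)) sequentially"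
    using s2
  proof eventually_elim
    case (elim n)
    have "ennreal (Y n) \<le> Jt (r n) (s n) (F n)"
      unfolding Y_def b_def
    proof (rule Jt_ge)
      show "0 < r n" "r n < 1" "1 < s n" "s n < 2" using r01 s1 elim by auto
      show "0 \<le> Nn n * taylor_const * v" using taylor_const_nonneg v by (simp add: Nn_def)
      show "ennreal (2 * w / (real ?d + 1) * \<tau> ^ (?d + 1) * A (F n) - Nn n * taylor_const * v * \<tau> ^ (?d + 2)) \<le> ball_shift (F n) \<tau>"
        if "0 < \<tau>" "\<tau> \<le> 1" for \<tau>
        unfolding w_def v_def Nn_def A_def q_def by (rule ball_shift_ge_divg[OF F fF that t])
    qed measurable
    then have "ennreal (Y n) / ennreal (b n) \<le> Jt (r n) (s n) (F n) / ennreal (b n)"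
      by (rule divide_right_mono_ennreal)
    with ennreal_divide_le[OF bpos, of "Y n" n] show ?case by (rule order_trans)
  qed
  have "Y n / b n = w * A (F n) * (1 - 1 / (real ?d + 1) * (1 / b n)) - Nn n * taylor_const * v * ((real ?d + s n) / (2 * (2 - s n))) * (1 / b n)" for n
    using bpos[of n] by (simp add: Y_def diff_divide_distrib right_diff_distrib)
  moreover have "(\<lambda>n. w * A (F n) * (1 - 1 / (real ?d + 1) * (1 / b n)) - Nn n * taylor_const * v * ((real ?d + s n) / (2 * (2 - s n))) * (1 / b n))
      \<longlonglongrightarrow> w * A E * (1 - 1 / (real ?d + 1) * 0) - N * taylor_const * v * ((real ?d + 1) / (2 * (2 - 1))) * 0"
    by (intro tendsto_intros Alim Nlim slim binv) auto
  ultimately have "(\<lambda>n. Y n / b n) \<longlonglongrightarrow> w * A E" by simp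
  then have "(\<lambda>n. ennreal (Y n / b n)) \<longlonglongrightarrow> ennreal (w * A E)" by (rule tendsto_ennrealI)
  then have "ennreal (w * A E) = liminf (\<lambda>n. ennreal (Y n / b n))"
    by (simp add: lim_imp_Liminf)
  also have "\<dots> \<le> ?X" unfolding b_def[symmetric] by (rule Liminf_mono[OF ev])
  finally have AX: "ennreal (w * A E) \<le> ?X" .
  have "(\<integral>x. indicator E x * divg D x \<partial>lborel) \<le> A E + e * N"
  proof -
    have i1: "integrable lborel (\<lambda>x. indicator E x * divg D x)"
      by (rule integrableI_bounded_set[where A=E and B=C]) (use fE C in \<open>auto simp: indicator_def\<close>)
    have i2: "integrable lborel (\<lambda>x. indicator E x * q x)"
      by (rule integrableI_bounded_set[where A=E and B="C + e"]) (use fE qC in \<open>auto simp: indicator_def\<close>)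
    have i3: "integrable lborel (\<lambda>x. e * indicator E x)"
      using fE by (intro integrable_mult_right integrable_real_indicator) auto
    have "(\<integral>x. indicator E x * divg D x \<partial>lborel) \<le> (\<integral>x. indicator E x * q x + e * indicator E x \<partial>lborel)"
    proof (rule integral_mono[OF i1 Bochner_Integration.integrable_add[OF i2 i3]])
      fix x
      have "divg D x \<le> q x + e" using qd[of x] by linarith
      then show "indicator E x * divg D x \<le> indicator E x * q x + e * indicator E x" by (simp add: indicator_def)
    qed
    also have "\<dots> = A E + e * N" unfolding A_def N_def using i2 i3 by simp
    finally show ?thesis .
  qed
  then have "w * (\<integral>x. indicator E x * divg D x \<partial>lborel) \<le> w * (A E + e * N)" using w by (rule mult_left_mono)
  also have "\<dots> \<le> w * A E + e'" using e(2) by (simp add: algebra_simps)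
  finally have "ennreal (w * (\<integral>x. indicator E x * divg D x \<partial>lborel)) \<le> ennreal (w * A E + e')" by (rule ennreal_leI)
  \<comment> \<open>\<open>A E\<close> may be negative, in which case \<open>ennreal\<close> cuts it
    to 0 and the inequality still holds.\<close>
  also have "\<dots> \<le> ennreal (w * A E) + ennreal e'"
    using e' by (cases "w * A E \<ge> 0") (auto simp: ennreal_neg intro!: ennreal_leI)
  also have "\<dots> \<le> ?X + ennreal e'" using AX by (rule add_right_mono)
  finally show "ennreal (unit_ball_vol (real (?d - 1)) * (\<integral>x. indicator E x * divg D x \<partial>lborel)) \<le> ?X + ennreal e'"
    by (simp add: w_def)
qed

section \<open>Lower and upper limits\<close>

lemma liminf_Jt_ge_Per:
  fixes E :: "'a::euclidean_space set"
  assumes E[measurable]: "E \<in> sets borel" and F[measurable]: "\<And>n. F n \<in> sets borel"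
    and fE: "emeasure lborel E < \<infinity>" and fF: "\<And>n. emeasure lborel (F n) < \<infinity>"
    and L: "(\<lambda>n. \<integral>\<^sup>+x. ennreal \<bar>indicator (F n) x - indicator E x\<bar> \<partial>lborel) \<longlonglongrightarrow> 0"
    and r01: "\<forall>n. 0 < r n \<and> r n < 1" and s1: "\<forall>n. 1 < s n" and rlim: "r \<longlonglongrightarrow> 0" and slim: "s \<longlonglongrightarrow> 1"
  shows "ennreal (unit_ball_vol (real (DIM('a) - 1))) * Per E
    \<le> liminf (\<lambda>n. Jt (r n) (s n) (F n) / ennreal (beta DIM('a) (r n) (s n)))"
proof -
  have "ennreal (unit_ball_vol (real (DIM('a) - 1))) * Per E
      = (SUP p \<in> test_fields. ennreal (unit_ball_vol (real (DIM('a) - 1))) * ennreal (\<integral>x. indicator E x * divg (snd p) x \<partial>lebesgue))"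
    unfolding Per_def by (rule SUP_mult_left_ennreal)
  also have "\<dots> \<le> liminf (\<lambda>n. Jt (r n) (s n) (F n) / ennreal (beta DIM('a) (r n) (s n)))"
  proof (rule SUP_least)
    fix p :: "('a \<Rightarrow> 'a) \<times> ('a \<Rightarrow> 'a \<Rightarrow>\<^sub>L 'a)"
    assume p: "p \<in> test_fields"
    then have t: "(fst p, snd p) \<in> test_fields" by simp
    have [measurable]: "divg (snd p) \<in> borel_measurable borel"
      by (rule borel_measurable_continuous_onI[OF test_fields_continuous(3)[OF t]])
    have "(\<integral>x. indicator E x * divg (snd p) x \<partial>lebesgue) = (\<integral>x. indicator E x * divg (snd p) x \<partial>lborel)"
      by (rule integral_completion) simp
    then have "ennreal (unit_ball_vol (real (DIM('a) - 1))) * ennreal (\<integral>x. indicator E x * divg (snd p) x \<partial>lebesgue)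
      = ennreal (unit_ball_vol (real (DIM('a) - 1)) * (\<integral>x. indicator E x * divg (snd p) x \<partial>lborel))"
      by (simp add: ennreal_mult')
    also have "\<dots> \<le> liminf (\<lambda>n. Jt (r n) (s n) (F n) / ennreal (beta DIM('a) (r n) (s n)))"
      by (rule liminf_Jt_ge_test_field[OF E F fE fF L r01 s1 rlim slim t])
    finally show "ennreal (unit_ball_vol (real (DIM('a) - 1))) * ennreal (\<integral>x. indicator E x * divg (snd p) x \<partial>lebesgue)
      \<le> liminf (\<lambda>n. Jt (r n) (s n) (F n) / ennreal (beta DIM('a) (r n) (s n)))" .
  qed
  finally show ?thesis .
qed

text \<open>For finite perimeter the remainder of \<open>Jt_le\<close> does not depend on
  \<open>n\<close> and disappears on division by \<open>\<beta>\<close>. For infinite perimeter the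
  right side is \<open>top\<close>, because the factor in front is positive.\<close>

lemma limsup_Jt_le_Per:
  fixes E :: "'a::euclidean_space set"
  assumes E[measurable]: "E \<in> sets borel" and fE: "emeasure lborel E < \<infinity>"
    and r01: "\<forall>n. 0 < r n \<and> r n < 1" and s1: "\<forall>n. 1 < s n" and rlim: "r \<longlonglongrightarrow> 0"
  shows "limsup (\<lambda>n. Jt (r n) (s n) E / ennreal (beta DIM('a) (r n) (s n))) \<le> ennreal (unit_ball_vol (real (DIM('a) - 1))) * Per E"
proof (cases "Per E")
  case (real p)
  define w where "w = unit_ball_vol (real (DIM('a) - 1))"
  define C where "C = measure lborel E * unit_ball_vol (real DIM('a)) * (real DIM('a) + 1)"
  define b where "b n = beta DIM('a) (r n) (s n)" for n
  have bpos: "b n > 0" for n using r01 s1 beta_pos by (simp add: b_def)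
  have blim: "filterlim b at_top sequentially"
    unfolding b_def[abs_def] by (rule beta_at_top[OF r01 s1 rlim])
  have "Jt (r n) (s n) E / ennreal (b n) \<le> ennreal (w * p + C * (1 / b n))" for n
  proof -
    have "Jt (r n) (s n) E \<le> ennreal (w * p * b n + C)"
      unfolding w_def C_def b_def using r01 s1 real by (intro Jt_le[OF E fE]) auto
    then have "Jt (r n) (s n) E / ennreal (b n) \<le> ennreal (w * p * b n + C) / ennreal (b n)"
      by (rule divide_right_mono_ennreal)
    also have "\<dots> = ennreal ((w * p * b n + C) / b n)"
      using bpos[of n] real by (intro divide_ennreal) (auto simp: w_def C_def)
    also have "(w * p * b n + C) / b n = w * p + C * (1 / b n)" using bpos[of n] by (simp add: field_simps)
    finally show ?thesis .
  qed
  then have "limsup (\<lambda>n. Jt (r n) (s n) E / ennreal (b n)) \<le> limsup (\<lambda>n. ennreal (w * p + C * (1 / b n)))"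
    by (intro Limsup_mono always_eventually allI)
  also have "\<dots> = ennreal (w * p)"
  proof (rule lim_imp_Limsup)
    have "(\<lambda>n. 1 / b n) \<longlonglongrightarrow> 0"
      using tendsto_inverse_0_at_top[OF blim] by (simp add: inverse_eq_divide)
    then have "(\<lambda>n. w * p + C * (1 / b n)) \<longlonglongrightarrow> w * p + C * 0" by (intro tendsto_intros)
    then show "(\<lambda>n. ennreal (w * p + C * (1 / b n))) \<longlonglongrightarrow> ennreal (w * p)"
      by (intro tendsto_ennrealI) simp
  qed simp
  finally show ?thesis using real unfolding b_def w_def by (simp add: ennreal_mult)
next
  case top
  define w where "w = unit_ball_vol (real (DIM('a) - 1))"
  have "w > 0" by (simp add: w_def)
  then have "ennreal w * Per E = top"
    using top by (simp add: ennreal_mult_eq_top_iff)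
  then show ?thesis by (simp add: w_def)
qed

section \<open>Passage to Borel representatives\<close>

text \<open>The representative is taken inside \<open>E\<close>, so that finite measure and
  containment in a bounded set are inherited.\<close>

lemma borel_representative:
  assumes "E \<in> sets lebesgue"
  obtains E' where "E' \<in> sets borel" "E' \<subseteq> E" "AE x in lborel. x \<in> E \<longleftrightarrow> x \<in> E'"
proof -
  obtain S N N' where "E = S \<union> N" "N \<subseteq> N'" "N' \<in> null_sets lborel" "S \<in> sets lborel"
    using assms by (rule sets_completionE)
  then show ?thesis
    by (intro that[of S] AE_I'[of N']) auto
qed

lemma Jt_cong_AE:
  assumes "AE x in lborel. x \<in> E \<longleftrightarrow> x \<in> E'"
  shows "Jt r s E = Jt r s E'"
proof -
  have i: "AE y in lborel. indicator (UNIV - E) y = (indicator (UNIV - E') y :: ennreal)"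
    using assms by eventually_elim (simp add: indicator_def)
  have "(\<integral>\<^sup>+ y. indicator E x * indicator (UNIV - E) y * k y \<partial>lborel) = (\<integral>\<^sup>+ y. indicator E x * indicator (UNIV - E') y * k y \<partial>lborel)" for x k
    by (rule nn_integral_cong_AE) (use i in eventually_elim, simp)
  moreover have "(\<integral>\<^sup>+ x. \<integral>\<^sup>+ y. indicator E x * indicator (UNIV - E') y * k x y \<partial>lborel \<partial>lborel) = (\<integral>\<^sup>+ x. \<integral>\<^sup>+ y. indicator E' x * indicator (UNIV - E') y * k x y \<partial>lborel \<partial>lborel)" for k
    by (rule nn_integral_cong_AE) (use assms in eventually_elim, simp add: indicator_def)
  ultimately show ?thesis
    unfolding Jt_def nn_integral_completion by simp
qed

lemma Per_cong_AE:
  fixes E :: "'a::euclidean_space set"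
  assumes "AE x in lborel. x \<in> E \<longleftrightarrow> x \<in> E'" "E \<in> sets lebesgue" "E' \<in> sets lebesgue"
  shows "Per E = Per E'"
  unfolding Per_def
proof (rule SUP_cong[OF refl])
  fix p :: "('a \<Rightarrow> 'a) \<times> ('a \<Rightarrow> 'a \<Rightarrow>\<^sub>L 'a)"
  assume "p \<in> test_fields"
  then have t: "(fst p, snd p) \<in> test_fields" by simp
  have "divg (snd p) \<in> borel_measurable lborel"
    using borel_measurable_continuous_onI[OF test_fields_continuous(3)[OF t]] by simp
  then have [measurable]: "divg (snd p) \<in> borel_measurable lebesgue" by (rule measurable_completion)
  note [measurable] = assms(2,3)
  have "(\<integral>x. indicator E x * divg (snd p) x \<partial>lebesgue) = (\<integral>x. indicator E' x * divg (snd p) x \<partial>lebesgue)"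
  proof (rule integral_cong_AE)
    show "AE x in lebesgue. indicator E x * divg (snd p) x = indicator E' x * divg (snd p) x"
      by (rule AE_completion) (use assms(1) in eventually_elim, simp add: indicator_def)
  qed measurable
  then show "ennreal (\<integral>x. indicator E x * divg (snd p) x \<partial>lebesgue) = ennreal (\<integral>x. indicator E' x * divg (snd p) x \<partial>lebesgue)"
    by simp
qed

lemma nn_integral_indicator_diff_cong_AE:
  assumes "AE x in lborel. x \<in> E \<longleftrightarrow> x \<in> E'" "AE x in lborel. x \<in> F \<longleftrightarrow> x \<in> F'"
  shows "(\<integral>\<^sup>+x. ennreal \<bar>indicator F x - indicator E x\<bar> \<partial>lborel) = (\<integral>\<^sup>+x. ennreal \<bar>indicator F' x - indicator E' x\<bar> \<partial>lborel)"
  by (rule nn_integral_cong_AE) (use assms in eventually_elim, simp add: indicator_def)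

section \<open>Control of translation differences by the energy\<close>

lemma ball_shift_measurable [measurable]:
  fixes F :: "'a::euclidean_space set"
  assumes [measurable]: "F \<in> sets borel"
  shows "ball_shift F \<in> borel_measurable borel"
proof -
  have [measurable]: "UNIV - F \<in> sets borel" by (simp add: sets.compl_sets[of F borel, simplified])
  show ?thesis
    unfolding ball_shift_eq_pairs[OF assms, abs_def] indicator_def atLeast_def mem_Collect_eq by measurable
qed

text \<open>Rounding \<open>t / \<tau>\<close> up to an integer \<open>m\<close> at most doubles it,
  as \<open>t / \<tau> \<ge> 1\<close>; this is the 2 in the constant. Scaling by the integer
  \<open>m\<close> then applies.\<close>

lemma ball_shift_le_smaller_radius:
  fixes F :: "'a::euclidean_space set"
  assumes [measurable]: "F \<in> sets borel" and "0 < \<tau>" "\<tau> \<le> t"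
  shows "ball_shift F t \<le> ennreal ((2 * t / \<tau>) ^ (DIM('a) + 1)) * ball_shift F \<tau>"
proof -
  define m where "m = nat \<lceil>t / \<tau>\<rceil>"
  have q: "t / \<tau> \<ge> 1" using assms by simp
  then have m: "real m \<ge> t / \<tau>" "real m \<le> t / \<tau> + 1" by (auto simp: m_def)
  have m0: "m > 0" using m(1) q by (cases m) auto
  have "t \<le> real m * \<tau>" using m(1) assms by (simp add: field_simps)
  then have "ball_shift F t \<le> ball_shift F (real m * \<tau>)" by (rule ball_shift_mono)
  also have "\<dots> \<le> of_nat m ^ (DIM('a) + 1) * ball_shift F \<tau>" by (rule ball_shift_scale_le) (use m0 in auto)
  also have "of_nat m ^ (DIM('a) + 1) = ennreal (real m ^ (DIM('a) + 1))"
    by (simp add: ennreal_power[symmetric] ennreal_of_nat_eq_real_of_nat del: power_Suc)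
  also have "\<dots> \<le> ennreal ((2 * t / \<tau>) ^ (DIM('a) + 1))"
  proof (intro ennreal_leI power_mono)
    show "real m \<le> 2 * t / \<tau>" using m(2) q by simp
  qed simp
  finally show ?thesis by (simp add: mult_right_mono)
qed

text \<open>For every radius in \<open>[r,t]\<close> the value at \<open>t\<close> bounds
  \<open>ball_shift\<close> from below, up to the power \<open>d + 1\<close> of the ratio of radii.
  In the layer-cake formula this leaves \<open>(d + s) * \<tau> powr (- s)\<close> under the
  integral, whose size is comparable to \<open>\<beta>\<close> when \<open>r\<close> is
  small.\<close>

lemma ball_shift_le_Jt:
  fixes F :: "'a::euclidean_space set"
  assumes [measurable]: "F \<in> sets borel" and r: "0 < r" and rt: "r \<le> t" and s: "1 < s"
  shows "ball_shift F t * ennreal ((real DIM('a) + s) * ((r powr (1 - s) - t powr (1 - s)) / (s - 1)))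
     \<le> ennreal (2 * (2 * t) ^ (DIM('a) + 1)) * Jt r s F"
proof -
  let ?d = "DIM('a)"
  define a where "a \<tau> = (real ?d + s) * \<tau> powr (- real ?d - s - 1)" for \<tau>
  have t: "t > 0" using r rt by simp
  have "(\<integral>\<^sup>+\<tau>. ennreal ((real ?d + s) * \<tau> powr (- s)) * indicator {r..t} \<tau> \<partial>lborel)
     = ennreal ((real ?d + s) * (t powr (1 - s) / (1 - s)) - (real ?d + s) * (r powr (1 - s) / (1 - s)))"
  proof (rule nn_integral_FTC_Icc[where F="\<lambda>\<tau>. (real ?d + s) * (\<tau> powr (1 - s) / (1 - s))"])
    show "((\<lambda>\<tau>. (real ?d + s) * (\<tau> powr (1 - s) / (1 - s))) has_real_derivative (real ?d + s) * x powr (- s)) (at x)" if "x \<in> {r..t}" for x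
      using that r s by (auto intro!: derivative_eq_intros)
  qed (use s rt in auto)
  also have "(real ?d + s) * (t powr (1 - s) / (1 - s)) - (real ?d + s) * (r powr (1 - s) / (1 - s))
     = (real ?d + s) * ((r powr (1 - s) - t powr (1 - s)) / (s - 1))"
  proof -
    have "t powr (1 - s) / (1 - s) - r powr (1 - s) / (1 - s) = (r powr (1 - s) - t powr (1 - s)) / (s - 1)"
      by (metis diff_divide_distrib minus_diff_eq minus_divide_divide)
    then show ?thesis unfolding right_diff_distrib[symmetric] by simp
  qed
  finally have "ball_shift F t * ennreal ((real ?d + s) * ((r powr (1 - s) - t powr (1 - s)) / (s - 1)))
      = (\<integral>\<^sup>+\<tau>. ball_shift F t * (ennreal ((real ?d + s) * \<tau> powr (- s)) * indicator {r..t} \<tau>) \<partial>lborel)"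
    by (simp add: nn_integral_cmult)
  also have "\<dots> \<le> (\<integral>\<^sup>+\<tau>. ennreal ((2 * t) ^ (?d + 1)) * (indicator {r..} \<tau> * ennreal (a \<tau>) * ball_shift F \<tau>) \<partial>lborel)"
  proof (rule nn_integral_mono)
    fix \<tau> :: real
    show "ball_shift F t * (ennreal ((real ?d + s) * \<tau> powr (- s)) * indicator {r..t} \<tau>)
       \<le> ennreal ((2 * t) ^ (?d + 1)) * (indicator {r..} \<tau> * ennreal (a \<tau>) * ball_shift F \<tau>)"
    proof (cases "\<tau> \<in> {r..t}")
      case True
      then have \<tau>: "\<tau> > 0" "\<tau> \<le> t" using r by auto
      have e: "(2 * t / \<tau>) ^ (?d + 1) * ((real ?d + s) * \<tau> powr (- s)) = (2 * t) ^ (?d + 1) * a \<tau>"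
      proof -
        have "\<tau> powr (- s) = \<tau> powr (- real ?d - s - 1) * \<tau> ^ (?d + 1)"
          using powr_split[OF \<tau>(1), of ?d s 1] by simp
        then have "(2 * t / \<tau>) ^ (?d + 1) * ((real ?d + s) * \<tau> powr (- s))
            = (2 * t) ^ (?d + 1) / \<tau> ^ (?d + 1) * ((real ?d + s) * (\<tau> powr (- real ?d - s - 1) * \<tau> ^ (?d + 1)))"
          by (simp only: power_divide)
        also have "\<dots> = (2 * t) ^ (?d + 1) * a \<tau>" using \<tau> unfolding a_def by (simp del: power_Suc add: field_simps)
        finally show ?thesis .
      qed
      have "ball_shift F t * ennreal ((real ?d + s) * \<tau> powr (- s)) \<le> (ennreal ((2 * t / \<tau>) ^ (?d + 1)) * ball_shift F \<tau>) * ennreal ((real ?d + s) * \<tau> powr (- s))"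
        using \<tau> by (intro mult_right_mono ball_shift_le_smaller_radius) auto
      also have "\<dots> = ennreal ((2 * t / \<tau>) ^ (?d + 1) * ((real ?d + s) * \<tau> powr (- s))) * ball_shift F \<tau>"
        using s \<tau> t by (simp add: ennreal_mult mult_ac del: power_Suc)
      also have "\<dots> = ennreal ((2 * t) ^ (?d + 1)) * (ennreal (a \<tau>) * ball_shift F \<tau>)"
        unfolding e using s t by (simp add: a_def ennreal_mult mult_ac del: power_Suc)
      finally show ?thesis using True by simp
    qed simp
  qed
  also have "\<dots> = ennreal ((2 * t) ^ (?d + 1)) * (\<integral>\<^sup>+\<tau>. indicator {r..} \<tau> * ennreal (a \<tau>) * ball_shift F \<tau> \<partial>lborel)"
    unfolding a_def by (rule nn_integral_cmult) measurable
  also have "(\<integral>\<^sup>+\<tau>. indicator {r..} \<tau> * ennreal (a \<tau>) * ball_shift F \<tau> \<partial>lborel) = 2 * Jt r s F"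
    using r s unfolding a_def by (intro Jt_layer_cake[symmetric]) auto
  finally show ?thesis
    using t by (simp add: ennreal_mult mult_ac del: power_Suc)
qed

text \<open>Convexity of the exponential gives \<open>exp z - 1 \<le> z * exp z\<close>, and
  \<open>z \<le> - ln t\<close>. The result bounds, uniformly in \<open>s\<close>, the contribution
  to \<open>\<beta>\<close> of the scales between \<open>t\<close> and 1.\<close>

lemma powr_quotient_le:
  fixes s t :: real
  assumes "0 < t" "t < 1" "1 < s" "s \<le> 2"
  shows "(t powr (1 - s) - 1) / (s - 1) \<le> - ln t / t"
proof -
  define z where "z = (s - 1) * (- ln t)"
  have "ln t < 0" using assms by simp
  then have z: "z \<ge> 0" "z \<le> - ln t"
    unfolding z_def using assms by (auto intro: mult_nonneg_nonpos mult_left_le_one_le[of "- ln t" "s - 1"])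
  have e: "t powr (1 - s) = exp z" using assms by (simp add: powr_def z_def algebra_simps)
  have "1 - z \<le> exp (- z)" using exp_ge_add_one_self[of "-z"] by simp
  then have "(1 - z) * exp z \<le> 1" using mult_right_mono[of "1 - z" "exp (- z)" "exp z"] by (simp flip: exp_add)
  then have "exp z - 1 \<le> z * exp z" by (simp add: algebra_simps)
  also have "\<dots> \<le> z * exp (- ln t)" using z by (intro mult_left_mono) auto
  also have "exp (- ln t) = 1 / t" using assms by (simp add: exp_minus inverse_eq_divide)
  finally have "t powr (1 - s) - 1 \<le> (s - 1) * (- ln t / t)" unfolding e by (simp add: z_def)
  then show ?thesis using assms by (simp add: field_simps)
qed

text \<open>Dropping the scales in \<open>[t,1]\<close> costs a bounded amount while
  \<open>\<beta>\<close> diverges, so the scales in \<open>[r,t]\<close> eventually carry at least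
  \<open>\<beta>\<close> and the factor \<open>\<beta>\<close> cancels. The index from which this
  holds depends on \<open>t\<close>, the constant \<open>M\<close> does not.\<close>

lemma ball_shift_eventually_le:
  fixes F :: "nat \<Rightarrow> 'a::euclidean_space set"
  assumes F: "\<And>n. F n \<in> sets borel"
    and J: "\<And>n. Jt (r n) (s n) (F n) \<le> ennreal (M * beta DIM('a) (r n) (s n))" and M: "M \<ge> 0"
    and r01: "\<forall>n. 0 < r n \<and> r n < 1" and s1: "\<forall>n. 1 < s n" and rlim: "r \<longlonglongrightarrow> 0" and slim: "s \<longlonglongrightarrow> 1"
    and t: "0 < t" "t < 1"
  shows "eventually (\<lambda>n. ball_shift (F n) t \<le> ennreal (2 * M * (2 * t) ^ (DIM('a) + 1))) sequentially"
proof -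
  let ?d = "DIM('a)"
  \<comment> \<open>The amount lost on \<open>[t,1]\<close>, with \<open>s\<close> replaced by its
    bound 2, plus the 1 that comes from \<open>(d + 1)\<close> times
    \<open>1 / (d + 1)\<close>.\<close>
  define Q where "Q = 1 + (real ?d + 2) * (- ln t / t)"
  have e1: "eventually (\<lambda>n. r n < t) sequentially" using rlim t by (intro order_tendstoD) auto
  have e2: "eventually (\<lambda>n. s n < 2) sequentially" using slim by (intro order_tendstoD) auto
  have e3: "eventually (\<lambda>n. Q \<le> beta ?d (r n) (s n)) sequentially"
    using beta_at_top[OF r01 s1 rlim, of ?d] by (simp add: filterlim_at_top)
  show ?thesis using e1 e2 e3
  proof eventually_elim
    case (elim n)
    define b where "b = beta ?d (r n) (s n)"
    have rs: "0 < r n" "r n < 1" "1 < s n" using r01 s1 by auto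
    have b: "b > 0" unfolding b_def using rs by (rule beta_pos)
    have "(real ?d + s n) * ((r n powr (1 - s n) - t powr (1 - s n)) / (s n - 1))
       = (real ?d + s n) * ((r n powr (1 - s n) - 1) / (s n - 1)) - (real ?d + s n) * ((t powr (1 - s n) - 1) / (s n - 1))"
      by (simp add: diff_divide_distrib right_diff_distrib)
    also have "(real ?d + s n) * ((r n powr (1 - s n) - 1) / (s n - 1)) = (real ?d + 1) * (b - 1 / (real ?d + 1))"
      unfolding b_def beta_radial[symmetric] by simp
    also have "(real ?d + 1) * (b - 1 / (real ?d + 1)) = (real ?d + 1) * b - 1" by (simp add: right_diff_distrib)
    finally have eq: "(real ?d + s n) * ((r n powr (1 - s n) - t powr (1 - s n)) / (s n - 1))
       = (real ?d + 1) * b - 1 - (real ?d + s n) * ((t powr (1 - s n) - 1) / (s n - 1))" .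
    have lt: "- ln t / t > 0" using t by (simp add: divide_neg_pos)
    have "(real ?d + s n) * ((t powr (1 - s n) - 1) / (s n - 1)) \<le> (real ?d + s n) * (- ln t / t)"
      using powr_quotient_le[of t "s n"] t rs elim by (intro mult_left_mono) auto
    also have "\<dots> \<le> (real ?d + 2) * (- ln t / t)"
      using lt elim by (intro mult_right_mono) auto
    finally have "(real ?d + s n) * ((t powr (1 - s n) - 1) / (s n - 1)) \<le> Q - 1" by (simp add: Q_def)
    \<comment> \<open>Since \<open>d \<ge> 1\<close>, the factor \<open>d + 1\<close> in front of
      \<open>b\<close> provides two copies: one absorbs \<open>Q\<close>, the other remains.\<close>
    moreover have "real ?d * b \<ge> 1 * b" using b DIM_positive[where 'a='a] by (intro mult_right_mono) auto
    moreover have "Q \<le> b" using elim by (simp add: b_def)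
    ultimately have ge: "b \<le> (real ?d + s n) * ((r n powr (1 - s n) - t powr (1 - s n)) / (s n - 1))"
      unfolding eq by (simp add: ring_distribs)
    have "ball_shift (F n) t * ennreal b \<le> ball_shift (F n) t * ennreal ((real ?d + s n) * ((r n powr (1 - s n) - t powr (1 - s n)) / (s n - 1)))"
      using ge by (intro mult_left_mono ennreal_leI) auto
    also have "\<dots> \<le> ennreal (2 * (2 * t) ^ (?d + 1)) * Jt (r n) (s n) (F n)"
      using rs elim F by (intro ball_shift_le_Jt) auto
    also have "\<dots> \<le> ennreal (2 * (2 * t) ^ (?d + 1)) * ennreal (M * b)"
      using J[of n] unfolding b_def by (intro mult_left_mono) auto
    also have "\<dots> = ennreal (2 * M * (2 * t) ^ (?d + 1)) * ennreal b"
      using t M b by (simp add: mult_ac flip: ennreal_mult)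
    finally have "ennreal b * ball_shift (F n) t \<le> ennreal b * ennreal (2 * M * (2 * t) ^ (?d + 1))" by (simp only: mult.commute)
    then show ?case using b by (subst (asm) ennreal_mult_le_mult_iff) auto
  qed
qed

section \<open>Compactness\<close>

lemma nn_integral_abs_diff_triangle:
  fixes f g h :: "'a::euclidean_space \<Rightarrow> real"
  assumes [measurable]: "f \<in> borel_measurable borel" "g \<in> borel_measurable borel" "h \<in> borel_measurable borel"
  shows "(\<integral>\<^sup>+x. ennreal \<bar>f x - h x\<bar> \<partial>lborel) \<le> (\<integral>\<^sup>+x. ennreal \<bar>f x - g x\<bar> \<partial>lborel) + (\<integral>\<^sup>+x. ennreal \<bar>g x - h x\<bar> \<partial>lborel)"
proof -
  have "(\<integral>\<^sup>+x. ennreal \<bar>f x - h x\<bar> \<partial>lborel) \<le> (\<integral>\<^sup>+x. ennreal \<bar>f x - g x\<bar> + ennreal \<bar>g x - h x\<bar> \<partial>lborel)"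
    by (intro nn_integral_mono) (auto simp flip: ennreal_plus)
  also have "\<dots> = (\<integral>\<^sup>+x. ennreal \<bar>f x - g x\<bar> \<partial>lborel) + (\<integral>\<^sup>+x. ennreal \<bar>g x - h x\<bar> \<partial>lborel)"
    by (rule nn_integral_add) measurable
  finally show ?thesis .
qed

text \<open>The pointwise part of the Arzela-Ascoli argument: a nearby point of the dense set
  transfers the Cauchy property with an error independent of \<open>n\<close>.\<close>

lemma equilipschitz_convergent:
  fixes f :: "nat \<Rightarrow> 'a::metric_space \<Rightarrow> real"
  assumes lip: "\<And>n x y. dist x y \<le> 1 \<Longrightarrow> \<bar>f n x - f n y\<bar> \<le> K * dist x y"
    and conv: "\<And>x. x \<in> D \<Longrightarrow> convergent (\<lambda>n. f n x)"
    and dense: "\<And>S. open S \<Longrightarrow> S \<noteq> {} \<Longrightarrow> \<exists>d\<in>D. d \<in> S"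
  shows "convergent (\<lambda>n. f n x)"
proof -
  have "Cauchy (\<lambda>n. f n x)"
  proof (rule metric_CauchyI)
    fix e :: real assume e: "e > 0"
    define \<rho> where "\<rho> = min 1 (e / (3 * (\<bar>K\<bar> + 1)))"
    have \<rho>: "\<rho> > 0" "\<rho> \<le> 1" "\<rho> * (\<bar>K\<bar> + 1) \<le> e / 3"
    proof -
      show "\<rho> > 0" "\<rho> \<le> 1" using e by (auto simp: \<rho>_def)
      have "\<rho> * (\<bar>K\<bar> + 1) \<le> e / (3 * (\<bar>K\<bar> + 1)) * (\<bar>K\<bar> + 1)" by (intro mult_right_mono) (auto simp: \<rho>_def)
      also have "\<dots> = e / 3"
      proof -
        have "e / (3 * y) * y = e / 3" if "y \<noteq> 0" for y using that by simp
        moreover have "\<bar>K\<bar> + 1 \<noteq> 0" by linarith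
        ultimately show ?thesis by blast
      qed
      finally show "\<rho> * (\<bar>K\<bar> + 1) \<le> e / 3" .
    qed
    obtain d where d: "d \<in> D" "dist x d < \<rho>"
      using dense[of "ball x \<rho>"] \<rho>(1) by auto
    have close: "\<bar>f n x - f n d\<bar> \<le> e / 3" for n
    proof -
      have "\<bar>f n x - f n d\<bar> \<le> K * dist x d" using d \<rho>(2) by (intro lip) auto
      also have "\<dots> \<le> (\<bar>K\<bar> + 1) * \<rho>" using d by (intro mult_mono) auto
      finally show ?thesis using \<rho>(3) by (simp add: mult.commute)
    qed
    have "Cauchy (\<lambda>n. f n d)" using conv[OF d(1)] convergent_Cauchy by blast
    then obtain N where N: "\<And>m n. m \<ge> N \<Longrightarrow> n \<ge> N \<Longrightarrow> dist (f m d) (f n d) < e / 3"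
      using metric_CauchyD[of "\<lambda>n. f n d" "e / 3"] e by auto
    show "\<exists>N. \<forall>m\<ge>N. \<forall>n\<ge>N. dist (f m x) (f n x) < e"
    proof (intro exI allI impI)
      fix m n assume "m \<ge> N" "n \<ge> N"
      then show "dist (f m x) (f n x) < e"
        using N[of m n] close[of m] close[of n] unfolding dist_real_def by linarith
    qed
  qed
  then show ?thesis by (simp add: Cauchy_convergent)
qed

context mollifier
begin

text \<open>Bounding the weight by its maximum on its support turns the average of the translation
  differences into \<open>ball_shift\<close>, the quantity that the energy controls.\<close>

lemma nn_integral_conv_diff_le_ball_shift:
  assumes [measurable]: "F \<in> sets borel" and b: "\<And>z. \<eta> z \<le> b"
  shows "(\<integral>\<^sup>+x. ennreal \<bar>conv (indicator F) \<eta> x - indicator F x\<bar> \<partial>lborel) \<le> ennreal b * ball_shift F \<epsilon>"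
proof -
  have "(\<integral>\<^sup>+x. ennreal \<bar>conv (indicator F) \<eta> x - indicator F x\<bar> \<partial>lborel) \<le> (\<integral>\<^sup>+z. ennreal (\<eta> z) * L1_shift (indicator F) (- z) \<partial>lborel)"
    by (rule nn_integral_conv_diff_le[where C=1]) (auto simp: indicator_def)
  also have "\<dots> \<le> (\<integral>\<^sup>+z. ennreal b * (indicator (cball 0 \<epsilon>) (- z) * L1_shift (indicator F) (- z)) \<partial>lborel)"
  proof (rule nn_integral_mono)
    fix z
    show "ennreal (\<eta> z) * L1_shift (indicator F) (- z) \<le> ennreal b * (indicator (cball 0 \<epsilon>) (- z) * L1_shift (indicator F) (- z))"
      using b[of z] supp(1)[of z] by (cases "norm z \<le> \<epsilon>") (auto intro: mult_right_mono ennreal_leI)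
  qed
  also have "\<dots> = ennreal b * (\<integral>\<^sup>+z. indicator (cball 0 \<epsilon>) (- z) * L1_shift (indicator F) (- z) \<partial>lborel)"
    by (rule nn_integral_cmult) measurable
  also have "(\<integral>\<^sup>+z. indicator (cball 0 \<epsilon>) (- z) * L1_shift (indicator F) (- z) \<partial>lborel) = ball_shift F \<epsilon>"
    unfolding ball_shift_def
    by (rule nn_integral_lborel_uminus[where f="\<lambda>z. indicator (cball 0 \<epsilon>) z * L1_shift (indicator F) z"]) measurable
  finally show ?thesis .
qed

lemma abs_conv_indicator_le:
  assumes [measurable]: "F \<in> sets borel"
  shows "\<bar>conv (indicator F) \<eta> x\<bar> \<le> 1"
proof -
  have "ennreal \<bar>conv (indicator F) \<eta> x\<bar> \<le> (\<integral>\<^sup>+y. ennreal (norm (indicator F y * \<eta> (x - y))) \<partial>lborel)"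
    unfolding conv_def using ennreal_norm_integral_le[of lborel "\<lambda>y. indicator F y * \<eta> (x - y)"] by simp
  also have "\<dots> \<le> (\<integral>\<^sup>+y. ennreal (\<eta> (x - y)) \<partial>lborel)"
    using nonneg by (intro nn_integral_mono ennreal_leI) (auto simp: indicator_def)
  also have "\<dots> = 1"
    using nn_integral_lborel_reflect[of "\<lambda>y. ennreal (\<eta> y)" x] total by simp
  finally show ?thesis by simp
qed

lemma conv_indicator_support:
  assumes "F \<subseteq> cball 0 R" "norm x > R + \<epsilon>"
  shows "conv (indicator F) \<eta> x = 0"
proof -
  have "indicator F y * \<eta> (x - y) = 0" for y
  proof (cases "y \<in> F")
    case True
    then have "norm y \<le> R" using assms by auto
    then have "norm (x - y) \<ge> \<epsilon>" using assms(2) norm_triangle_ineq2[of x y] by linarith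
    then show ?thesis by (simp add: supp)
  qed simp
  then show ?thesis unfolding conv_def by (simp only: integral_zero)
qed

text \<open>For increments of length at most 1 the kernel has Lipschitz constant
  \<open>L + B\<close>, and only points of \<open>cball 0 R\<close> contribute. The constant is
  therefore the same for all sets in this ball.\<close>

lemma conv_indicator_equilipschitz:
  obtains K where "\<And>F x y. F \<in> sets borel \<Longrightarrow> F \<subseteq> cball 0 R \<Longrightarrow> dist x y \<le> 1 \<Longrightarrow>
     \<bar>conv (indicator F) \<eta> x - conv (indicator F) \<eta> y\<bar> \<le> K * dist x y"
proof -
  obtain B where B: "B \<ge> 0" "\<And>z. \<bar>\<eta> z\<bar> \<le> B" "\<And>z. norm (G z) \<le> B" using bounded_kernel by metis
  define V where "V = measure lborel (cball (0::'a) R)"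
  show ?thesis
  proof (rule that[of "(L + B) * V"])
    fix F :: "'a set" and x y :: 'a
    assume F[measurable]: "F \<in> sets borel" and FR: "F \<subseteq> cball 0 R" and xy: "dist x y \<le> 1"
    define h where "h = x - y"
    have h: "norm h \<le> 1" "x = y + h" "dist x y = norm h" using xy by (auto simp: h_def dist_norm)
    have le: "\<bar>\<eta> (z + h) - \<eta> z\<bar> \<le> (L + B) * norm h" for z
    proof -
      have "\<bar>\<eta> (z + h) - \<eta> z\<bar> \<le> L * (norm h)\<^sup>2 + \<bar>G z \<bullet> h\<bar>" using taylor[OF h(1), of z] by linarith
      also have "\<dots> \<le> L * norm h + B * norm h"
      proof (intro add_mono)
        have "(norm h)\<^sup>2 \<le> norm h" using h(1) by (simp add: power2_eq_square mult_left_le_one_le)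
        then show "L * (norm h)\<^sup>2 \<le> L * norm h" using L_nonneg by (rule mult_left_mono)
        show "\<bar>G z \<bullet> h\<bar> \<le> B * norm h"
          using B(3)[of z] by (intro order_trans[OF Cauchy_Schwarz_ineq2] mult_right_mono) auto
      qed
      finally show ?thesis by (simp add: algebra_simps)
    qed
    have i: "integrable lborel (\<lambda>z. indicator F z * \<eta> (a - z))" for a
      by (rule integrable_shift_eta[where C=1]) (auto simp: indicator_def)
    have iV: "integrable lborel (\<lambda>z. ((L + B) * norm h) * indicator (cball (0::'a) R) z)"
      by (intro integrable_mult_right integrable_real_indicator emeasure_lborel_cball_finite) auto
    have "conv (indicator F) \<eta> x - conv (indicator F) \<eta> y = (\<integral>z. indicator F z * \<eta> (x - z) - indicator F z * \<eta> (y - z) \<partial>lborel)"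
      unfolding conv_def using i by simp
    then have "\<bar>conv (indicator F) \<eta> x - conv (indicator F) \<eta> y\<bar> \<le> (\<integral>z. norm (indicator F z * \<eta> (x - z) - indicator F z * \<eta> (y - z)) \<partial>lborel)"
      using integral_norm_bound[of lborel "\<lambda>z. indicator F z * \<eta> (x - z) - indicator F z * \<eta> (y - z)"] by simp
    also have "\<dots> \<le> (\<integral>z. ((L + B) * norm h) * indicator (cball (0::'a) R) z \<partial>lborel)"
    proof (rule integral_mono[OF _ iV])
      show "integrable lborel (\<lambda>z. norm (indicator F z * \<eta> (x - z) - indicator F z * \<eta> (y - z)))"
        using i by (intro integrable_norm Bochner_Integration.integrable_diff)
      fix z
      show "norm (indicator F z * \<eta> (x - z) - indicator F z * \<eta> (y - z)) \<le> ((L + B) * norm h) * indicator (cball (0::'a) R) z"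
      proof (cases "z \<in> F")
        case True
        have "x - z = (y - z) + h" by (simp add: h_def)
        then have "\<bar>\<eta> (x - z) - \<eta> (y - z)\<bar> \<le> (L + B) * norm h" using le[of "y - z"] by (simp only:)
        moreover have "z \<in> cball 0 R" using True FR by blast
        ultimately show ?thesis using True by (simp del: mem_cball)
      next
        case False
        then show ?thesis using L_nonneg B(1) by (simp add: indicator_def)
      qed
    qed
    also have "\<dots> = (L + B) * V * dist x y" by (simp add: V_def h(3))
    finally show "\<bar>conv (indicator F) \<eta> x - conv (indicator F) \<eta> y\<bar> \<le> (L + B) * V * dist x y" .
  qed
qed

end

section \<open>Extraction of convergent subsequences\<close>

text \<open>A subsequence is Cauchy almost everywhere, and a Cauchy sequence with values 0 and 1 is
  eventually constant. The limit is therefore again an indicator, and the common bounded support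
  gives dominated convergence.\<close>

lemma L1_limit_of_uniformly_bounded_sets:
  fixes F :: "nat \<Rightarrow> 'a::euclidean_space set"
  assumes F[measurable]: "\<And>n. F n \<in> sets borel" and FR: "\<And>n. F n \<subseteq> cball 0 R"
    and cauchy: "\<And>e. e > 0 \<Longrightarrow> \<exists>N. \<forall>i\<ge>N. \<forall>j\<ge>N. (\<integral>\<^sup>+x. ennreal \<bar>indicator (F i) x - indicator (F j) x\<bar> \<partial>lborel) < ennreal e"
  obtains g E where "strict_mono (g :: nat \<Rightarrow> nat)" "E \<in> sets borel" "E \<subseteq> cball 0 R"
    "(\<lambda>n. \<integral>\<^sup>+x. ennreal \<bar>indicator (F (g n)) x - indicator E x\<bar> \<partial>lborel) \<longlonglongrightarrow> 0"
proof -
  define ind :: "nat \<Rightarrow> 'a \<Rightarrow> real" where "ind n = indicator (F n)" for n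
  have indm[measurable]: "ind n \<in> borel_measurable borel" for n unfolding ind_def by measurable
  have indR: "norm (ind n x) \<le> indicator (cball 0 R) x" for n x
    using FR[of n] by (auto simp: ind_def indicator_def)
  have int: "integrable lborel (ind n)" for n
    by (rule integrable_bounded_support[where a=0 and R=R and B=1])
      (use FR[of n] in \<open>auto simp: ind_def indicator_def\<close>)
  obtain g where g: "strict_mono (g :: nat \<Rightarrow> nat)" "AE x in lborel. Cauchy (\<lambda>i. ind (g i) x)"
  proof (rule cauchy_L1_AE_cauchy_subseq[of lborel ind])
    show "integrable lborel (ind n)" for n by (rule int)
    fix e :: real assume "e > 0"
    then obtain N where N: "\<And>i j. i \<ge> N \<Longrightarrow> j \<ge> N \<Longrightarrow> (\<integral>\<^sup>+x. ennreal \<bar>ind i x - ind j x\<bar> \<partial>lborel) < ennreal e"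
      using cauchy unfolding ind_def by blast
    have "(LINT x|lborel. norm (ind i x - ind j x)) < e" if "i \<ge> N" "j \<ge> N" for i j
    proof -
      have "ennreal (LINT x|lborel. norm (ind i x - ind j x)) = (\<integral>\<^sup>+x. ennreal \<bar>ind i x - ind j x\<bar> \<partial>lborel)"
        using int by (subst nn_integral_eq_integral[symmetric]) auto
      also have "\<dots> < ennreal e" by (rule N[OF that])
      finally show ?thesis by (subst (asm) ennreal_less_iff) auto
    qed
    then show "\<exists>N. \<forall>i\<ge>N. \<forall>j\<ge>N. (LINT x|lborel. norm (ind i x - ind j x)) < e" by blast
  qed
  \<comment> \<open>The set-theoretic lower limit: a Borel set containing exactly the points whose
    indicators are eventually 1.\<close>
  define E where "E = (\<Union>N. \<Inter>i\<in>{N..}. F (g i))"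
  have E[measurable]: "E \<in> sets borel" unfolding E_def by measurable
  have "(\<lambda>i. ind (g i) x) \<longlonglongrightarrow> indicator E x" if C: "Cauchy (\<lambda>i. ind (g i) x)" for x
  proof -
    obtain N where N: "\<And>i j. i \<ge> N \<Longrightarrow> j \<ge> N \<Longrightarrow> dist (ind (g i) x) (ind (g j) x) < 1"
      using metric_CauchyD[OF C, of 1] by auto
    then have same: "x \<in> F (g i) \<longleftrightarrow> x \<in> F (g N)" if "i \<ge> N" for i
      using N[OF that order_refl] by (auto simp: ind_def indicator_def dist_real_def split: if_splits)
    have "x \<in> E \<longleftrightarrow> x \<in> F (g N)"
    proof
      assume "x \<in> E"
      then obtain N' where "\<And>i. i \<ge> N' \<Longrightarrow> x \<in> F (g i)" unfolding E_def by blast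
      then have "x \<in> F (g (max N N'))" by simp
      then show "x \<in> F (g N)" using same[of "max N N'"] by simp
    next
      assume "x \<in> F (g N)"
      then show "x \<in> E" unfolding E_def using same by blast
    qed
    then have "ind (g i) x = indicator E x" if "i \<ge> N" for i
      using same[OF that] by (simp add: ind_def indicator_def)
    then have "eventually (\<lambda>i. ind (g i) x = indicator E x) sequentially"
      unfolding eventually_sequentially by blast
    then show ?thesis by (rule tendsto_eventually)
  qed
  then have AE: "AE x in lborel. (\<lambda>i. ind (g i) x) \<longlonglongrightarrow> indicator E x"
    using g(2) by (auto elim: eventually_mono)
  have "(\<lambda>i. \<integral>\<^sup>+x. ennreal (norm (indicator E x - ind (g i) x)) \<partial>lborel) \<longlonglongrightarrow> 0"
  proof (rule nn_integral_dominated_convergence_norm[where w="\<lambda>x. indicator (cball 0 R) x"])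
    show "AE x in lborel. norm (ind (g j) x) \<le> indicator (cball 0 R) x" for j using indR by simp
    have "(\<integral>\<^sup>+x. ennreal (indicator (cball (0::'a) R) x) \<partial>lborel) = emeasure lborel (cball (0::'a) R)"
      by (simp add: ennreal_indicator)
    then show "(\<integral>\<^sup>+x. ennreal (indicator (cball (0::'a) R) x) \<partial>lborel) < \<infinity>"
      using emeasure_lborel_cball_finite[of "0::'a" R] by simp
  qed (use AE in auto)
  then have "(\<lambda>n. \<integral>\<^sup>+x. ennreal \<bar>indicator (F (g n)) x - indicator E x\<bar> \<partial>lborel) \<longlonglongrightarrow> 0"
    by (simp add: ind_def abs_minus_commute)
  moreover have "E \<subseteq> cball 0 R"
  proof
    fix x assume "x \<in> E"
    then obtain N where "x \<in> F (g N)" unfolding E_def by blast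
    then show "x \<in> cball 0 R" using FR by blast
  qed
  ultimately show ?thesis using that[OF g(1) E] by blast
qed

text \<open>For each \<open>k\<close> there is one fixed kernel whose mollifications are eventually
  \<open>1 / (k + 1)\<close>-close to the sets. Along a single subsequence all these mollifications
  converge, so the sets form a Cauchy sequence in \<open>L1\<close>.\<close>

lemma energy_bounded_precompact:
  fixes F :: "nat \<Rightarrow> 'a::euclidean_space set"
  assumes F[measurable]: "\<And>n. F n \<in> sets borel" and FR: "\<And>n. F n \<subseteq> cball 0 R"
    and J: "\<And>n. Jt (r n) (s n) (F n) \<le> ennreal (M * beta DIM('a) (r n) (s n))" and M: "M \<ge> 0"
    and r01: "\<forall>n. 0 < r n \<and> r n < 1" and s1: "\<forall>n. 1 < s n" and rlim: "r \<longlonglongrightarrow> 0" and slim: "s \<longlonglongrightarrow> 1"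
  obtains g E where "strict_mono (g :: nat \<Rightarrow> nat)" "E \<in> sets borel" "E \<subseteq> cball 0 R"
    "(\<lambda>n. \<integral>\<^sup>+x. ennreal \<bar>indicator (F (g n)) x - indicator E x\<bar> \<partial>lborel) \<longlonglongrightarrow> 0"
proof -
  let ?d = "DIM('a)"
  let ?diff = "\<lambda>\<eta> n. (\<integral>\<^sup>+x. ennreal \<bar>conv (indicator (F n)) \<eta> x - indicator (F n) x\<bar> \<partial>lborel)"
  define P where "P k \<eta> \<longleftrightarrow> (\<exists>G \<epsilon> L. \<epsilon> \<le> 1 \<and> mollifier \<eta> G \<epsilon> L) \<and> eventually (\<lambda>n. ?diff \<eta> n \<le> ennreal (1 / real (Suc k))) sequentially"
    for k and \<eta> :: "'a \<Rightarrow> real"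
  have "\<exists>\<eta>. P k \<eta>" for k
  proof -
    define v where "v = unit_ball_vol (real ?d)"
    have v: "v > 0" by (simp add: v_def)
    \<comment> \<open>The product of the maximum of the kernel, \<open>2 * 2 ^ d\<close> over
      \<open>v * \<epsilon> ^ d\<close>, with the energy bound
      \<open>2 * M * (2 * \<epsilon>) ^ (d + 1)\<close> is \<open>K * \<epsilon>\<close>, of first
      order in the scale.\<close>
    define K where "K = 8 * M * 2 ^ ?d * 2 ^ ?d / v"
    have K: "K \<ge> 0" using M v by (simp add: K_def)
    define \<epsilon> where "\<epsilon> = min (1 / 2) (1 / (real (Suc k) * (K + 1)))"
    have \<epsilon>: "\<epsilon> > 0" "\<epsilon> < 1" using K by (auto simp: \<epsilon>_def intro!: divide_pos_pos mult_pos_pos)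
    have K\<epsilon>: "K * \<epsilon> \<le> 1 / real (Suc k)"
    proof -
      have "K * \<epsilon> \<le> (K + 1) * (1 / (real (Suc k) * (K + 1)))"
        using K \<epsilon> by (intro mult_mono) (auto simp: \<epsilon>_def)
      then show ?thesis using K by (simp del: of_nat_Suc)
    qed
    obtain \<eta> :: "'a \<Rightarrow> real" and G L where m: "mollifier \<eta> G \<epsilon> L"
      and b: "\<And>z. \<eta> z \<le> 2 / measure lborel (cball (0::'a) (\<epsilon> / 2))"
      using mollifier_exists[OF \<epsilon>(1)] by metis
    interpret mollifier \<eta> G \<epsilon> L by (rule m)
    define c where "c = 2 / measure lborel (cball (0::'a) (\<epsilon> / 2))"
    have c: "c = 2 / (v * (\<epsilon> / 2) ^ ?d)"
      unfolding c_def v_def using \<epsilon> by (subst content_cball) auto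
    have c0: "c \<ge> 0" by (simp add: c_def)
    have cK: "c * (2 * M * (2 * \<epsilon>) ^ (?d + 1)) = K * \<epsilon>"
      using \<epsilon> v by (simp add: c K_def power_mult_distrib power_divide field_simps)
    have "eventually (\<lambda>n. ball_shift (F n) \<epsilon> \<le> ennreal (2 * M * (2 * \<epsilon>) ^ (?d + 1))) sequentially"
      by (rule ball_shift_eventually_le[OF F J M r01 s1 rlim slim \<epsilon>])
    then have "eventually (\<lambda>n. ?diff \<eta> n \<le> ennreal (1 / real (Suc k))) sequentially"
    proof eventually_elim
      case (elim n)
      have "?diff \<eta> n \<le> ennreal c * ball_shift (F n) \<epsilon>"
        unfolding c_def by (rule nn_integral_conv_diff_le_ball_shift[OF F b])
      also have "\<dots> \<le> ennreal c * ennreal (2 * M * (2 * \<epsilon>) ^ (?d + 1))" using elim by (rule mult_left_mono) simp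
      also have "\<dots> = ennreal (K * \<epsilon>)" unfolding cK[symmetric] using c0 by (simp add: ennreal_mult')
      also have "\<dots> \<le> ennreal (1 / real (Suc k))" using K\<epsilon> by (rule ennreal_leI)
      finally show ?case .
    qed
    then have "P k \<eta>" unfolding P_def using m \<epsilon>(2) less_imp_le by blast
    then show ?thesis by blast
  qed
  then obtain H where "\<And>k. P k (H k)" by metis
  then have H: "\<And>k. \<exists>G \<epsilon> L. \<epsilon> \<le> 1 \<and> mollifier (H k) G \<epsilon> L"
      "\<And>k. eventually (\<lambda>n. ?diff (H k) n \<le> ennreal (1 / real (Suc k))) sequentially"
    unfolding P_def by blast+
  define u where "u k n = conv (indicator (F n)) (H k)" for k n
  have u_props: "u k n \<in> borel_measurable borel" "\<bar>u k n x\<bar> \<le> 1" "norm x > R + 1 \<Longrightarrow> u k n x = 0" for k n x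
  proof -
    obtain G \<epsilon> L where "\<epsilon> \<le> 1" "mollifier (H k) G \<epsilon> L" using H(1) by blast
    then interpret mollifier "H k" G \<epsilon> L by simp
    show "u k n \<in> borel_measurable borel" unfolding u_def by measurable
    show "\<bar>u k n x\<bar> \<le> 1" unfolding u_def by (rule abs_conv_indicator_le[OF F])
    show "u k n x = 0" if "norm x > R + 1"
      unfolding u_def by (rule conv_indicator_support[OF FR]) (use that \<open>\<epsilon> \<le> 1\<close> in linarith)
  qed
  note u_meas[measurable] = u_props(1)
  have lip: "\<exists>K. \<forall>n x y. dist x y \<le> 1 \<longrightarrow> \<bar>u k n x - u k n y\<bar> \<le> K * dist x y" for k
  proof -
    obtain G \<epsilon> L where "mollifier (H k) G \<epsilon> L" using H(1) by blast
    then interpret mollifier "H k" G \<epsilon> L .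
    obtain K where "\<And>F x y. F \<in> sets borel \<Longrightarrow> F \<subseteq> cball 0 R \<Longrightarrow> dist x y \<le> 1 \<Longrightarrow>
       \<bar>conv (indicator F) (H k) x - conv (indicator F) (H k) y\<bar> \<le> K * dist x y"
      using conv_indicator_equilipschitz[of R] by blast
    then show ?thesis unfolding u_def using F FR by blast
  qed
  obtain D :: "'a set" where D: "countable D" "\<And>S. open S \<Longrightarrow> S \<noteq> {} \<Longrightarrow> \<exists>d\<in>D. d \<in> S"
    by (rule countable_dense_setE) blast
  \<comment> \<open>Indexing by pairs of a kernel number and a dense point makes one diagonal
    subsequence serve all kernels simultaneously.\<close>
  obtain g where g: "strict_mono (g :: nat \<Rightarrow> nat)"
     "\<And>p. p \<in> (UNIV :: nat set) \<times> D \<Longrightarrow> \<exists>l. (\<lambda>n. u (fst p) (g n) (snd p)) \<longlonglongrightarrow> l"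
    using function_convergent_subsequence[of "(UNIV :: nat set) \<times> D" "\<lambda>n p. u (fst p) n (snd p)" 1] D(1) u_props(2)
    by (metis countable_SIGMA countableI_type real_norm_def)
  have conv: "convergent (\<lambda>n. u k (g n) x)" for k x
  proof -
    obtain K where K: "\<And>n x y. dist x y \<le> 1 \<Longrightarrow> \<bar>u k n x - u k n y\<bar> \<le> K * dist x y" using lip[of k] by blast
    show ?thesis
    proof (rule equilipschitz_convergent[where f="\<lambda>n. u k (g n)", OF _ _ D(2)])
      show "convergent (\<lambda>n. u k (g n) x)" if "x \<in> D" for x
        using g(2)[of "(k, x)"] that by (auto simp: convergent_def)
    qed (rule K)
  qed
  define U where "U k x = lim (\<lambda>n. u k (g n) x)" for k x
  have Ulim: "(\<lambda>n. u k (g n) x) \<longlonglongrightarrow> U k x" for k x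
    unfolding U_def using conv[of k x] by (simp add: convergent_LIMSEQ_iff)
  have Um[measurable]: "U k \<in> borel_measurable borel" for k
    by (rule borel_measurable_LIMSEQ_real[OF Ulim]) measurable
  have L1: "(\<lambda>n. \<integral>\<^sup>+x. ennreal (norm (U k x - u k (g n) x)) \<partial>lborel) \<longlonglongrightarrow> 0" for k
  proof (rule nn_integral_dominated_convergence_norm[where w="\<lambda>x. indicator (cball 0 (R + 1)) x"])
    show "AE x in lborel. norm (u k (g j) x) \<le> indicator (cball 0 (R + 1)) x" for j
      using u_props(2,3) by (intro AE_I2) (auto simp: indicator_def)
    have "(\<integral>\<^sup>+x. ennreal (indicator (cball (0::'a) (R + 1)) x) \<partial>lborel) = emeasure lborel (cball (0::'a) (R + 1))"
      by (simp add: ennreal_indicator)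
    then show "(\<integral>\<^sup>+x. ennreal (indicator (cball (0::'a) (R + 1)) x) \<partial>lborel) < \<infinity>"
      using emeasure_lborel_cball_finite[of "0::'a" "R + 1"] by simp
  qed (use Ulim in auto)
  have cauchy: "\<exists>N. \<forall>i\<ge>N. \<forall>j\<ge>N. (\<integral>\<^sup>+x. ennreal \<bar>indicator (F (g i)) x - indicator (F (g j)) x\<bar> \<partial>lborel) < ennreal e"
    if e: "e > 0" for e :: real
  proof -
    \<comment> \<open>One quarter is for the mollification error and one for the distance of the
      mollification from its limit \<open>U k\<close>; both occur once for each of the two
      indices.\<close>
    obtain k where k: "1 / real (Suc k) < e / 4"
      using e by (metis nat_approx_posE zero_less_divide_iff zero_less_numeral)
    have "eventually (\<lambda>n. ?diff (H k) (g n) \<le> ennreal (1 / real (Suc k))) sequentially"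
      by (rule eventually_subseq[OF g(1) H(2)])
    moreover have "eventually (\<lambda>n. (\<integral>\<^sup>+x. ennreal (norm (U k x - u k (g n) x)) \<partial>lborel) < ennreal (e / 4)) sequentially"
      using e by (intro order_tendstoD(2)[OF L1]) auto
    ultimately have "eventually (\<lambda>n. (\<integral>\<^sup>+x. ennreal \<bar>U k x - indicator (F (g n)) x\<bar> \<partial>lborel) < ennreal (e / 2)) sequentially"
    proof eventually_elim
      case (elim n)
      have "(\<integral>\<^sup>+x. ennreal \<bar>U k x - indicator (F (g n)) x\<bar> \<partial>lborel) \<le> (\<integral>\<^sup>+x. ennreal \<bar>U k x - u k (g n) x\<bar> \<partial>lborel) + (\<integral>\<^sup>+x. ennreal \<bar>u k (g n) x - indicator (F (g n)) x\<bar> \<partial>lborel)"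
        by (rule nn_integral_abs_diff_triangle) measurable
      also have "\<dots> < ennreal (e / 4) + ennreal (e / 4)"
      proof (rule add_strict_mono)
        show "(\<integral>\<^sup>+x. ennreal \<bar>U k x - u k (g n) x\<bar> \<partial>lborel) < ennreal (e / 4)"
          using elim(2) by (simp only: real_norm_def)
        have "ennreal (1 / real (Suc k)) < ennreal (e / 4)" using k e by (intro ennreal_lessI) auto
        with elim(1) show "(\<integral>\<^sup>+x. ennreal \<bar>u k (g n) x - indicator (F (g n)) x\<bar> \<partial>lborel) < ennreal (e / 4)"
          unfolding u_def by (rule le_less_trans)
      qed
      also have "\<dots> = ennreal (e / 2)" using e by (simp flip: ennreal_plus)
      finally show ?case .
    qed
    then obtain N where N: "\<And>n. n \<ge> N \<Longrightarrow> (\<integral>\<^sup>+x. ennreal \<bar>U k x - indicator (F (g n)) x\<bar> \<partial>lborel) < ennreal (e / 2)"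
      by (auto simp: eventually_sequentially)
    have "(\<integral>\<^sup>+x. ennreal \<bar>indicator (F (g i)) x - indicator (F (g j)) x\<bar> \<partial>lborel) < ennreal e" if "i \<ge> N" "j \<ge> N" for i j
    proof -
      have "(\<integral>\<^sup>+x. ennreal \<bar>indicator (F (g i)) x - indicator (F (g j)) x\<bar> \<partial>lborel)
         \<le> (\<integral>\<^sup>+x. ennreal \<bar>indicator (F (g i)) x - U k x\<bar> \<partial>lborel) + (\<integral>\<^sup>+x. ennreal \<bar>U k x - indicator (F (g j)) x\<bar> \<partial>lborel)"
        by (rule nn_integral_abs_diff_triangle) measurable
      also have "\<dots> < ennreal (e / 2) + ennreal (e / 2)"
        using N[OF that(1)] N[OF that(2)] by (intro add_strict_mono) (simp_all add: abs_minus_commute)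
      also have "\<dots> = ennreal e" using e by (simp flip: ennreal_plus)
      finally show ?thesis .
    qed
    then show ?thesis by blast
  qed
  obtain h E where "strict_mono (h :: nat \<Rightarrow> nat)" "E \<in> sets borel" "E \<subseteq> cball 0 R"
    "(\<lambda>n. \<integral>\<^sup>+x. ennreal \<bar>indicator (F (g (h n))) x - indicator E x\<bar> \<partial>lborel) \<longlonglongrightarrow> 0"
    using L1_limit_of_uniformly_bounded_sets[where F="\<lambda>n. F (g n)" and R=R, OF F FR cauchy] by blast
  then show ?thesis
    using that[of "g \<circ> h" E] g(1) by (auto simp: strict_mono_o)
qed

section \<open>Gamma-convergence\<close>

lemma Gamma_liminf:
  fixes E :: "'a::euclidean_space set"
  assumes E: "E \<in> sets lebesgue" "emeasure lebesgue E < \<infinity>"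
    and F: "\<And>n. F n \<in> sets lebesgue" "\<And>n. emeasure lebesgue (F n) < \<infinity>" and L: "L1_conv F E"
    and r01: "\<forall>n. 0 < r n \<and> r n < 1" and s1: "\<forall>n. 1 < s n" and rlim: "r \<longlonglongrightarrow> 0" and slim: "s \<longlonglongrightarrow> 1"
  shows "ennreal (unit_ball_vol (real (DIM('a) - 1))) * Per E
    \<le> liminf (\<lambda>n. Jt (r n) (s n) (F n) / ennreal (beta DIM('a) (r n) (s n)))"
proof -
  obtain E' where E': "E' \<in> sets borel" "E' \<subseteq> E" "AE x in lborel. x \<in> E \<longleftrightarrow> x \<in> E'"
    using borel_representative[OF E(1)] by blast
  have "\<forall>n. \<exists>F'. F' \<in> sets borel \<and> F' \<subseteq> F n \<and> (AE x in lborel. x \<in> F n \<longleftrightarrow> x \<in> F')"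
    using borel_representative[OF F(1)] by metis
  then obtain F' where F': "\<And>n. F' n \<in> sets borel" "\<And>n. F' n \<subseteq> F n" "\<And>n. AE x in lborel. x \<in> F n \<longleftrightarrow> x \<in> F' n"
    by metis
  have fE: "emeasure lborel E' < \<infinity>"
    using emeasure_mono[OF E'(2) E(1)] E(2) E'(1) by (simp add: le_less_trans)
  have fF: "emeasure lborel (F' n) < \<infinity>" for n
    using emeasure_mono[OF F'(2) F(1), of n] F(2)[of n] F'(1)[of n] by (simp add: le_less_trans)
  have "(\<lambda>n. \<integral>\<^sup>+x. ennreal \<bar>indicator (F' n) x - indicator E' x\<bar> \<partial>lborel) \<longlonglongrightarrow> 0"
    using L unfolding L1_conv_def nn_integral_completion
    by (simp only: nn_integral_indicator_diff_cong_AE[OF E'(3) F'(3)])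
  from liminf_Jt_ge_Per[OF E'(1) F'(1) fE fF this r01 s1 rlim slim]
  have "ennreal (unit_ball_vol (real (DIM('a) - 1))) * Per E'
    \<le> liminf (\<lambda>n. Jt (r n) (s n) (F' n) / ennreal (beta DIM('a) (r n) (s n)))" .
  moreover have "Per E = Per E'" using E E' by (intro Per_cong_AE) auto
  ultimately show ?thesis by (simp only: Jt_cong_AE[OF F'(3)])
qed

theorem theorem5p1:
  fixes r s :: "nat \<Rightarrow> real"
  assumes dim: "DIM('a::euclidean_space) \<ge> 2"
    and r01: "\<forall>n. 0 < r n \<and> r n < 1" and s1: "\<forall>n. 1 < s n"
    and rlim: "r \<longlonglongrightarrow> 0" and slim: "s \<longlonglongrightarrow> 1"
  shows
   "(\<forall>(U::'a set) (M::real) (F::nat \<Rightarrow> 'a set).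
       open U \<and> bounded U \<and>
       (\<forall>n. F n \<in> sets lebesgue \<and> F n \<subseteq> U \<and>
            Jt (r n) (s n) (F n) \<le> ennreal (M * beta DIM('a) (r n) (s n)))
       \<longrightarrow> (\<exists>g E. strict_mono g \<and> E \<in> sets lebesgue \<and> emeasure lebesgue E < \<infinity>
                 \<and> Per E < \<infinity> \<and> L1_conv (F \<circ> g) E))
  \<and> (\<forall>(E::'a set) (F::nat \<Rightarrow> 'a set).
       E \<in> sets lebesgue \<and> emeasure lebesgue E < \<infinity> \<and>
       (\<forall>n. F n \<in> sets lebesgue \<and> emeasure lebesgue (F n) < \<infinity>) \<and> L1_conv F E
       \<longrightarrow> ennreal (unit_ball_vol (real (DIM('a) - 1))) * Per E
           \<le> liminf (\<lambda>n. Jt (r n) (s n) (F n) / ennreal (beta DIM('a) (r n) (s n))))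
  \<and> (\<forall>(E::'a set). E \<in> sets lebesgue \<and> emeasure lebesgue E < \<infinity>
       \<longrightarrow> (\<exists>F::nat \<Rightarrow> 'a set.
             (\<forall>n. F n \<in> sets lebesgue \<and> emeasure lebesgue (F n) < \<infinity>) \<and> L1_conv F E \<and>
             ennreal (unit_ball_vol (real (DIM('a) - 1))) * Per E
               = limsup (\<lambda>n. Jt (r n) (s n) (F n) / ennreal (beta DIM('a) (r n) (s n)))))"
proof (intro conjI allI impI)
  fix U :: "'a set" and M :: real and F :: "nat \<Rightarrow> 'a set"
  assume "open U \<and> bounded U \<and> (\<forall>n. F n \<in> sets lebesgue \<and> F n \<subseteq> U \<and>
            Jt (r n) (s n) (F n) \<le> ennreal (M * beta DIM('a) (r n) (s n)))"
  then have U: "bounded U" and F: "\<And>n. F n \<in> sets lebesgue" "\<And>n. F n \<subseteq> U"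
      "\<And>n. Jt (r n) (s n) (F n) \<le> ennreal (M * beta DIM('a) (r n) (s n))" by auto
  \<comment> \<open>A negative \<open>M\<close> makes the \<open>ennreal\<close> bound 0, so the
    assumption also holds with the nonnegative constant.\<close>
  define M' where "M' = max M 0"
  have bpos: "beta DIM('a) (r n) (s n) > 0" for n using r01 s1 beta_pos by blast
  have J: "Jt (r n) (s n) (F n) \<le> ennreal (M' * beta DIM('a) (r n) (s n))" for n
    using F(3)[of n] bpos[of n] by (auto simp: M'_def intro!: order_trans[OF F(3)] ennreal_leI mult_right_mono)
  obtain R where R: "U \<subseteq> cball 0 R" using U by (auto simp: bounded_iff subset_eq)
  have "\<forall>n. \<exists>F'. F' \<in> sets borel \<and> F' \<subseteq> F n \<and> (AE x in lborel. x \<in> F n \<longleftrightarrow> x \<in> F')"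
    using borel_representative[OF F(1)] by metis
  then obtain F' where F': "\<And>n. F' n \<in> sets borel" "\<And>n. F' n \<subseteq> F n" "\<And>n. AE x in lborel. x \<in> F n \<longleftrightarrow> x \<in> F' n"
    by metis
  have F'R: "F' n \<subseteq> cball 0 R" for n using F' F R by blast
  have J': "Jt (r n) (s n) (F' n) \<le> ennreal (M' * beta DIM('a) (r n) (s n))" for n
    using J[of n] Jt_cong_AE[OF F'(3)] by metis
  obtain g E where g: "strict_mono (g :: nat \<Rightarrow> nat)" and E: "E \<in> sets borel" "E \<subseteq> cball 0 R"
    and L: "(\<lambda>n. \<integral>\<^sup>+x. ennreal \<bar>indicator (F' (g n)) x - indicator E x\<bar> \<partial>lborel) \<longlonglongrightarrow> 0"
    by (rule energy_bounded_precompact[OF F'(1) F'R J' _ r01 s1 rlim slim]) (auto simp: M'_def)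
  have fin: "emeasure lborel S < \<infinity>" if "S \<subseteq> cball 0 R" for S :: "'a set"
    using emeasure_mono[OF that, of lborel] emeasure_lborel_cball_finite[of "0::'a" R] by (simp add: le_less_trans)
  have conv: "L1_conv (F \<circ> g) E"
    using L unfolding L1_conv_def nn_integral_completion comp_def
    by (simp only: nn_integral_indicator_diff_cong_AE[OF AE_I2[OF refl] F'(3)])
  define w where "w = unit_ball_vol (real (DIM('a) - 1))"
  have w: "w > 0" by (simp add: w_def)
  \<comment> \<open>The perimeter of the limit is finite by the lower bound along the subsequence,
    where the quotients are at most \<open>M'\<close>.\<close>
  have "ennreal w * Per E \<le> liminf (\<lambda>n. Jt ((r \<circ> g) n) ((s \<circ> g) n) (F' (g n)) / ennreal (beta DIM('a) ((r \<circ> g) n) ((s \<circ> g) n)))"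
    unfolding w_def
  proof (rule liminf_Jt_ge_Per[OF E(1) F'(1) fin[OF E(2)] fin[OF F'R] L])
    show "(r \<circ> g) \<longlonglongrightarrow> 0" "(s \<circ> g) \<longlonglongrightarrow> 1" using rlim slim g by (auto intro: LIMSEQ_subseq_LIMSEQ)
  qed (use r01 s1 in auto)
  also have "\<dots> \<le> liminf (\<lambda>n. ennreal M')"
  proof (intro Liminf_mono always_eventually allI)
    fix n
    have "Jt ((r \<circ> g) n) ((s \<circ> g) n) (F' (g n)) / ennreal (beta DIM('a) ((r \<circ> g) n) ((s \<circ> g) n))
        \<le> ennreal (M' * beta DIM('a) (r (g n)) (s (g n))) / ennreal (beta DIM('a) (r (g n)) (s (g n)))"
      using J'[of "g n"] by (simp add: divide_right_mono_ennreal)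
    also have "\<dots> = ennreal M'" using bpos[of "g n"] by (subst divide_ennreal) (auto simp: M'_def)
    finally show "Jt ((r \<circ> g) n) ((s \<circ> g) n) (F' (g n)) / ennreal (beta DIM('a) ((r \<circ> g) n) ((s \<circ> g) n)) \<le> ennreal M'" .
  qed
  also have "\<dots> = ennreal M'" by (simp add: Liminf_const)
  finally have "ennreal w * Per E < \<infinity>" by (simp add: le_less_trans)
  then have "Per E < \<infinity>" using w by (auto simp: ennreal_mult_less_top)
  with g E conv fin[OF E(2)] show "\<exists>g E. strict_mono g \<and> E \<in> sets lebesgue \<and> emeasure lebesgue E < \<infinity>
                 \<and> Per E < \<infinity> \<and> L1_conv (F \<circ> g) E"
    by (intro exI[of _ g] exI[of _ E]) auto
next
  fix E :: "'a set" and F :: "nat \<Rightarrow> 'a set"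
  assume "E \<in> sets lebesgue \<and> emeasure lebesgue E < \<infinity> \<and>
       (\<forall>n. F n \<in> sets lebesgue \<and> emeasure lebesgue (F n) < \<infinity>) \<and> L1_conv F E"
  then show "ennreal (unit_ball_vol (real (DIM('a) - 1))) * Per E
           \<le> liminf (\<lambda>n. Jt (r n) (s n) (F n) / ennreal (beta DIM('a) (r n) (s n)))"
    using r01 s1 rlim slim by (intro Gamma_liminf) blast+
next
  fix E :: "'a set"
  assume E: "E \<in> sets lebesgue \<and> emeasure lebesgue E < \<infinity>"
  let ?Q = "\<lambda>n. Jt (r n) (s n) E / ennreal (beta DIM('a) (r n) (s n))"
  have conv: "L1_conv (\<lambda>_. E) E" by (simp add: L1_conv_def)
  obtain E' where E': "E' \<in> sets borel" "E' \<subseteq> E" "AE x in lborel. x \<in> E \<longleftrightarrow> x \<in> E'"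
    using E borel_representative[of E] by blast
  have fE: "emeasure lborel E' < \<infinity>"
    using emeasure_mono[OF E'(2) conjunct1[OF E]] conjunct2[OF E] E'(1) by (simp add: le_less_trans)
  have "limsup ?Q \<le> ennreal (unit_ball_vol (real (DIM('a) - 1))) * Per E"
    using limsup_Jt_le_Per[OF E'(1) fE r01 s1 rlim] Per_cong_AE[OF E'(3)] E E'(1)
    by (simp add: Jt_cong_AE[OF E'(3)])
  \<comment> \<open>The lower bound for the constant sequence closes the chain of inequalities, so
    the quotients have a limit and the upper limit is attained with equality.\<close>
  moreover have "ennreal (unit_ball_vol (real (DIM('a) - 1))) * Per E \<le> liminf ?Q"
    using E by (intro Gamma_liminf[OF _ _ _ _ conv r01 s1 rlim slim]) auto
  moreover have "liminf ?Q \<le> limsup ?Q" by (rule Liminf_le_Limsup) simp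
  ultimately show "\<exists>F::nat \<Rightarrow> 'a set. (\<forall>n. F n \<in> sets lebesgue \<and> emeasure lebesgue (F n) < \<infinity>) \<and> L1_conv F E \<and>
             ennreal (unit_ball_vol (real (DIM('a) - 1))) * Per E
               = limsup (\<lambda>n. Jt (r n) (s n) (F n) / ennreal (beta DIM('a) (r n) (s n)))"
    using E conv by (intro exI[of _ "\<lambda>_. E"]) auto
qed

end
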